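(* Let $p\ge1$, $\alpha\in(0,2]$, let $r_{kl}\in[0,\infty)$, $1\le k,l\le p$, be constants, and let $\mathbf Z=(Z_1,\dots,Z_p)$ be a centered Gaussian random vector with positive-definite covariance matrix given by $\mathrm{Var}(Z_k)=1$ and, for $k\ne l$, $\mathrm{Cov}(Z_k,Z_l)=r_{kl}/\sqrt{r_{kk}r_{ll}}$ if $r_{kk}r_{ll}\neq0$ and $\mathrm{Cov}(Z_k,Z_l)=0$ if $r_{kk}r_{ll}=0$. Let $f:\mathbb R^3\to\mathbb R$ be any one of the following functions (with $D_1,D_2>0$, $D_1\ne D_2$, $\theta_1,\theta_2\in[0,\infty)$, $\theta=\theta_2-\theta_1$): (1) $f(x,y_1,y_2)=e^{-x}+e^{-y_1}+e^{-y_2}$; (2) $f(x,y_1,y_2)=e^{-x}+e^{-y_1}+e^{-y_2}-e^{-y_1-\theta_1}I(y_1>y_2+\theta)-e^{-y_2-\theta_2}I(y_1\le y_2+\theta)$; (3) $f(x,y_1,y_2)=e^{-x}+e^{-y_1}+e^{-y_2}-H_{D_2,\alpha}^{\ln H_\alpha+x,\ \ln H_{D_2,\alpha}+y_2}$; (4) $f(x,y_1,y_2)=e^{-y_1}+e^{-\min(x,y_2)}$; (5) $f(x,y_1,y_2)=e^{-x}+e^{-y_1}+e^{-y_2}-H_{D_1,\alpha}^{\ln H_\alpha+x,\ \ln H_{D_1,\alpha}+y_1}-H_{D_2,\alpha}^{\ln H_\alpha+x,\ \ln H_{D_2,\alpha}+y_2}-H_{D_1,D_2,\alpha}^{\ln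 H_{D_1,\alpha}+y_1,\ \ln H_{D_2,\alpha}+y_2}+H_{D_1,D_2,\alpha}^{\ln H_\alpha+x,\ \ln H_{D_1,\alpha}+y_1,\ \ln H_{D_2,\alpha}+y_2}$; (6) $f(x,y_1,y_2)=e^{-\min(x,y_2)}+e^{-y_1}-H_{D_1,\alpha}^{\ln H_\alpha+\min(x,y_2),\ \ln H_{D_1,\alpha}+y_1}$; (7) $f(x,y_1,y_2)=e^{-\min(x,y_1,y_2)}$. For $\mathbf x,\mathbf y_1,\mathbf y_2\in\mathbb R^p$ (with $y_{ki}$ the $k$th component of $\mathbf y_i$) set $$G(\mathbf x,\mathbf y_1,\mathbf y_2)=\mathbb E\left\{\exp\Big(-\sum_{k=1}^pf(x_k,y_{k1},y_{k2})\,e^{-r_{kk}+\sqrt{2r_{kk}}Z_k}\Big)\right\}.$$ Then $G$ is a non-degenerate multivariate distribution function on $\mathbb R^{3p}$. Moreover, if $r_{kk}=0$ for all $k\le p$, then $G$ has unit Gumbel univariate marginals $\Lambda(x)=e^{-e^{-x}}$, $x\in\mathbb R$, and $G$ is max-stable: $$\big(G(\mathbf x+\ln n,\ \mathbf y_1+\ln n,\ \mathbf y_2+\ln n)\big)^n=G(\mathbf x,\mathbf y_1,\mathbf y_2),\qquad \mathbf x,\mathbf y_1,\mathbf y_2\in\mathbb R^p,\ n\in\mathbb N,\ n\ge1,$$ where $\ln n$ is added to every component.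
   Context: $I(\cdot)$ is the indicator function. "Non-degenerate" means that $G$ is the distribution function of a probability measure on $\mathbb R^{3p}$ that is not a point mass. $B_{\alpha/2}$ is a standard fractional Brownian motion with Hurst index $\alpha/2$ and $B^*_{\alpha/2}(t)=\sqrt2B_{\alpha/2}(t)-|t|^\alpha$, $t\ge0$. With $k$ ranging over $\{0,1,2,\dots\}$, for $D,D_1,D_2>0$ and $x,y,z_1,z_2\in\mathbb R$, define (all limits exist in $(0,\infty)$): $$H_\alpha=\lim_{\lambda\to\infty}\lambda^{-1}\mathbb E\{e^{\max_{t\in[0,\lambda]}B^*_{\alpha/2}(t)}\},\qquad H_{D,\alpha}=\lim_{\lambda\to\infty}\lambda^{-1}\mathbb E\{e^{\max_{k:kD\in[0,\lambda]}B^*_{\alpha/2}(kD)}\},$$ $$H_{D,\alpha}^{x,y}=\lim_{\lambda\to\infty}\lambda^{-1}\int_{\mathbb R}e^s\,\mathbb P\Big\{\max_{t\in[0,\lambda]}B^*_{\alpha/2}(t)>s+x,\ \max_{k:kD\in[0,\lambda]}B^*_{\alpha/2}(kD)>s+y\Big\}ds,$$ $$H_{D_1,D_2,\alpha}^{z_1,z_2}=\lim_{\lambda\to\infty}\lambda^{-1}\int_{\mathbb R}e^s\,\mathbb P\Big\{\max_{k:kD_i\in[0,\lambda]}B^*_{\alpha/2}(kD_i)>s+z_i,\ i=1,2\Big\}ds,$$ $$H_{D_1,D_2,\alpha}^{x,z_1,z_2}=\lim_{\lambda\to\infty}\lambda^{-1}\int_{\mathbb R}e^s\,\mathbb P\Big\{\max_{t\in[0,\lambda]}B^*_{\alpha/2}(t)>s+x,\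 \max_{k:kD_i\in[0,\lambda]}B^*_{\alpha/2}(kD_i)>s+z_i,\ i=1,2\Big\}ds.$$ *)

theory Defs
  imports "HOL-Probability.Probability"
begin

definition covariance :: "'a measure \<Rightarrow> ('a \<Rightarrow> real) \<Rightarrow> ('a \<Rightarrow> real) \<Rightarrow> real" where
  "covariance M X Y =
     (\<integral>\<omega>. (X \<omega> - (\<integral>\<omega>'. X \<omega>' \<partial>M)) * (Y \<omega> - (\<integral>\<omega>'. Y \<omega>' \<partial>M)) \<partial>M)"

text \<open>The case \<open>s = 0\<close> (a point mass) is included, as needed for jointly Gaussian families.\<close>

definition gaussian_rv :: "'a measure \<Rightarrow> ('a \<Rightarrow> real) \<Rightarrow> bool" where
  "gaussian_rv M X \<longleftrightarrow>
     X \<in> borel_measurable M \<and>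
     (\<exists>m s. distr M borel X = distr std_normal_distribution borel (\<lambda>x. m + s * x))"

definition jointly_gaussian :: "'a measure \<Rightarrow> 'i set \<Rightarrow> ('i \<Rightarrow> 'a \<Rightarrow> real) \<Rightarrow> bool" where
  "jointly_gaussian M I X \<longleftrightarrow>
     (\<forall>J c. finite J \<and> J \<subseteq> I \<longrightarrow> gaussian_rv M (\<lambda>\<omega>. \<Sum>i\<in>J. c i * X i \<omega>))"

definition fractional_brownian_motion ::
    "'a measure \<Rightarrow> real \<Rightarrow> (real \<Rightarrow> 'a \<Rightarrow> real) \<Rightarrow> bool" where
  "fractional_brownian_motion M H B \<longleftrightarrow>
     prob_space M \<and>
     jointly_gaussian M {0..} B \<and>
     (\<forall>t\<ge>0. (\<integral>\<omega>. B t \<omega> \<partial>M) = 0) \<and>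
     (\<forall>s\<ge>0. \<forall>t\<ge>0. covariance M (B s) (B t) =
        (\<bar>s\<bar> powr (2 * H) + \<bar>t\<bar> powr (2 * H) - \<bar>t - s\<bar> powr (2 * H)) / 2) \<and>
     (\<forall>\<omega>\<in>space M. continuous_on {0..} (\<lambda>t. B t \<omega>))"

definition Bstar :: "(real \<Rightarrow> 'a \<Rightarrow> real) \<Rightarrow> real \<Rightarrow> real \<Rightarrow> 'a \<Rightarrow> real" where
  "Bstar B \<alpha> t \<omega> = sqrt 2 * B t \<omega> - \<bar>t\<bar> powr \<alpha>"

text \<open>The suprema below are maxima: \<open>Bstar\<close> has continuous paths on \<open>{0..L}\<close> and
  \<open>grid D L\<close> is finite.  Both index sets contain \<open>0\<close> for \<open>L \<ge> 0\<close>.\<close>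

definition max_cont :: "(real \<Rightarrow> 'a \<Rightarrow> real) \<Rightarrow> real \<Rightarrow> real \<Rightarrow> 'a \<Rightarrow> real" where
  "max_cont B \<alpha> L \<omega> = (SUP t\<in>{0..L}. Bstar B \<alpha> t \<omega>)"

definition grid :: "real \<Rightarrow> real \<Rightarrow> real set" where
  "grid D L = {real k * D |k::nat. real k * D \<in> {0..L}}"

definition max_grid :: "(real \<Rightarrow> 'a \<Rightarrow> real) \<Rightarrow> real \<Rightarrow> real \<Rightarrow> real \<Rightarrow> 'a \<Rightarrow> real" where
  "max_grid B \<alpha> D L \<omega> = (SUP t\<in>grid D L. Bstar B \<alpha> t \<omega>)"

text \<open>The constants depend on \<open>M\<close> and \<open>B\<close> only through the law of \<open>B\<close>, i.e. through \<open>\<alpha>\<close>,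
  when \<open>B\<close> is a fractional Brownian motion on \<open>M\<close> with Hurst index \<open>\<alpha> / 2\<close>.\<close>

definition H_cont :: "'a measure \<Rightarrow> (real \<Rightarrow> 'a \<Rightarrow> real) \<Rightarrow> real \<Rightarrow> real" where
  "H_cont M B \<alpha> =
     Lim at_top (\<lambda>L. inverse L * (\<integral>\<omega>. exp (max_cont B \<alpha> L \<omega>) \<partial>M))"

definition H_grid :: "'a measure \<Rightarrow> (real \<Rightarrow> 'a \<Rightarrow> real) \<Rightarrow> real \<Rightarrow> real \<Rightarrow> real" where
  "H_grid M B \<alpha> D =
     Lim at_top (\<lambda>L. inverse L * (\<integral>\<omega>. exp (max_grid B \<alpha> D L \<omega>) \<partial>M))"

definition H_cont_grid ::
    "'a measure \<Rightarrow> (real \<Rightarrow> 'a \<Rightarrow> real) \<Rightarrow> real \<Rightarrow> real \<Rightarrow> real \<Rightarrow> real \<Rightarrow> real" where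
  "H_cont_grid M B \<alpha> D x y =
     Lim at_top (\<lambda>L. inverse L *
       (\<integral>s. exp s * \<P>(\<omega> in M. max_cont B \<alpha> L \<omega> > s + x \<and> max_grid B \<alpha> D L \<omega> > s + y)
         \<partial>lborel))"

definition H_grid_grid ::
    "'a measure \<Rightarrow> (real \<Rightarrow> 'a \<Rightarrow> real) \<Rightarrow> real \<Rightarrow> real \<Rightarrow> real \<Rightarrow> real \<Rightarrow> real \<Rightarrow> real" where
  "H_grid_grid M B \<alpha> D1 D2 z1 z2 =
     Lim at_top (\<lambda>L. inverse L *
       (\<integral>s. exp s * \<P>(\<omega> in M. max_grid B \<alpha> D1 L \<omega> > s + z1 \<and> max_grid B \<alpha> D2 L \<omega> > s + z2)
         \<partial>lborel))"

definition H_cont_grid_grid ::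
    "'a measure \<Rightarrow> (real \<Rightarrow> 'a \<Rightarrow> real) \<Rightarrow> real \<Rightarrow> real \<Rightarrow> real \<Rightarrow> real \<Rightarrow> real \<Rightarrow> real \<Rightarrow> real" where
  "H_cont_grid_grid M B \<alpha> D1 D2 x z1 z2 =
     Lim at_top (\<lambda>L. inverse L *
       (\<integral>s. exp s * \<P>(\<omega> in M. max_cont B \<alpha> L \<omega> > s + x \<and>
                              max_grid B \<alpha> D1 L \<omega> > s + z1 \<and> max_grid B \<alpha> D2 L \<omega> > s + z2)
         \<partial>lborel))"

definition f1 :: "real \<Rightarrow> real \<Rightarrow> real \<Rightarrow> real" where
  "f1 x y1 y2 = exp (- x) + exp (- y1) + exp (- y2)"

definition f2 :: "real \<Rightarrow> real \<Rightarrow> real \<Rightarrow> real \<Rightarrow> real \<Rightarrow> real" where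
  "f2 \<theta>1 \<theta>2 x y1 y2 =
     exp (- x) + exp (- y1) + exp (- y2)
     - exp (- y1 - \<theta>1) * of_bool (y1 > y2 + (\<theta>2 - \<theta>1))
     - exp (- y2 - \<theta>2) * of_bool (y1 \<le> y2 + (\<theta>2 - \<theta>1))"

definition f3 :: "'a measure \<Rightarrow> (real \<Rightarrow> 'a \<Rightarrow> real) \<Rightarrow> real \<Rightarrow> real \<Rightarrow>
    real \<Rightarrow> real \<Rightarrow> real \<Rightarrow> real" where
  "f3 M B \<alpha> D2 x y1 y2 =
     exp (- x) + exp (- y1) + exp (- y2)
     - H_cont_grid M B \<alpha> D2 (ln (H_cont M B \<alpha>) + x) (ln (H_grid M B \<alpha> D2) + y2)"

definition f4 :: "real \<Rightarrow> real \<Rightarrow> real \<Rightarrow> real" where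
  "f4 x y1 y2 = exp (- y1) + exp (- min x y2)"

definition f5 :: "'a measure \<Rightarrow> (real \<Rightarrow> 'a \<Rightarrow> real) \<Rightarrow> real \<Rightarrow> real \<Rightarrow> real \<Rightarrow>
    real \<Rightarrow> real \<Rightarrow> real \<Rightarrow> real" where
  "f5 M B \<alpha> D1 D2 x y1 y2 =
     exp (- x) + exp (- y1) + exp (- y2)
     - H_cont_grid M B \<alpha> D1 (ln (H_cont M B \<alpha>) + x) (ln (H_grid M B \<alpha> D1) + y1)
     - H_cont_grid M B \<alpha> D2 (ln (H_cont M B \<alpha>) + x) (ln (H_grid M B \<alpha> D2) + y2)
     - H_grid_grid M B \<alpha> D1 D2 (ln (H_grid M B \<alpha> D1) + y1) (ln (H_grid M B \<alpha> D2) + y2)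
     + H_cont_grid_grid M B \<alpha> D1 D2
         (ln (H_cont M B \<alpha>) + x) (ln (H_grid M B \<alpha> D1) + y1) (ln (H_grid M B \<alpha> D2) + y2)"

definition f6 :: "'a measure \<Rightarrow> (real \<Rightarrow> 'a \<Rightarrow> real) \<Rightarrow> real \<Rightarrow> real \<Rightarrow>
    real \<Rightarrow> real \<Rightarrow> real \<Rightarrow> real" where
  "f6 M B \<alpha> D1 x y1 y2 =
     exp (- min x y2) + exp (- y1)
     - H_cont_grid M B \<alpha> D1 (ln (H_cont M B \<alpha>) + min x y2) (ln (H_grid M B \<alpha> D1) + y1)"

definition f7 :: "real \<Rightarrow> real \<Rightarrow> real \<Rightarrow> real" where
  "f7 x y1 y2 = exp (- min x (min y1 y2))"

definition positive_definite :: "real^'n^'n \<Rightarrow> bool" where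
  "positive_definite A \<longleftrightarrow> transpose A = A \<and> (\<forall>v. v \<noteq> 0 \<longrightarrow> v \<bullet> (A *v v) > 0)"

definition centered_gaussian_vector :: "'b measure \<Rightarrow> ('b \<Rightarrow> real^'p) \<Rightarrow> real^'p^'p \<Rightarrow> bool" where
  "centered_gaussian_vector N Z \<Sigma> \<longleftrightarrow>
     prob_space N \<and>
     jointly_gaussian N UNIV (\<lambda>k \<omega>. Z \<omega> $ k) \<and>
     (\<forall>k. (\<integral>\<omega>. Z \<omega> $ k \<partial>N) = 0) \<and>
     (\<forall>k l. covariance N (\<lambda>\<omega>. Z \<omega> $ k) (\<lambda>\<omega>. Z \<omega> $ l) = \<Sigma> $ k $ l)"

definition cov_matrix :: "real^'p^'p \<Rightarrow> real^'p^'p" where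
  "cov_matrix r = (\<chi> k l.
     if k = l then 1
     else if r $ k $ k * r $ l $ l \<noteq> 0 then r $ k $ l / sqrt (r $ k $ k * r $ l $ l)
     else 0)"

definition G_fun :: "'b measure \<Rightarrow> ('b \<Rightarrow> real^'p) \<Rightarrow> real^'p^'p \<Rightarrow>
    (real \<Rightarrow> real \<Rightarrow> real \<Rightarrow> real) \<Rightarrow> real^'p \<Rightarrow> real^'p \<Rightarrow> real^'p \<Rightarrow> real" where
  "G_fun N Z r f x y1 y2 =
     (\<integral>\<omega>. exp (- (\<Sum>k\<in>UNIV. f (x $ k) (y1 $ k) (y2 $ k)
                 * exp (- r $ k $ k + sqrt (2 * r $ k $ k) * Z \<omega> $ k))) \<partial>N)"

text \<open>The order on a Euclidean space is componentwise, so \<open>{..z}\<close> is the lower orthant at \<open>z\<close>.\<close>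

definition distribution_function_of ::
    "'c::ordered_euclidean_space measure \<Rightarrow> ('c \<Rightarrow> real) \<Rightarrow> bool" where
  "distribution_function_of \<mu> F \<longleftrightarrow>
     prob_space \<mu> \<and> sets \<mu> = sets borel \<and> (\<forall>z. F z = measure \<mu> {..z})"

definition non_degenerate :: "'c::ordered_euclidean_space measure \<Rightarrow> bool" where
  "non_degenerate \<mu> \<longleftrightarrow> (\<forall>c. \<mu> \<noteq> return borel c)"

text \<open>\<open>Basis\<close> enumerates the coordinates of the Euclidean space.\<close>

definition unit_Gumbel_marginals :: "'c::ordered_euclidean_space measure \<Rightarrow> bool" where
  "unit_Gumbel_marginals \<mu> \<longleftrightarrow>
     (\<forall>b\<in>Basis. \<forall>t. cdf (distr \<mu> borel (\<lambda>z. z \<bullet> b)) t = exp (- exp (- t)))"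

end

theory Submission
  imports Defs "HOL-Real_Asymp.Real_Asymp"
begin

text \<open>Every listed \<open>f\<close> is homogeneous, \<open>f (x + s) (y + s) (z + s) = exp (- s) * f x y z\<close>, lies between
  the maximum and the sum of \<open>exp (- x)\<close>, \<open>exp (- y)\<close>, \<open>exp (- z)\<close>, and is a limit of expectations
  \<open>E (MAX i. U i * exp (- v i))\<close>: by inclusion--exclusion the constants with superscripts are
  combinations of limits of \<open>E (max (c1 * exp M) (max (c2 * exp M1) (c3 * exp M2))) / L\<close>, where
  \<open>M\<close>, \<open>M1\<close>, \<open>M2\<close> are the maxima over the interval and the two grids.  For such an expectation,
  \<open>exp (- E W)\<close> is the limit of \<open>(E (exp (- W / n))) ^ n\<close>, the law of a maximum of \<open>n\<close> independent
  vectors \<open>ln (U i / n) + \<xi>\<close> with \<open>\<xi>\<close> Gumbel, and pointwise limits of distribution functions that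
  remain proper are distribution functions.  Given \<open>Z\<close>, the function \<open>G\<close> is then the distribution
  function of independent vectors with law \<open>exp (- f)\<close>, randomly shifted by
  \<open>- r k k + sqrt (2 * r k k) * Z k\<close>.

  The limits over \<open>L\<close> exist because the expected maximum is invariant under a common shift of the
  index set (Cameron--Martin), so that the expectation is subadditive up to the mismatch of the two
  grids, and this mismatch can be made arbitrarily small at bounded cost since the multiples of
  \<open>D1\<close> return near the multiples of \<open>D2\<close> with bounded gaps.\<close>

section \<open>A space-filling curve with a measurable section\<close>

text \<open>Weak compactness and uniqueness of laws are only ever used on the real line. A vector is
  encoded in one real number by interleaving binary digits, and joint laws are compared one
  coordinate at a time, the remaining coordinates entering as a bounded complex weight. The obstacle
  is \<open>D1 / D2\<close> irrational: no positive shift then maps both grids into themselves, so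
  the expected joint maximum is not plainly subadditive. What makes moving a grid cheap is the
  affinity \<open>E (sqrt (V s * V t)) = exp (- (\<bar>t - s\<bar> powr \<alpha>) / 4)\<close> of
  the values of \<open>V t = exp (Bstar B \<alpha> t)\<close>. Near 1 it bounds the
  \<open>L1\<close> distance of \<open>V s\<close> and \<open>V t\<close>; near 0 it makes distant
  values rarely large together. The latter bounds the limits away from 0, as is necessary because
  their logarithms occur in \<open>f\<close>.\<close>

definition zigzag :: "real \<Rightarrow> real" where
  "zigzag x = max 0 (min 1 (1 / 2 - cos (pi * x)))"

text \<open>Schoenberg's curve: for \<open>t\<close> in the Cantor set, coordinate \<open>i\<close>
  reads the ternary digits at the positions \<open>d * j + i\<close> as binary digits.
  \<open>zigzag\<close> is its plateau function: a clipped cosine of period 2 that is 0 on the first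
  third of the unit interval and 1 on the last, since \<open>cos (pi / 3) = 1 / 2\<close>.\<close>

definition schoenberg :: "nat \<Rightarrow> nat \<Rightarrow> real \<Rightarrow> real" where
  "schoenberg d i t = (\<Sum>j. (1 / 2) ^ Suc j * zigzag (3 ^ (d * j + i) * t))"

definition cantor :: "(nat \<Rightarrow> bool) \<Rightarrow> real" where
  "cantor b = (\<Sum>k. 2 * of_bool (b k) * (1 / 3) ^ Suc k)"

definition bit_of :: "real \<Rightarrow> nat \<Rightarrow> bool" where
  "bit_of u k \<longleftrightarrow> odd \<lfloor>u * 2 ^ Suc k\<rfloor>"

lemma zigzag_bounds: "0 \<le> zigzag x" "zigzag x \<le> 1"
  by (auto simp: zigzag_def)

lemma zigzag_periodic: "zigzag (2 * of_int m + x) = zigzag x"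
proof -
  have "cos (pi * (2 * of_int m + x)) = cos (pi * x + 2 * pi * of_int m)"
    by (simp add: algebra_simps)
  also have "\<dots> = cos (pi * x)"
    by (simp add: cos_add sin_int_2pin cos_int_2pin)
  finally show ?thesis by (simp add: zigzag_def)
qed

lemma zigzag_low: assumes "0 \<le> x" "x \<le> 1 / 3" shows "zigzag x = 0"
proof -
  have "cos (pi / 3) \<le> cos (pi * x)"
    using assms pi_gt_zero by (intro cos_monotone_0_pi_le) (auto simp: field_simps intro: order_trans)
  then show ?thesis by (simp add: cos_60 zigzag_def)
qed

lemma zigzag_high: assumes "2 / 3 \<le> x" "x \<le> 1" shows "zigzag x = 1"
proof -
  have "zigzag x = max 0 (min 1 (1 / 2 + cos (pi * (1 - x))))"
    by (simp add: zigzag_def algebra_simps)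
  moreover have "cos (pi / 3) \<le> cos (pi * (1 - x))"
    using assms pi_gt_zero by (intro cos_monotone_0_pi_le) (auto simp: field_simps intro: order_trans)
  ultimately show ?thesis by (simp add: cos_60)
qed

lemma continuous_zigzag: "continuous_on A zigzag"
  unfolding zigzag_def by (intro continuous_intros)

lemma half_power_sums: "(\<lambda>j. (1 / 2) ^ Suc j :: real) sums 1"
  using power_half_series by simp

lemma continuous_schoenberg: "continuous_on UNIV (schoenberg d i)"
proof -
  have "uniform_limit UNIV (\<lambda>n t. \<Sum>j<n. (1 / 2) ^ Suc j * zigzag (3 ^ (d * j + i) * t))
      (\<lambda>t. \<Sum>j. (1 / 2) ^ Suc j * zigzag (3 ^ (d * j + i) * t)) sequentially"
    by (rule Weierstrass_m_test[OF _ sums_summable[OF half_power_sums]])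
       (auto simp: zigzag_bounds abs_mult mult_le_cancel_left1)
  then have "continuous_on UNIV (\<lambda>t. \<Sum>j. (1 / 2) ^ Suc j * zigzag (3 ^ (d * j + i) * t))"
    by (rule uniform_limit_theorem[rotated])
       (auto intro!: always_eventually continuous_intros
          continuous_on_compose2[OF continuous_zigzag[of UNIV]])
  then show ?thesis by (simp add: schoenberg_def)
qed

lemma third_power_sums: "(\<lambda>k. 2 * (1 / 3) ^ Suc k :: real) sums 1"
  using sums_mult[OF geometric_sums[of "1/3::real"], of "2/3"] by (simp add: mult_ac)

lemma summable_cantor: "summable (\<lambda>k. 2 * of_bool (b k) * (1 / 3 :: real) ^ Suc k)"
  by (rule summable_comparison_test_ev[OF _ sums_summable[OF third_power_sums]]) auto

lemma cantor_bounds: "0 \<le> cantor b" "cantor b \<le> 1"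
proof -
  show "0 \<le> cantor b"
    unfolding cantor_def by (intro suminf_nonneg summable_cantor) simp
  have "cantor b \<le> (\<Sum>k. 2 * (1 / 3) ^ Suc k)"
    unfolding cantor_def
    by (intro suminf_le summable_cantor sums_summable[OF third_power_sums]) auto
  then show "cantor b \<le> 1" using third_power_sums sums_unique by fastforce
qed

lemma cantor_step: "cantor b = 2 * of_bool (b 0) / 3 + cantor (\<lambda>k. b (Suc k)) / 3"
proof -
  have "cantor b = (\<Sum>k. 2 * of_bool (b (Suc k)) * (1 / 3) ^ Suc (Suc k)) + 2 * of_bool (b 0) * (1/3)"
    unfolding cantor_def using suminf_split_head[OF summable_cantor[of b]] by simp
  also have "(\<Sum>k. 2 * of_bool (b (Suc k)) * (1 / 3 :: real) ^ Suc (Suc k))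
     = (\<Sum>k. (2 * of_bool (b (Suc k)) * (1 / 3) ^ Suc k) * (1/3))"
    by (simp add: mult_ac)
  also have "\<dots> = cantor (\<lambda>k. b (Suc k)) * (1/3)"
    unfolding cantor_def by (rule suminf_mult2[symmetric]) (rule summable_cantor)
  finally show ?thesis by simp
qed

text \<open>Multiplication by \<open>3 ^ m\<close> moves digit \<open>m\<close> to the front. The
  digits passed on the way are 0 or 2, so they contribute an even integer, which the period 2
  absorbs; the leading digit then selects a plateau.\<close>

lemma zigzag_cantor: "zigzag (3 ^ m * cantor b) = of_bool (b m)"
proof (induction m arbitrary: b)
  case 0
  show ?case
    using cantor_bounds[of "\<lambda>k. b (Suc k)"] cantor_step[of b]
    by (cases "b 0") (auto intro!: zigzag_low zigzag_high)
next
  case (Suc m)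
  have "3 ^ Suc m * cantor b
      = 2 * of_int (3 ^ m * of_bool (b 0)) + 3 ^ m * cantor (\<lambda>k. b (Suc k))"
    by (subst cantor_step) (simp add: algebra_simps)
  then show ?case using Suc.IH[of "\<lambda>k. b (Suc k)"] by (simp only: zigzag_periodic)
qed

lemma bit_of_partial_sum:
  assumes "0 \<le> u" "u < 1"
  shows "(\<Sum>k<n. (1 / 2 :: real) ^ Suc k * of_bool (bit_of u k)) = of_int \<lfloor>u * 2 ^ n\<rfloor> / 2 ^ n"
proof (induction n)
  case 0
  then show ?case using floor_eq_iff[of u 0] assms by simp
next
  case (Suc n)
  define y where "y = u * 2 ^ n"
  have *: "\<lfloor>2 * y\<rfloor> = 2 * \<lfloor>y\<rfloor> + of_bool (odd \<lfloor>2 * y\<rfloor>)"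
  proof -
    have "\<lfloor>2 * y\<rfloor> = 2 * \<lfloor>y\<rfloor> \<or> \<lfloor>2 * y\<rfloor> = 2 * \<lfloor>y\<rfloor> + 1" by linarith
    then show ?thesis by auto
  qed
  have "(\<Sum>k<Suc n. (1 / 2 :: real) ^ Suc k * of_bool (bit_of u k))
      = of_int \<lfloor>y\<rfloor> / 2 ^ n + (1 / 2) ^ Suc n * of_bool (odd \<lfloor>2 * y\<rfloor>)"
    using Suc by (simp add: y_def bit_of_def mult_ac)
  also have "\<dots> = (2 * of_int \<lfloor>y\<rfloor> + of_bool (odd \<lfloor>2 * y\<rfloor>)) / 2 ^ Suc n"
    by (simp add: field_simps)
  also have "\<dots> = of_int \<lfloor>2 * y\<rfloor> / 2 ^ Suc n"
    by (subst (2) *) simp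
  finally show ?case by (simp add: y_def mult_ac)
qed

lemma bit_of_sums:
  assumes "0 \<le> u" "u < 1"
  shows "(\<lambda>k. (1 / 2 :: real) ^ Suc k * of_bool (bit_of u k)) sums u"
proof -
  have "(\<lambda>n. of_int \<lfloor>u * 2 ^ n\<rfloor> / 2 ^ n) \<longlonglongrightarrow> u"
  proof (rule real_tendsto_sandwich)
    show "\<forall>\<^sub>F n in sequentially. u - (1 / 2) ^ n \<le> of_int \<lfloor>u * 2 ^ n\<rfloor> / 2 ^ n"
    proof (intro always_eventually allI)
      fix n
      have "u * 2 ^ n - 1 \<le> of_int \<lfloor>u * 2 ^ n\<rfloor>" by linarith
      then have "(u * 2 ^ n - 1) / 2 ^ n \<le> of_int \<lfloor>u * 2 ^ n\<rfloor> / 2 ^ n"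
        by (intro divide_right_mono) auto
      then show "u - (1 / 2) ^ n \<le> of_int \<lfloor>u * 2 ^ n\<rfloor> / 2 ^ n"
        by (simp add: diff_divide_distrib power_one_over)
    qed
    show "\<forall>\<^sub>F n in sequentially. of_int \<lfloor>u * 2 ^ n\<rfloor> / 2 ^ n \<le> u"
      by (intro always_eventually allI) (simp add: divide_le_eq)
    have "(\<lambda>n. u - (1 / 2) ^ n) \<longlonglongrightarrow> u - 0"
      by (intro tendsto_intros LIMSEQ_power_zero) auto
    then show "(\<lambda>n. u - (1 / 2) ^ n) \<longlonglongrightarrow> u" by simp
  qed simp
  then show ?thesis unfolding sums_def bit_of_partial_sum[OF assms] .
qed

text \<open>A right inverse of the curve: digit \<open>k\<close> is taken from coordinate
  \<open>k mod d\<close> at binary position \<open>k div d\<close>, which inverts the index map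
  \<open>d * j + i\<close>.\<close>

definition interleave :: "nat \<Rightarrow> (nat \<Rightarrow> real) \<Rightarrow> real" where
  "interleave d u = cantor (\<lambda>k. bit_of (u (k mod d)) (k div d))"

lemma schoenberg_interleave:
  assumes "i < d" "0 \<le> u i" "u i < 1"
  shows "schoenberg d i (interleave d u) = u i"
proof -
  have "zigzag (3 ^ (d * j + i) * interleave d u) = of_bool (bit_of (u i) j)" for j
    using \<open>i < d\<close> unfolding interleave_def zigzag_cantor by simp
  then show ?thesis
    unfolding schoenberg_def using bit_of_sums[OF assms(2,3)] by (simp add: sums_iff)
qed

lemma interleave_bounds: "0 \<le> interleave d u" "interleave d u \<le> 1"
  by (simp_all add: interleave_def cantor_bounds)

lemma measurable_bit_of [measurable]: "Measurable.pred borel (\<lambda>u. bit_of u k)"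
  unfolding bit_of_def by measurable

lemma measurable_interleave:
  assumes [measurable]: "\<And>i. u i \<in> borel_measurable M"
  shows "(\<lambda>x. interleave d (\<lambda>i. u i x)) \<in> borel_measurable M"
  unfolding interleave_def cantor_def by measurable

section \<open>Pointwise limits of distribution functions\<close>

definition is_df :: "('c::ordered_euclidean_space \<Rightarrow> real) \<Rightarrow> bool" where
  "is_df F \<longleftrightarrow> (\<exists>\<mu>. distribution_function_of \<mu> F)"

text \<open>Compresses the line to \<open>(0, 1)\<close>, where binary digits are available; the two
  endpoints stand for mass lost at infinity.\<close>

definition logistic :: "real \<Rightarrow> real" where
  "logistic x = 1 / (1 + exp (- x))"

definition logit :: "real \<Rightarrow> real" where
  "logit u = ln (u / (1 - u))"

lemma logistic_bounds: "0 < logistic x" "logistic x < 1"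
  by (simp_all add: logistic_def field_simps add_pos_pos)

lemma logistic_mono_iff: "logistic x \<le> logistic y \<longleftrightarrow> x \<le> y"
  by (simp add: logistic_def field_simps add_pos_pos)

lemma logistic_strict_mono_iff: "logistic x < logistic y \<longleftrightarrow> x < y"
  using logistic_mono_iff[of y x] by linarith

lemma logistic_logit: assumes "0 < u" "u < 1" shows "logistic (logit u) = u"
proof -
  have "exp (- logit u) = (1 - u) / u"
    using assms by (simp add: logit_def exp_minus)
  moreover have "1 + (1 - u) / u = 1 / u"
    using assms by (simp add: field_simps)
  ultimately show ?thesis by (simp add: logistic_def)
qed

lemma logit_le_iff: assumes "0 < u" "u < 1" shows "logit u \<le> x \<longleftrightarrow> u \<le> logistic x"
  using logistic_mono_iff[of "logit u" x] logistic_logit[OF assms] by simp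

lemma measurable_logistic [measurable]: "logistic \<in> borel_measurable borel"
  unfolding logistic_def by measurable

lemma measurable_logit [measurable]: "logit \<in> borel_measurable borel"
  unfolding logit_def by measurable

lemma logistic_at_top: "(\<lambda>k. logistic (real k)) \<longlonglongrightarrow> 1"
proof -
  have "(\<lambda>k. exp (- real k)) \<longlonglongrightarrow> 0"
    using LIMSEQ_power_zero[of "exp (-1::real)"] by (simp add: exp_of_nat_mult[symmetric] mult.commute)
  then have "(\<lambda>k. 1 / (1 + exp (- real k))) \<longlonglongrightarrow> 1 / (1 + 0)"
    by (intro tendsto_intros) auto
  then show ?thesis by (simp add: logistic_def)
qed

text \<open>A continuous cut-off from 1 to 0 between \<open>a\<close> and \<open>b\<close>: weak
  convergence can be tested with it, but not with the indicator of a half-line.\<close>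

definition ramp :: "real \<Rightarrow> real \<Rightarrow> real \<Rightarrow> real" where
  "ramp a b x = max 0 (min 1 ((b - x) / (b - a)))"

lemma ramp_bounds: "0 \<le> ramp a b x" "ramp a b x \<le> 1"
  by (auto simp: ramp_def)

lemma ramp_eq_1: "a < b \<Longrightarrow> x \<le> a \<Longrightarrow> ramp a b x = 1"
  by (simp add: ramp_def)

lemma ramp_eq_0: "a < b \<Longrightarrow> b \<le> x \<Longrightarrow> ramp a b x = 0"
  by (simp add: ramp_def divide_le_0_iff)

lemma continuous_ramp: "a < b \<Longrightarrow> continuous_on A (ramp a b)"
  unfolding ramp_def by (intro continuous_intros) auto

lemma borel_measurable_vec_lambda:
  assumes "\<And>i. (\<lambda>x. f x i) \<in> borel_measurable M"
  shows "(\<lambda>x. (\<chi> i. f x i) :: real^'n) \<in> borel_measurable M"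
  using assms by (subst borel_measurable_euclidean_space) (auto simp: Basis_vec_def inner_axis)

lemma borel_measurable_vec_nth [measurable (raw)]:
  assumes "f \<in> borel_measurable M"
  shows "(\<lambda>x. (f x :: real^'n) $ i) \<in> borel_measurable M"
  using assms borel_measurable_euclidean_space[of f M] by (auto simp: Basis_vec_def inner_axis)

lemma tight_unit_interval:
  assumes "\<And>n. real_distribution (\<nu> n)" "\<And>n. AE t in \<nu> n. 0 \<le> t \<and> t \<le> 1"
  shows "tight \<nu>"
  unfolding tight_def
proof (intro conjI allI impI)
  fix \<epsilon> :: real assume "\<epsilon> > 0"
  have "measure (\<nu> n) {-1<..1} > 1 - \<epsilon>" for n
  proof -
    interpret real_distribution "\<nu> n" by fact
    have "prob {-1<..1} = 1"
      using assms(2)[of n] by (intro prob_eq_1[THEN iffD2]) (auto elim!: eventually_mono)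
    then show ?thesis using \<open>\<epsilon> > 0\<close> by simp
  qed
  then show "\<exists>a b. a < b \<and> (\<forall>n. 1 - \<epsilon> < measure (\<nu> n) {a<..b})"
    by (intro exI[of _ "-1"] exI[of _ 1]) auto
qed (use assms in auto)

lemma (in finite_measure) measure_le_integral:
  assumes "A \<in> sets M" "integrable M f" "\<And>x. indicator A x \<le> (f x :: real)"
  shows "measure M A \<le> (\<integral>x. f x \<partial>M)"
proof -
  have "(\<integral>x. indicator A x \<partial>M) \<le> (\<integral>x. f x \<partial>M)"
    using assms by (intro integral_mono) (auto simp: less_top[symmetric])
  then show ?thesis using assms by simp
qed

lemma (in finite_measure) integral_le_measure:
  assumes "A \<in> sets M" "integrable M f" "\<And>x. f x \<le> (indicator A x :: real)"
  shows "(\<integral>x. f x \<partial>M) \<le> measure M A"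
proof -
  have "(\<integral>x. f x \<partial>M) \<le> (\<integral>x. indicator A x \<partial>M)"
    using assms by (intro integral_mono) (auto simp: less_top[symmetric])
  then show ?thesis using assms by simp
qed

text \<open>The measures are transported to the unit interval by a measurable section of a
  space-filling curve; there Helly's selection theorem provides a weak limit, and the curve, being
  continuous, carries this limit back to the cube.\<close>

lemma is_df_limit:
  fixes F :: "real^'n \<Rightarrow> real" and Fn :: "nat \<Rightarrow> real^'n \<Rightarrow> real"
  assumes dfs: "\<And>n. is_df (Fn n)"
    and lim: "\<And>v. (\<lambda>n. Fn n v) \<longlonglongrightarrow> F v"
    and right: "\<And>v. (\<lambda>k. F (v + (\<chi> j. 1 / real (Suc k)))) \<longlonglongrightarrow> F v"
    and top: "(\<lambda>m. F (\<chi> j. real m)) \<longlonglongrightarrow> 1"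
    and bot: "\<And>i m. (\<lambda>k. F (\<chi> j. if j = i then - real k else real m)) \<longlonglongrightarrow> 0"
  shows "is_df F"
proof -
  define d where "d = CARD('n)"
  obtain e :: "'n \<Rightarrow> nat" where e: "bij_betw e UNIV {0..<d}"
    using ex_bij_betw_finite_nat[of "UNIV :: 'n set"] by (auto simp: d_def)
  define e' where "e' = inv_into UNIV e"
  have e_less: "e i < d" and e'_e: "e' (e i) = i" for i
    using e by (auto simp: e'_def bij_betw_def inv_into_f_f)
  from dfs obtain \<mu> where \<mu>: "\<And>n. distribution_function_of (\<mu> n) (Fn n)"
    unfolding is_df_def by metis
  have prob_\<mu>: "prob_space (\<mu> n)" and sets_\<mu>[measurable_cong]: "sets (\<mu> n) = sets borel"
    and Fn: "Fn n v = measure (\<mu> n) {..v}" for n v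
    using \<mu>[of n] by (auto simp: distribution_function_of_def)
  define h where "h i = schoenberg d (e i)" for i
  have cont_h: "continuous_on UNIV (h i)" for i
    unfolding h_def by (rule continuous_schoenberg)
  have [measurable]: "h i \<in> borel_measurable borel" for i
    using cont_h by (rule borel_measurable_continuous_onI)
  define s where "s x = interleave d (\<lambda>k. logistic (x $ e' k))" for x :: "real^'n"
  have [measurable]: "s \<in> borel_measurable borel"
    unfolding s_def by (intro measurable_interleave) measurable
  have h_s: "h i (s x) = logistic (x $ i)" for i x
    using schoenberg_interleave[of "e i" d "\<lambda>k. logistic (x $ e' k)"] e_less[of i]
      logistic_bounds[of "x $ i"]
    by (simp add: h_def s_def e'_e)
  define \<nu> where "\<nu> n = distr (\<mu> n) borel s" for n
  have rd_\<nu>: "real_distribution (\<nu> n)" for n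
    unfolding \<nu>_def by (rule prob_space.real_distribution_distr[OF prob_\<mu>]) measurable
  have "tight \<nu>"
  proof (rule tight_unit_interval[OF rd_\<nu>])
    show "AE t in \<nu> n. 0 \<le> t \<and> t \<le> 1" for n
      unfolding \<nu>_def by (subst AE_distr_iff) (auto simp: s_def interleave_bounds)
  qed
  then obtain r \<nu>' where r: "strict_mono r" and rd_\<nu>': "real_distribution \<nu>'"
    and weak: "weak_conv_m (\<nu> \<circ> id \<circ> r) \<nu>'"
    using tight_imp_convergent_subsubsequence[of \<nu> id] by (auto simp: strict_mono_def)
  interpret \<nu>': real_distribution \<nu>' by (rule rd_\<nu>')
  \<comment> \<open>Candidate for the limit: the law of the curve under the weak limit, read in
    logistic coordinates.\<close>
  define A where "A v = \<nu>'.prob {t. \<forall>i. h i t \<le> logistic (v $ i)}" for v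
  \<comment> \<open>A product of ramps lies between the indicators of the orthants at
    \<open>v\<close> and at \<open>w\<close>, so weak convergence compares \<open>F\<close> and
    \<open>A\<close> up to an arbitrary shift \<delta>, without any search for continuity
    points.\<close>
  have bump: "F v \<le> A (v + (\<chi> j. \<delta>)) \<and> A v \<le> F (v + (\<chi> j. \<delta>))" if "\<delta> > 0" for v \<delta>
  proof -
    define w where "w = v + (\<chi> j. \<delta>)"
    have vw: "logistic (v $ i) < logistic (w $ i)" for i
      using \<open>\<delta> > 0\<close> by (simp add: logistic_strict_mono_iff w_def)
    define \<psi> where "\<psi> u = (\<Prod>i\<in>UNIV. ramp (logistic (v $ i)) (logistic (w $ i)) (u i))"
      for u :: "'n \<Rightarrow> real"
    have \<psi>_bounds: "0 \<le> \<psi> u" "\<psi> u \<le> 1" for u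
      unfolding \<psi>_def by (auto intro!: prod_nonneg prod_le_1 simp: ramp_bounds)
    have \<psi>_1: "\<psi> u = 1" if "\<And>i. u i \<le> logistic (v $ i)" for u
      unfolding \<psi>_def using that vw by (simp add: ramp_eq_1)
    have \<psi>_0: "\<psi> u = 0" if "logistic (w $ i) < u i" for u i
      unfolding \<psi>_def using that vw[of i] ramp_eq_0[of "logistic (v $ i)" "logistic (w $ i)" "u i"]
      by (intro prod_zero) auto
    have cont: "continuous_on UNIV (\<lambda>t. \<psi> (\<lambda>i. h i t))"
      unfolding \<psi>_def
      by (intro continuous_on_prod continuous_on_compose2[OF continuous_ramp[OF vw] cont_h]) auto
    have [measurable]: "(\<lambda>t. \<psi> (\<lambda>i. h i t)) \<in> borel_measurable borel"
      using cont by (rule borel_measurable_continuous_onI)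
    have conv: "(\<lambda>n. \<integral>t. \<psi> (\<lambda>i. h i t) \<partial>(\<nu> \<circ> id \<circ> r) n) \<longlonglongrightarrow> (\<integral>t. \<psi> (\<lambda>i. h i t) \<partial>\<nu>')"
      using cont rd_\<nu> rd_\<nu>' weak \<psi>_bounds
      by (intro weak_conv_imp_integral_bdd_continuous_conv[where B=1])
         (auto simp: continuous_on_eq_continuous_at o_def)
    have \<psi>_int: "(\<integral>t. \<psi> (\<lambda>i. h i t) \<partial>(\<nu> n)) = (\<integral>x. \<psi> (\<lambda>i. logistic (x $ i)) \<partial>\<mu> n)" for n
      unfolding \<nu>_def by (subst integral_distr) (auto simp: h_s)
    have meas\<psi>: "(\<lambda>x::real^'n. \<psi> (\<lambda>i. logistic (x $ i))) \<in> borel_measurable borel"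
      unfolding \<psi>_def ramp_def by measurable
    have bounds_n: "Fn n v \<le> (\<integral>t. \<psi> (\<lambda>i. h i t) \<partial>(\<nu> n)) \<and> (\<integral>t. \<psi> (\<lambda>i. h i t) \<partial>(\<nu> n)) \<le> Fn n w" for n
    proof -
      interpret \<mu>n: prob_space "\<mu> n" by (rule prob_\<mu>)
      have [measurable]: "(\<lambda>x::real^'n. \<psi> (\<lambda>i. logistic (x $ i))) \<in> borel_measurable (\<mu> n)"
        using meas\<psi> measurable_cong_sets[OF sets_\<mu> refl] by blast
      have I: "integrable (\<mu> n) (\<lambda>x. \<psi> (\<lambda>i. logistic (x $ i)))"
        using \<psi>_bounds by (intro \<mu>n.integrable_const_bound[where B=1]) auto
      have S: "{..x} \<in> sets (\<mu> n)" for x :: "real^'n" by (simp add: sets_\<mu>)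
      have "indicator {..v} x \<le> \<psi> (\<lambda>i. logistic (x $ i))" for x
        using \<psi>_bounds \<psi>_1[of "\<lambda>i. logistic (x $ i)"]
        by (auto simp: indicator_def less_eq_vec_def logistic_mono_iff)
      then have 1: "Fn n v \<le> (\<integral>x. \<psi> (\<lambda>i. logistic (x $ i)) \<partial>\<mu> n)"
        unfolding Fn using S I by (intro \<mu>n.measure_le_integral) auto
      have "\<psi> (\<lambda>i. logistic (x $ i)) \<le> indicator {..w} x" for x
        using \<psi>_bounds \<psi>_0[of _ "\<lambda>i. logistic (x $ i)"]
        by (auto simp: indicator_def less_eq_vec_def logistic_strict_mono_iff not_le)
      then have 2: "(\<integral>x. \<psi> (\<lambda>i. logistic (x $ i)) \<partial>\<mu> n) \<le> Fn n w"
        unfolding Fn using S I by (intro \<mu>n.integral_le_measure) auto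
      show ?thesis using 1 2 by (simp add: \<psi>_int)
    qed
    have sub: "(\<lambda>n. Fn (r n) x) \<longlonglongrightarrow> F x" for x
      using LIMSEQ_subseq_LIMSEQ[OF lim r] by (simp add: o_def)
    have F1: "F v \<le> (\<integral>t. \<psi> (\<lambda>i. h i t) \<partial>\<nu>')" and F2: "(\<integral>t. \<psi> (\<lambda>i. h i t) \<partial>\<nu>') \<le> F w"
      using bounds_n conv
      by (auto intro!: LIMSEQ_le[OF sub conv] LIMSEQ_le[OF conv sub] exI[of _ 0])
    have I: "integrable \<nu>' (\<lambda>t. \<psi> (\<lambda>i. h i t))"
      using \<psi>_bounds by (intro \<nu>'.integrable_const_bound[where B=1]) auto
    have "indicator {t. \<forall>i. h i t \<le> logistic (v $ i)} t \<le> \<psi> (\<lambda>i. h i t)" for t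
      using \<psi>_bounds \<psi>_1[of "\<lambda>i. h i t"] by (auto simp: indicator_def)
    then have "A v \<le> (\<integral>t. \<psi> (\<lambda>i. h i t) \<partial>\<nu>')"
      unfolding A_def using I by (intro \<nu>'.measure_le_integral) auto
    moreover have "\<psi> (\<lambda>i. h i t) \<le> indicator {t. \<forall>i. h i t \<le> logistic (w $ i)} t" for t
      using \<psi>_bounds \<psi>_0[of _ "\<lambda>i. h i t"] by (auto simp: indicator_def not_le)
    then have "(\<integral>t. \<psi> (\<lambda>i. h i t) \<partial>\<nu>') \<le> A w"
      unfolding A_def using I by (intro \<nu>'.integral_le_measure) auto
    ultimately show ?thesis using F1 F2 by (simp add: w_def)
  qed
  have A_right: "(\<lambda>k. A (v + (\<chi> j. 1 / real (Suc k)))) \<longlonglongrightarrow> A v" for v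
  proof -
    define S where "S k = {t. \<forall>i. h i t \<le> logistic (v $ i + 1 / real (Suc k))}" for k
    have "(\<lambda>k. \<nu>'.prob (S k)) \<longlonglongrightarrow> \<nu>'.prob (\<Inter>k. S k)"
    proof (rule \<nu>'.finite_Lim_measure_decseq)
      show "range S \<subseteq> \<nu>'.events" unfolding S_def by auto
      show "decseq S"
      proof (rule decseq_SucI, unfold S_def, safe)
        fix k t i
        assume "\<forall>i. h i t \<le> logistic (v $ i + 1 / real (Suc (Suc k)))"
        then have "h i t \<le> logistic (v $ i + 1 / real (Suc (Suc k)))" by blast
        also have "\<dots> \<le> logistic (v $ i + 1 / real (Suc k))"
          by (simp add: logistic_mono_iff frac_le)
        finally show "h i t \<le> logistic (v $ i + 1 / real (Suc k))" .
      qed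
    qed
    moreover have "(\<Inter>k. S k) = {t. \<forall>i. h i t \<le> logistic (v $ i)}"
    proof (intro set_eqI iffI)
      fix t assume t: "t \<in> (\<Inter>k. S k)"
      have "h i t \<le> logistic (v $ i)" for i
      proof (rule LIMSEQ_le_const)
        have "isCont logistic (v $ i)" unfolding logistic_def
          by (intro continuous_intros) (use exp_gt_zero[of "- v $ i"] in linarith)
        moreover have "(\<lambda>k. v $ i + 1 / real (Suc k)) \<longlonglongrightarrow> v $ i + 0"
          using LIMSEQ_inverse_real_of_nat by (intro tendsto_intros) (simp add: inverse_eq_divide)
        ultimately show "(\<lambda>k. logistic (v $ i + 1 / real (Suc k))) \<longlonglongrightarrow> logistic (v $ i)"
          using isCont_tendsto_compose by fastforce
      qed (use t in \<open>auto simp: S_def\<close>)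
      then show "t \<in> {t. \<forall>i. h i t \<le> logistic (v $ i)}" by simp
    next
      fix t assume t: "t \<in> {t. \<forall>i. h i t \<le> logistic (v $ i)}"
      have "h i t \<le> logistic (v $ i + 1 / real (Suc k))" for i k
        using t order_trans[of "h i t" "logistic (v $ i)" "logistic (v $ i + 1 / real (Suc k))"]
        by (simp add: logistic_mono_iff)
      then show "t \<in> (\<Inter>k. S k)" by (simp add: S_def)
    qed
    ultimately show ?thesis by (simp add: A_def S_def)
  qed
  \<comment> \<open>Both functions are continuous from above along the diagonal, so the shift can be
    sent to 0.\<close>
  have A_eq: "A v = F v" for v
  proof (rule antisym)
    show "A v \<le> F v"
      using bump by (intro LIMSEQ_le_const[OF right]) (auto intro!: exI[of _ 0])
    show "F v \<le> A v"
      using bump by (intro LIMSEQ_le_const[OF A_right]) (auto intro!: exI[of _ 0])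
  qed
  have [measurable]: "{t. \<forall>i. h i t \<le> logistic (v $ i)} \<in> sets borel" for v by measurable
  have AE_less_1: "AE t in \<nu>'. \<forall>i. h i t < 1"
  proof (subst \<nu>'.prob_eq_1[symmetric, of "{t. \<forall>i. h i t < 1}", simplified])
    have "A (\<chi> j. real m) \<le> \<nu>'.prob {t. \<forall>i. h i t < 1}" for m
      unfolding A_def
      by (intro \<nu>'.finite_measure_mono)
         (auto intro: le_less_trans[OF _ logistic_bounds(2)])
    then have "1 \<le> \<nu>'.prob {t. \<forall>i. h i t < 1}"
      using LIMSEQ_le_const2[OF top] by (auto simp: A_eq)
    then show "\<nu>'.prob {t. \<forall>i. h i t < 1} = 1"
      using \<nu>'.prob_le_1 antisym by blast
  qed
  \<comment> \<open>\<open>bot\<close> speaks of coordinate \<open>i\<close> only while the others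
    are at most \<open>m\<close>. Since almost surely all \<open>h j t < 1\<close>, some
    \<open>m\<close> bounds them, and the countably many \<open>m\<close> together exclude
    \<open>h i t \<le> 0\<close>.\<close>
  have AE_pos_m: "AE t in \<nu>'. \<not> (h i t \<le> 0 \<and> (\<forall>j. h j t \<le> logistic (real m)))" for i m
  proof -
    let ?N = "{t. h i t \<le> 0 \<and> (\<forall>j. h j t \<le> logistic (real m))}"
    have "\<nu>'.prob ?N \<le> A (\<chi> j. if j = i then - real k else real m)" for k
      unfolding A_def
      by (intro \<nu>'.finite_measure_mono)
         (auto intro: order_trans[OF _ less_imp_le[OF logistic_bounds(1)]])
    then have "\<nu>'.prob ?N \<le> 0"
      by (intro LIMSEQ_le_const[OF bot[of i m]]) (auto simp: A_eq)
    then have "\<nu>'.prob ?N = 0" using measure_nonneg[of \<nu>' ?N] by linarith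
    then have "emeasure \<nu>' ?N = 0" by (simp add: \<nu>'.emeasure_eq_measure)
    then show ?thesis by (intro AE_I'[of ?N]) (auto simp: null_sets_def)
  qed
  have AE_pos: "AE t in \<nu>'. \<forall>i. 0 < h i t"
  proof -
    have "AE t in \<nu>'. \<forall>i m. \<not> (h i t \<le> 0 \<and> (\<forall>j. h j t \<le> logistic (real m)))"
      by (simp only: AE_all_countable) (use AE_pos_m in blast)
    with AE_less_1 show ?thesis
    proof eventually_elim
      case (elim t)
      have "\<forall>\<^sub>F m in sequentially. \<forall>j. h j t < logistic (real m)"
        using elim(1) by (intro eventually_all_finite order_tendstoD(1)[OF logistic_at_top]) auto
      then obtain m where "\<forall>j. h j t < logistic (real m)"
        by (auto simp: eventually_sequentially)
      then show ?case using elim(2) by (meson less_imp_le not_le)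
    qed
  qed
  define \<rho> where "\<rho> = distr \<nu>' borel (\<lambda>t. \<chi> i. logit (h i t))"
  have meas: "(\<lambda>t. \<chi> i. logit (h i t)) \<in> borel_measurable \<nu>'"
    by (intro borel_measurable_vec_lambda) auto
  have "measure \<rho> {..v} = F v" for v
  proof -
    have "measure \<rho> {..v} = \<nu>'.prob {t. \<forall>i. logit (h i t) \<le> v $ i}"
      unfolding \<rho>_def using meas by (subst measure_distr) (auto simp: less_eq_vec_def vimage_def)
    also have "\<dots> = A v"
      unfolding A_def
    proof (rule \<nu>'.finite_measure_eq_AE)
      show "AE t in \<nu>'. t \<in> {t. \<forall>i. logit (h i t) \<le> v $ i} \<longleftrightarrow> t \<in> {t. \<forall>i. h i t \<le> logistic (v $ i)}"
        using AE_pos AE_less_1 by eventually_elim (simp add: logit_le_iff)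
    qed auto
    finally show ?thesis by (simp add: A_eq)
  qed
  moreover have "prob_space \<rho>" unfolding \<rho>_def by (rule \<nu>'.prob_space_distr[OF meas])
  ultimately show ?thesis
    unfolding is_df_def distribution_function_of_def by (intro exI[of _ \<rho>]) (simp add: \<rho>_def)
qed

section \<open>Exponent functions of max-stable laws\<close>

lemma is_dfI:
  assumes "prob_space \<mu>" "sets \<mu> = sets borel" "\<And>v. measure \<mu> {..v} = F v"
  shows "is_df F"
  using assms unfolding is_df_def distribution_function_of_def by metis

lemma is_dfE:
  assumes "is_df F"
  obtains \<mu> where "prob_space \<mu>" "sets \<mu> = sets borel" "\<And>v. measure \<mu> {..v} = F v"
  using assms unfolding is_df_def distribution_function_of_def by metis

text \<open>The product belongs to the componentwise maximum of two independent vectors.\<close>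

lemma is_df_mult:
  fixes F G :: "real^'n \<Rightarrow> real"
  assumes "is_df F" "is_df G"
  shows "is_df (\<lambda>v. F v * G v)"
proof -
  obtain \<mu> where \<mu>: "prob_space \<mu>" "sets \<mu> = sets borel" "\<And>v. measure \<mu> {..v} = F v"
    using is_dfE[OF assms(1)] by blast
  obtain \<nu> where \<nu>: "prob_space \<nu>" "sets \<nu> = sets borel" "\<And>v. measure \<nu> {..v} = G v"
    using is_dfE[OF assms(2)] by blast
  note [measurable_cong] = \<mu>(2) \<nu>(2)
  interpret \<mu>: prob_space \<mu> by fact
  interpret \<nu>: prob_space \<nu> by fact
  interpret pair_prob_space \<mu> \<nu> ..
  define m where "m p = (\<chi> i. max (fst p $ i) (snd p $ i))" for p :: "(real^'n) \<times> (real^'n)"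
  have [measurable]: "fst \<in> borel_measurable (\<mu> \<Otimes>\<^sub>M \<nu>)" "snd \<in> borel_measurable (\<mu> \<Otimes>\<^sub>M \<nu>)"
    by measurable
  have [measurable]: "m \<in> borel_measurable (\<mu> \<Otimes>\<^sub>M \<nu>)"
    unfolding m_def by (intro borel_measurable_vec_lambda) measurable
  show ?thesis
  proof (rule is_dfI)
    show "prob_space (distr (\<mu> \<Otimes>\<^sub>M \<nu>) borel m)" by (rule prob_space_distr) measurable
    fix v :: "real^'n"
    have sp: "space \<mu> = UNIV" "space \<nu> = UNIV"
      using sets_eq_imp_space_eq[OF \<mu>(2)] sets_eq_imp_space_eq[OF \<nu>(2)] by auto
    have "m -` {..v} \<inter> space (\<mu> \<Otimes>\<^sub>M \<nu>) = {..v} \<times> {..v}"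
      by (auto simp: m_def less_eq_vec_def space_pair_measure sp)
    then have "measure (distr (\<mu> \<Otimes>\<^sub>M \<nu>) borel m) {..v} = measure (\<mu> \<Otimes>\<^sub>M \<nu>) ({..v} \<times> {..v})"
      by (subst measure_distr) auto
    also have "\<dots> = F v * G v"
      unfolding \<mu>(3)[symmetric] \<nu>(3)[symmetric] measure_def
      by (subst \<nu>.emeasure_pair_measure_Times) (auto simp: enn2real_mult)
    finally show "measure (distr (\<mu> \<Otimes>\<^sub>M \<nu>) borel m) {..v} = F v * G v" .
  qed simp
qed

lemma is_df_power:
  fixes F :: "real^'n \<Rightarrow> real"
  assumes "is_df F" shows "is_df (\<lambda>v. F v ^ Suc n)"
proof (induction n)
  case (Suc n)
  then show ?case using is_df_mult[OF assms Suc] by simp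
qed (use assms in simp)

definition Gumbel :: "real measure" where
  "Gumbel = interval_measure (\<lambda>x. exp (- exp (- x)))"

lemma Gumbel:
  shows real_distribution_Gumbel: "real_distribution Gumbel"
    and measure_Gumbel: "measure Gumbel {..x} = exp (- exp (- x))"
proof -
  have mono: "exp (- exp (- x)) \<le> exp (- exp (- y))" if "x \<le> y" for x y :: real
    using that by simp
  have cont: "continuous (at_right a) (\<lambda>x. exp (- exp (- x)) :: real)" for a
    by (intro continuous_intros)
  have bot: "((\<lambda>x. exp (- exp (- x)) :: real) \<longlongrightarrow> 0) at_bot"
    by real_asymp
  have top: "((\<lambda>x. exp (- exp (- x)) :: real) \<longlongrightarrow> 1) at_top"
    by real_asymp
  show "real_distribution Gumbel" unfolding Gumbel_def
    by (rule real_distribution_interval_measure[OF mono cont bot top])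
  show "measure Gumbel {..x} = exp (- exp (- x))"
    using cdf_interval_measure[OF mono cont bot] by (simp add: cdf_def2 Gumbel_def fun_eq_iff)
qed

definition exp_sum :: "real^'n \<Rightarrow> real" where
  "exp_sum v = (\<Sum>i\<in>UNIV. exp (- v $ i))"

text \<open>For positive \<open>a\<close>, the exponent of the totally dependent vector
  \<open>ln (a i) + \<xi>\<close>, with one Gumbel variable \<xi> for all coordinates.\<close>

definition exp_max :: "('n \<Rightarrow> real) \<Rightarrow> real^'n \<Rightarrow> real" where
  "exp_max a v = (MAX i. a i * exp (- v $ i))"

lemma exp_max_ge: "a i * exp (- v $ i) \<le> exp_max a v"
  unfolding exp_max_def by (intro Max_ge) auto

lemma exp_max_le_iff: "exp_max a v \<le> c \<longleftrightarrow> (\<forall>i. a i * exp (- v $ i) \<le> c)"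
  unfolding exp_max_def by (subst Max_le_iff) auto

lemma exp_max_nonneg: assumes "\<And>i. 0 \<le> a i" shows "0 \<le> exp_max a v"
proof -
  have "0 \<le> a undefined * exp (- v $ undefined)" using assms by simp
  then show ?thesis using exp_max_ge order_trans by blast
qed

lemma exp_max_le_sum: assumes "\<And>i. 0 \<le> a i" shows "exp_max a v \<le> (\<Sum>i\<in>UNIV. a i * exp (- v $ i))"
  unfolding exp_max_le_iff
  by (intro allI member_le_sum) (auto simp: assms)

lemma exp_max_shift: "exp_max a (v + (\<chi> j. s)) = exp (- s) * exp_max a v"
proof -
  \<comment> \<open>Equality of two maxima is read off from equality of their upper bounds, here and
    in several later proofs.\<close>
  have "exp_max a (v + (\<chi> j. s)) \<le> c \<longleftrightarrow> exp (- s) * exp_max a v \<le> c" for c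
  proof -
    have "exp (- s) * exp_max a v \<le> c \<longleftrightarrow> exp_max a v \<le> c * exp s"
      by (simp add: exp_minus field_simps)
    then show ?thesis
      by (simp only: exp_max_le_iff) (simp add: exp_add exp_minus exp_diff field_simps)
  qed
  then show ?thesis by (meson antisym order_refl)
qed

lemma exp_max_scale: assumes "0 \<le> c" shows "exp_max (\<lambda>i. c * a i) v = c * exp_max a v"
proof -
  have "c * exp_max a v = (MAX x \<in> range (\<lambda>i. a i * exp (- v $ i)). c * x)"
    unfolding exp_max_def using assms
    by (intro mono_Max_commute[symmetric, symmetric]) (auto simp: mono_def mult_left_mono)
  then show ?thesis by (simp add: exp_max_def image_image mult_ac)
qed

lemma exp_max_measurable [measurable (raw)]:
  assumes "\<And>i. U i \<in> borel_measurable M"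
  shows "(\<lambda>\<omega>. exp_max (\<lambda>i. U i \<omega>) v) \<in> borel_measurable M"
  unfolding exp_max_def using assms by (intro borel_measurable_Max) auto

lemma is_df_Gumbel_scaled:
  assumes "0 < \<epsilon>" shows "is_df (\<lambda>v. exp (- (\<epsilon> * exp_sum (v :: real^'n))))"
proof -
  interpret G: real_distribution Gumbel by (rule real_distribution_Gumbel)
  interpret P: finite_product_prob_space "\<lambda>_. Gumbel" "UNIV :: 'n set"
    by unfold_locales auto
  define m where "m \<omega> = (\<chi> i. \<omega> i + ln \<epsilon>)" for \<omega> :: "'n \<Rightarrow> real"
  have [measurable]: "m \<in> borel_measurable (Pi\<^sub>M UNIV (\<lambda>_. Gumbel))"
    unfolding m_def by (intro borel_measurable_vec_lambda) measurable
  show ?thesis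
  proof (rule is_dfI)
    show "prob_space (distr (Pi\<^sub>M UNIV (\<lambda>_. Gumbel)) borel m)" by (rule P.prob_space_distr) measurable
    fix v :: "real^'n"
    have "m -` {..v} \<inter> space (Pi\<^sub>M UNIV (\<lambda>_. Gumbel)) = (\<Pi>\<^sub>E i\<in>UNIV. {..v $ i - ln \<epsilon>})"
      by (auto simp: m_def less_eq_vec_def space_PiM PiE_iff algebra_simps)
    then have "measure (distr (Pi\<^sub>M UNIV (\<lambda>_. Gumbel)) borel m) {..v}
        = P.prob (\<Pi>\<^sub>E i\<in>UNIV. {..v $ i - ln \<epsilon>})"
      by (subst measure_distr) auto
    also have "\<dots> = (\<Prod>i\<in>UNIV. exp (- exp (- (v $ i - ln \<epsilon>))))"
      by (subst P.prob_times) (auto simp: measure_Gumbel)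
    also have "\<dots> = (\<Prod>i\<in>UNIV. exp (- (\<epsilon> * exp (- v $ i))))"
      using assms by (simp add: exp_diff exp_minus field_simps)
    also have "\<dots> = exp (- (\<epsilon> * exp_sum v))"
      by (simp add: exp_sum_def exp_sum[symmetric] sum_negf sum_distrib_left)
    finally show "measure (distr (Pi\<^sub>M UNIV (\<lambda>_. Gumbel)) borel m) {..v} = exp (- (\<epsilon> * exp_sum v))" .
  qed simp
qed

text \<open>One Gumbel variable \<xi> independent of \<open>U\<close> drives all coordinates: given
  \<open>U\<close>, the vector \<open>\<xi> + ln (U i)\<close> has the exponent
  \<open>exp_max\<close>. Positivity of \<open>U\<close> gives the logarithms their meaning.\<close>

lemma is_df_expectation_exp_max:
  fixes U :: "'n::finite \<Rightarrow> 'a \<Rightarrow> real"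
  assumes "prob_space M" and [measurable]: "\<And>i. U i \<in> borel_measurable M" and pos: "\<And>i \<omega>. 0 < U i \<omega>"
  shows "is_df (\<lambda>v. \<integral>\<omega>. exp (- exp_max (\<lambda>i. U i \<omega>) v) \<partial>M)"
proof -
  interpret M: prob_space M by fact
  interpret G: real_distribution Gumbel by (rule real_distribution_Gumbel)
  interpret pair_prob_space M Gumbel ..
  define m where "m p = (\<chi> i. snd p + ln (U i (fst p)))" for p
  have [measurable]: "m \<in> borel_measurable (M \<Otimes>\<^sub>M Gumbel)"
    unfolding m_def by (intro borel_measurable_vec_lambda) measurable
  show ?thesis
  proof (rule is_dfI)
    show "prob_space (distr (M \<Otimes>\<^sub>M Gumbel) borel m)" by (rule prob_space_distr) measurable
    fix v :: "real^'n"
    have iff: "\<xi> + ln (U i \<omega>) \<le> v $ i \<longleftrightarrow> U i \<omega> * exp (- v $ i) \<le> exp (- \<xi>)" for \<xi> i \<omega>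
    proof -
      have "U i \<omega> * exp (- v $ i) \<le> exp (- \<xi>) \<longleftrightarrow> exp (\<xi> + ln (U i \<omega>)) \<le> exp (v $ i)"
        using pos[of i \<omega>] by (simp add: exp_add exp_minus field_simps)
      then show ?thesis by simp
    qed
    have fibre: "G.prob {\<xi>. m (\<omega>, \<xi>) \<le> v} = exp (- exp_max (\<lambda>i. U i \<omega>) v)" for \<omega>
    proof -
      have "0 < U undefined \<omega> * exp (- v $ undefined)" using pos by simp
      then have p: "0 < exp_max (\<lambda>i. U i \<omega>) v"
        using exp_max_ge[of "\<lambda>i. U i \<omega>" undefined v] by linarith
      have "m (\<omega>, \<xi>) \<le> v \<longleftrightarrow> exp_max (\<lambda>i. U i \<omega>) v \<le> exp (- \<xi>)" for \<xi>
        by (simp add: m_def less_eq_vec_def exp_max_le_iff iff)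
      also have "\<dots> \<xi> \<longleftrightarrow> \<xi> \<le> - ln (exp_max (\<lambda>i. U i \<omega>) v)" for \<xi>
        using ln_le_cancel_iff[OF p exp_gt_zero[of "- \<xi>"]] by auto
      finally have "{\<xi>. m (\<omega>, \<xi>) \<le> v} = {..- ln (exp_max (\<lambda>i. U i \<omega>) v)}" by auto
      then show ?thesis using p by (simp add: measure_Gumbel)
    qed
    have S: "m -` {..v} \<inter> space (M \<Otimes>\<^sub>M Gumbel) \<in> sets (M \<Otimes>\<^sub>M Gumbel)"
      by (rule measurable_sets[of m _ borel]) auto
    have "measure (distr (M \<Otimes>\<^sub>M Gumbel) borel m) {..v} = measure (M \<Otimes>\<^sub>M Gumbel) (m -` {..v} \<inter> space (M \<Otimes>\<^sub>M Gumbel))"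
      by (subst measure_distr) auto
    also have "\<dots> = enn2real (\<integral>\<^sup>+\<omega>. emeasure Gumbel (Pair \<omega> -` (m -` {..v} \<inter> space (M \<Otimes>\<^sub>M Gumbel))) \<partial>M)"
      unfolding measure_def by (subst G.emeasure_pair_measure_alt[OF S]) auto
    also have "(\<integral>\<^sup>+\<omega>. emeasure Gumbel (Pair \<omega> -` (m -` {..v} \<inter> space (M \<Otimes>\<^sub>M Gumbel))) \<partial>M)
        = (\<integral>\<^sup>+\<omega>. ennreal (exp (- exp_max (\<lambda>i. U i \<omega>) v)) \<partial>M)"
    proof (rule nn_integral_cong)
      fix \<omega> assume "\<omega> \<in> space M"
      then have "Pair \<omega> -` (m -` {..v} \<inter> space (M \<Otimes>\<^sub>M Gumbel)) = {\<xi>. m (\<omega>, \<xi>) \<le> v}"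
        by (auto simp: space_pair_measure)
      then show "emeasure Gumbel (Pair \<omega> -` (m -` {..v} \<inter> space (M \<Otimes>\<^sub>M Gumbel)))
          = ennreal (exp (- exp_max (\<lambda>i. U i \<omega>) v))"
        by (simp add: G.emeasure_eq_measure fibre)
    qed
    also have "enn2real \<dots> = (\<integral>\<omega>. exp (- exp_max (\<lambda>i. U i \<omega>) v) \<partial>M)"
      by (subst integral_eq_nn_integral) auto
    finally show "measure (distr (M \<Otimes>\<^sub>M Gumbel) borel m) {..v} = (\<integral>\<omega>. exp (- exp_max (\<lambda>i. U i \<omega>) v) \<partial>M)" .
  qed simp
qed

text \<open>Homogeneity along the diagonal supplies right continuity and the limit 1; the lower
  bound in every coordinate supplies the limit 0.\<close>

lemma is_df_exp_limit:
  fixes g :: "real^'n \<Rightarrow> real"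
  assumes "\<And>n. is_df (Fn n)" "\<And>v. (\<lambda>n. Fn n v) \<longlonglongrightarrow> exp (- g v)"
    and shift: "\<And>v s. g (v + (\<chi> j. s)) = exp (- s) * g v"
    and "0 < c" and lower: "\<And>v i. c * exp (- v $ i) \<le> g v"
  shows "is_df (\<lambda>v. exp (- g v))"
proof (rule is_df_limit[OF assms(1,2)])
  fix v :: "real^'n"
  have "(\<lambda>k. exp (- (exp (- (1 / real (Suc k))) * g v))) \<longlonglongrightarrow> exp (- (exp (- 0) * g v))"
    using LIMSEQ_inverse_real_of_nat by (intro tendsto_intros) (simp add: inverse_eq_divide)
  then show "(\<lambda>k. exp (- g (v + (\<chi> j. 1 / real (Suc k))))) \<longlonglongrightarrow> exp (- g v)"
    by (simp add: shift)
next
  have "(\<lambda>m. exp (- (exp (- real m) * g 0))) \<longlonglongrightarrow> 1"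
    by real_asymp
  then show "(\<lambda>m. exp (- g (\<chi> j. real m))) \<longlonglongrightarrow> 1"
    using shift[of 0] by simp
next
  fix i :: 'n and m :: nat
  have "(\<lambda>k. exp (- (c * exp (real k)))) \<longlonglongrightarrow> 0"
    using \<open>0 < c\<close> by real_asymp
  then show "(\<lambda>k. exp (- g (\<chi> j. if j = i then - real k else real m))) \<longlonglongrightarrow> 0"
  proof (rule tendsto_sandwich[OF _ _ tendsto_const, rotated 2])
    show "\<forall>\<^sub>F k in sequentially. exp (- g (\<chi> j. if j = i then - real k else real m)) \<le> exp (- (c * exp (real k)))"
      using lower[of "\<chi> j. if j = i then - real _ else real m" i] by (auto intro!: always_eventually)
  qed auto
qed

text \<open>The perturbation by \<open>\<epsilon> * exp_sum\<close> makes the law proper: without it, \<open>exp (- f v)\<close> need not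
  tend to 0 when a single coordinate tends to \<open>-\<infinity>\<close>.\<close>

definition exponent_function :: "(real^'n \<Rightarrow> real) \<Rightarrow> bool" where
  "exponent_function f \<longleftrightarrow>
     (\<forall>v. 0 \<le> f v) \<and> (\<forall>v s. f (v + (\<chi> j. s)) = exp (- s) * f v) \<and>
     (\<forall>\<epsilon>>0. is_df (\<lambda>v. exp (- (f v + \<epsilon> * exp_sum v))))"

lemma exp_sum_shift: "exp_sum (v + (\<chi> j. s)) = exp (- s) * exp_sum v"
  by (simp add: exp_sum_def sum_distrib_left exp_diff exp_minus field_simps)

lemma exp_sum_ge: "exp (- v $ i) \<le> exp_sum v"
  unfolding exp_sum_def by (rule member_le_sum) auto

lemma exp_sum_lower: "0 < \<epsilon> \<Longrightarrow> 0 \<le> x \<Longrightarrow> \<epsilon> * exp (- v $ i) \<le> x + \<epsilon> * exp_sum v"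
  using mult_left_mono[OF exp_sum_ge[of v i] less_imp_le, of \<epsilon>] by linarith

lemma exponent_function_add:
  assumes "exponent_function f" "exponent_function g"
  shows "exponent_function (\<lambda>v. f v + g v)"
  unfolding exponent_function_def
proof (intro conjI allI impI)
  fix \<epsilon> :: real assume "0 < \<epsilon>"
  then have "0 < \<epsilon> / 2" by simp
  then have "is_df (\<lambda>v. exp (- (f v + \<epsilon> / 2 * exp_sum v)) * exp (- (g v + \<epsilon> / 2 * exp_sum v)))"
    using assms unfolding exponent_function_def by (intro is_df_mult) blast+
  then show "is_df (\<lambda>v. exp (- (f v + g v + \<epsilon> * exp_sum v)))"
    by (simp add: exp_add[symmetric] algebra_simps)
qed (use assms in \<open>auto simp: exponent_function_def algebra_simps\<close>)

lemma exponent_function_limit: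
  assumes fn: "\<And>n. exponent_function (fn n)" and lim: "\<And>v. (\<lambda>n. fn n v) \<longlonglongrightarrow> f v"
  shows "exponent_function f"
  unfolding exponent_function_def
proof (intro conjI allI impI)
  show nonneg: "0 \<le> f v" for v
    using fn by (intro LIMSEQ_le_const[OF lim]) (auto simp: exponent_function_def)
  show shift: "f (v + (\<chi> j. s)) = exp (- s) * f v" for v s
    using fn tendsto_mult[OF tendsto_const lim, of "exp (- s)" v]
    by (intro LIMSEQ_unique[OF lim]) (simp add: exponent_function_def)
  fix \<epsilon> :: real assume "0 < \<epsilon>"
  show "is_df (\<lambda>v. exp (- (f v + \<epsilon> * exp_sum v)))"
  proof (rule is_df_exp_limit[where c = \<epsilon>])
    show "is_df (\<lambda>v. exp (- (fn n v + \<epsilon> * exp_sum v)))" for n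
      using fn \<open>0 < \<epsilon>\<close> by (simp add: exponent_function_def)
    show "(\<lambda>n. exp (- (fn n v + \<epsilon> * exp_sum v))) \<longlonglongrightarrow> exp (- (f v + \<epsilon> * exp_sum v))" for v
      by (intro tendsto_intros lim)
    show "f (v + (\<chi> j. s)) + \<epsilon> * exp_sum (v + (\<chi> j. s)) = exp (- s) * (f v + \<epsilon> * exp_sum v)" for v s
      by (simp add: shift exp_sum_shift algebra_simps)
    show "\<epsilon> * exp (- v $ i) \<le> f v + \<epsilon> * exp_sum v" for v i
      using \<open>0 < \<epsilon>\<close> nonneg by (rule exp_sum_lower)
  qed fact
qed

text \<open>The perturbed laws with \<open>\<epsilon> = 1 / (n + 1)\<close> are proper, and the
  lower bound on \<open>f\<close> keeps their limit proper once the perturbation is gone.\<close>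

lemma is_df_exponent_function:
  assumes f: "exponent_function f" and lower: "\<And>v i. exp (- v $ i) \<le> f v"
  shows "is_df (\<lambda>v. exp (- f v))"
proof (rule is_df_exp_limit[where c = 1])
  have "0 < 1 / real (Suc n)" for n by simp
  then show "is_df (\<lambda>v. exp (- (f v + 1 / real (Suc n) * exp_sum v)))" for n
    using f unfolding exponent_function_def by blast
  fix v :: "real^'a"
  have "(\<lambda>n. exp (- (f v + 1 / real (Suc n) * exp_sum v))) \<longlonglongrightarrow> exp (- (f v + 0 * exp_sum v))"
    using LIMSEQ_inverse_real_of_nat by (intro tendsto_intros) (simp add: inverse_eq_divide)
  then show "(\<lambda>n. exp (- (f v + 1 / real (Suc n) * exp_sum v))) \<longlonglongrightarrow> exp (- f v)" by simp
qed (use assms in \<open>auto simp: exponent_function_def\<close>)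

text \<open>Sandwich by \<open>y / (1 + y) \<le> 1 - exp (- y) \<le> y\<close> with
  \<open>y = x n / (n + 1)\<close>.\<close>

lemma scaled_exp_limit:
  assumes "x \<longlonglongrightarrow> (l::real)" "\<And>n. 0 \<le> x n"
  shows "(\<lambda>n. real (Suc n) * (1 - exp (- (x n / real (Suc n))))) \<longlonglongrightarrow> l"
proof (rule tendsto_sandwich[OF _ _ _ assms(1)])
  have "(\<lambda>n. x n / (1 + x n * (1 / real (Suc n)))) \<longlonglongrightarrow> l / (1 + l * 0)"
    using LIMSEQ_inverse_real_of_nat by (intro tendsto_intros assms) (simp_all add: inverse_eq_divide)
  then show "(\<lambda>n. x n / (1 + x n / real (Suc n))) \<longlonglongrightarrow> l" by simp
  show "\<forall>\<^sub>F n in sequentially. x n / (1 + x n / real (Suc n)) \<le> real (Suc n) * (1 - exp (- (x n / real (Suc n))))"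
  proof (intro always_eventually allI)
    fix n
    define y where "y = x n / real (Suc n)"
    have y: "0 \<le> y" using assms(2) by (simp add: y_def)
    have "exp (- y) \<le> 1 / (1 + y)"
      using exp_ge_add_one_self[of y] y by (simp add: exp_minus field_simps)
    then have "y / (1 + y) \<le> 1 - exp (- y)"
      using y by (simp add: field_simps)
    then have "real (Suc n) * (y / (1 + y)) \<le> real (Suc n) * (1 - exp (- y))"
      by (intro mult_left_mono) auto
    then show "x n / (1 + x n / real (Suc n)) \<le> real (Suc n) * (1 - exp (- (x n / real (Suc n))))"
      by (simp add: y_def del: of_nat_Suc)
  qed
  show "\<forall>\<^sub>F n in sequentially. real (Suc n) * (1 - exp (- (x n / real (Suc n)))) \<le> x n"
  proof (intro always_eventually allI)
    fix n
    have "1 - exp (- (x n / real (Suc n))) \<le> x n / real (Suc n)"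
      using exp_ge_add_one_self[of "- (x n / real (Suc n))"] by linarith
    then have "real (Suc n) * (1 - exp (- (x n / real (Suc n)))) \<le> real (Suc n) * (x n / real (Suc n))"
      by (intro mult_left_mono) auto
    then show "real (Suc n) * (1 - exp (- (x n / real (Suc n)))) \<le> x n" by (simp del: of_nat_Suc)
  qed
qed

text \<open>\<open>q n\<close> tends to 1, and \<open>ln (q n)\<close> lies between
  \<open>(q n - 1) / q n\<close> and \<open>q n - 1\<close>.\<close>

lemma power_exp_limit:
  assumes "\<And>n. 0 < q n" "(\<lambda>n. real (Suc n) * (1 - q n)) \<longlonglongrightarrow> a"
  shows "(\<lambda>n. q n ^ Suc n) \<longlonglongrightarrow> exp (- a)"
proof -
  have "(\<lambda>n. 1 / real (Suc n) * (real (Suc n) * (1 - q n))) \<longlonglongrightarrow> 0 * a"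
    using LIMSEQ_inverse_real_of_nat by (intro tendsto_intros assms) (simp add: inverse_eq_divide)
  then have "(\<lambda>n. 1 - q n) \<longlonglongrightarrow> 0" by (simp del: of_nat_Suc)
  then have "(\<lambda>n. 1 - (1 - q n)) \<longlonglongrightarrow> 1 - 0" by (intro tendsto_intros)
  then have q1: "q \<longlonglongrightarrow> 1" by simp
  have "(\<lambda>n. real (Suc n) * ln (q n)) \<longlonglongrightarrow> - a"
  proof (rule tendsto_sandwich)
    show "(\<lambda>n. - (real (Suc n) * (1 - q n)) / q n) \<longlonglongrightarrow> - a"
      using tendsto_divide[OF tendsto_minus[OF assms(2)] q1] by simp
    show "(\<lambda>n. - (real (Suc n) * (1 - q n))) \<longlonglongrightarrow> - a"
      by (intro tendsto_intros assms)
    show "\<forall>\<^sub>F n in sequentially. - (real (Suc n) * (1 - q n)) / q n \<le> real (Suc n) * ln (q n)"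
    proof (intro always_eventually allI)
      fix n
      have "ln (1 / q n) \<le> 1 / q n - 1" using assms(1) by (intro ln_le_minus_one) auto
      then have "- ((1 - q n) / q n) \<le> ln (q n)"
        using assms(1)[of n] by (simp add: ln_div field_simps)
      then have "real (Suc n) * (- ((1 - q n) / q n)) \<le> real (Suc n) * ln (q n)"
        by (intro mult_left_mono) auto
      then show "- (real (Suc n) * (1 - q n)) / q n \<le> real (Suc n) * ln (q n)" by simp
    qed
    show "\<forall>\<^sub>F n in sequentially. real (Suc n) * ln (q n) \<le> - (real (Suc n) * (1 - q n))"
    proof (intro always_eventually allI)
      fix n
      have "ln (q n) \<le> q n - 1" using assms(1) by (intro ln_le_minus_one)
      then have "real (Suc n) * ln (q n) \<le> real (Suc n) * (q n - 1)"
        by (intro mult_left_mono) auto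
      then show "real (Suc n) * ln (q n) \<le> - (real (Suc n) * (1 - q n))" by (simp add: algebra_simps)
    qed
  qed
  then have "(\<lambda>n. exp (real (Suc n) * ln (q n))) \<longlonglongrightarrow> exp (- a)" by (intro tendsto_intros)
  moreover have "exp (real (Suc n) * ln (q n)) = q n ^ Suc n" for n
    by (simp only: exp_of_nat_mult exp_ln[OF assms(1)])
  ultimately show ?thesis by simp
qed

lemma exponent_function_expectation:
  fixes U :: "'n::finite \<Rightarrow> 'a \<Rightarrow> real"
  assumes "prob_space M" and int: "\<And>i. integrable M (U i)" and nonneg: "\<And>i \<omega>. 0 \<le> U i \<omega>"
  shows "exponent_function (\<lambda>v. \<integral>\<omega>. exp_max (\<lambda>i. U i \<omega>) v \<partial>M)"
  unfolding exponent_function_def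
proof (intro conjI allI impI)
  interpret prob_space M by fact
  have [measurable]: "U i \<in> borel_measurable M" for i using int by auto
  let ?f = "\<lambda>v. \<integral>\<omega>. exp_max (\<lambda>i. U i \<omega>) v \<partial>M"
  show nonneg_f: "0 \<le> ?f v" for v by (simp add: exp_max_nonneg nonneg)
  show shift: "?f (v + (\<chi> j. s)) = exp (- s) * ?f v" for v s
    by (simp add: exp_max_shift)
  fix \<epsilon> :: real assume "0 < \<epsilon>"
  define W where "W n v \<omega> = exp_max (\<lambda>i. U i \<omega> + 1 / real (Suc n)) v" for n v \<omega>
  have W_meas [measurable]: "W n v \<in> borel_measurable M" for n v
    unfolding W_def by measurable
  have W_nonneg: "0 \<le> W n v \<omega>" for n v \<omega>
    unfolding W_def by (intro exp_max_nonneg) (simp add: nonneg)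
  have W_scaled: "W n v \<omega> / real (Suc n) = exp_max (\<lambda>i. (U i \<omega> + 1 / real (Suc n)) / real (Suc n)) v" for n v \<omega>
    using exp_max_scale[of "1 / real (Suc n)" "\<lambda>i. U i \<omega> + 1 / real (Suc n)" v] by (simp add: W_def)
  define q where "q n v = (\<integral>\<omega>. exp (- (W n v \<omega> / real (Suc n))) \<partial>M)" for n v
  have int_exp: "integrable M (\<lambda>\<omega>. exp (- (W n v \<omega> / real (Suc n))))" for n v
    by (rule integrable_const_bound[where B=1]) (auto simp: W_nonneg)
  have q_pos: "0 < q n v" for n v
  proof -
    have "q n v \<noteq> 0"
    proof
      assume "q n v = 0"
      then have "AE \<omega> in M. exp (- (W n v \<omega> / real (Suc n))) = 0"
        unfolding q_def by (subst (asm) integral_nonneg_eq_0_iff_AE[OF int_exp]) auto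
      then show False by simp
    qed
    moreover have "0 \<le> q n v" unfolding q_def by (intro integral_nonneg_AE) auto
    ultimately show ?thesis by linarith
  qed
  have q_lim: "(\<lambda>n. q n v ^ Suc n) \<longlonglongrightarrow> exp (- ?f v)" for v
  proof (rule power_exp_limit[OF q_pos])
    have "(\<lambda>n. \<integral>\<omega>. real (Suc n) * (1 - exp (- (W n v \<omega> / real (Suc n)))) \<partial>M) \<longlonglongrightarrow> ?f v"
    proof (rule integral_dominated_convergence)
      show "integrable M (\<lambda>\<omega>. \<Sum>i\<in>UNIV. (U i \<omega> + 1) * exp (- v $ i))"
        using int by (intro Bochner_Integration.integrable_sum integrable_mult_left) auto
      show "AE \<omega> in M. (\<lambda>n. real (Suc n) * (1 - exp (- (W n v \<omega> / real (Suc n))))) \<longlonglongrightarrow> exp_max (\<lambda>i. U i \<omega>) v"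
      proof (intro AE_I2 scaled_exp_limit W_nonneg)
        fix \<omega>
        show "(\<lambda>n. W n v \<omega>) \<longlonglongrightarrow> exp_max (\<lambda>i. U i \<omega>) v"
        proof (rule tendsto_sandwich[OF _ _ tendsto_const])
          show "\<forall>\<^sub>F n in sequentially. exp_max (\<lambda>i. U i \<omega>) v \<le> W n v \<omega>"
            unfolding exp_max_le_iff
          proof (intro always_eventually allI)
            fix n i
            have "U i \<omega> * exp (- v $ i) \<le> (U i \<omega> + 1 / real (Suc n)) * exp (- v $ i)"
              by (intro mult_right_mono) auto
            also have "\<dots> \<le> W n v \<omega>"
              unfolding W_def using exp_max_ge[of "\<lambda>i. U i \<omega> + 1 / real (Suc n)" i v] .
            finally show "U i \<omega> * exp (- v $ i) \<le> W n v \<omega>" .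
          qed
          show "\<forall>\<^sub>F n in sequentially. W n v \<omega> \<le> exp_max (\<lambda>i. U i \<omega>) v + 1 / real (Suc n) * exp_sum v"
            unfolding exp_max_le_iff W_def
          proof (intro always_eventually allI)
            fix n i
            have "1 / real (Suc n) * exp (- v $ i) \<le> 1 / real (Suc n) * exp_sum v"
              by (intro mult_left_mono exp_sum_ge) auto
            then show "(U i \<omega> + 1 / real (Suc n)) * exp (- v $ i)
                \<le> exp_max (\<lambda>i. U i \<omega>) v + 1 / real (Suc n) * exp_sum v"
              using exp_max_ge[of "\<lambda>i. U i \<omega>" i v] by (simp only: distrib_right)
          qed
          have "(\<lambda>n. exp_max (\<lambda>i. U i \<omega>) v + 1 / real (Suc n) * exp_sum v)
             \<longlonglongrightarrow> exp_max (\<lambda>i. U i \<omega>) v + 0 * exp_sum v"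
            using LIMSEQ_inverse_real_of_nat by (intro tendsto_intros) (simp add: inverse_eq_divide)
          then show "(\<lambda>n. exp_max (\<lambda>i. U i \<omega>) v + 1 / real (Suc n) * exp_sum v)
             \<longlonglongrightarrow> exp_max (\<lambda>i. U i \<omega>) v" by simp
        qed
      qed
      show "AE \<omega> in M. norm (real (Suc n) * (1 - exp (- (W n v \<omega> / real (Suc n)))))
          \<le> (\<Sum>i\<in>UNIV. (U i \<omega> + 1) * exp (- v $ i))" for n
      proof (rule AE_I2)
        fix \<omega>
        have "1 - exp (- (W n v \<omega> / real (Suc n))) \<le> W n v \<omega> / real (Suc n)"
          using exp_ge_add_one_self[of "- (W n v \<omega> / real (Suc n))"] by linarith
        then have "real (Suc n) * (1 - exp (- (W n v \<omega> / real (Suc n)))) \<le> real (Suc n) * (W n v \<omega> / real (Suc n))"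
          by (intro mult_left_mono) auto
        also have "\<dots> = W n v \<omega>" by simp
        also have "\<dots> \<le> (\<Sum>i\<in>UNIV. (U i \<omega> + 1 / real (Suc n)) * exp (- v $ i))"
          unfolding W_def by (intro exp_max_le_sum) (simp add: nonneg)
        also have "\<dots> \<le> (\<Sum>i\<in>UNIV. (U i \<omega> + 1) * exp (- v $ i))"
          by (intro sum_mono mult_right_mono) auto
        finally show "norm (real (Suc n) * (1 - exp (- (W n v \<omega> / real (Suc n)))))
            \<le> (\<Sum>i\<in>UNIV. (U i \<omega> + 1) * exp (- v $ i))"
          using W_nonneg[of n v \<omega>] by (simp add: abs_mult del: of_nat_Suc)
      qed
    qed measurable
    moreover have "(\<integral>\<omega>. real (Suc n) * (1 - exp (- (W n v \<omega> / real (Suc n)))) \<partial>M) = real (Suc n) * (1 - q n v)" for n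
    proof -
      have "(\<integral>\<omega>. 1 - exp (- (W n v \<omega> / real (Suc n))) \<partial>M) = 1 - q n v"
        unfolding q_def by (subst Bochner_Integration.integral_diff[OF _ int_exp]) (auto simp: prob_space simp del: of_nat_Suc)
      then show ?thesis by (simp only: integral_mult_right_zero)
    qed
    ultimately show "(\<lambda>n. real (Suc n) * (1 - q n v)) \<longlonglongrightarrow> ?f v" by simp
  qed
  show "is_df (\<lambda>v. exp (- (?f v + \<epsilon> * exp_sum v)))"
  proof (rule is_df_exp_limit[where c = \<epsilon>])
    \<comment> \<open>The factor with \<epsilon> comes from taking the maximum with an independent
      vector of shifted Gumbel variables.\<close>
    show "is_df (\<lambda>v. exp (- (\<epsilon> * exp_sum v)) * q n v ^ Suc n)" for n
    proof (intro is_df_mult is_df_Gumbel_scaled is_df_power)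
      show "is_df (q n)"
        unfolding q_def W_scaled
        by (intro is_df_expectation_exp_max assms(1)) (auto simp: nonneg add_nonneg_pos)
    qed fact
    show "(\<lambda>n. exp (- (\<epsilon> * exp_sum v)) * q n v ^ Suc n) \<longlonglongrightarrow> exp (- (?f v + \<epsilon> * exp_sum v))" for v
      using tendsto_mult[OF tendsto_const q_lim, of "exp (- (\<epsilon> * exp_sum v))" v]
      by (simp add: exp_add[symmetric] add.commute)
    show "?f (v + (\<chi> j. s)) + \<epsilon> * exp_sum (v + (\<chi> j. s)) = exp (- s) * (?f v + \<epsilon> * exp_sum v)" for v s
      by (simp only: shift exp_sum_shift) (simp add: algebra_simps)
    show "\<epsilon> * exp (- v $ i) \<le> ?f v + \<epsilon> * exp_sum v" for v i
      using \<open>0 < \<epsilon>\<close> nonneg_f by (rule exp_sum_lower)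
  qed fact
qed

section \<open>Random shifts of independent max-stable vectors\<close>

lemma is_df_shift_mixture:
  fixes f :: "real \<Rightarrow> real \<Rightarrow> real \<Rightarrow> real" and Z :: "'b \<Rightarrow> real^'p"
  assumes N: "prob_space N" and [measurable]: "\<And>k. (\<lambda>\<omega>. Z \<omega> $ k) \<in> borel_measurable N"
    and df: "is_df (\<lambda>v :: real^3. exp (- f (v $ 1) (v $ 2) (v $ 3)))"
    and shift: "\<And>x y z s. f (x + s) (y + s) (z + s) = exp (- s) * f x y z"
  shows "is_df (\<lambda>(x, y1, y2). G_fun N Z r f x y1 y2)"
proof -
  interpret N: prob_space N by fact
  obtain \<rho> where \<rho>: "prob_space \<rho>" "sets \<rho> = sets borel"
      "\<And>v :: real^3. measure \<rho> {..v} = exp (- f (v $ 1) (v $ 2) (v $ 3))"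
    using is_dfE[OF df] by blast
  note [measurable_cong] = \<rho>(2)
  interpret \<rho>: prob_space \<rho> by fact
  have sp: "space \<rho> = UNIV" using sets_eq_imp_space_eq[OF \<rho>(2)] by auto
  let ?P = "Pi\<^sub>M (UNIV :: 'p set) (\<lambda>_. \<rho>)"
  interpret PP: finite_product_prob_space "\<lambda>_. \<rho>" "UNIV :: 'p set"
    by unfold_locales auto
  interpret pair_prob_space N ?P ..
  define s where "s k \<omega> = - r $ k $ k + sqrt (2 * r $ k $ k) * Z \<omega> $ k" for k \<omega>
  have [measurable]: "s k \<in> borel_measurable N" for k
    unfolding s_def by measurable
  define c where "c i p = (\<chi> k. snd p k $ i + s k (fst p))" for i :: 3 and p :: "'b \<times> ('p \<Rightarrow> real^3)"
  define m where "m p = (c 1 p, c 2 p, c 3 p)" for p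
  have [measurable]: "(\<lambda>p. snd p k) \<in> borel_measurable (N \<Otimes>\<^sub>M ?P)" for k
    by measurable
  have [measurable]: "c i \<in> borel_measurable (N \<Otimes>\<^sub>M ?P)" for i
    unfolding c_def by (intro borel_measurable_vec_lambda) measurable
  have m_meas [measurable]: "m \<in> borel_measurable (N \<Otimes>\<^sub>M ?P)"
    unfolding m_def by (intro borel_measurable_Pair) measurable
  show ?thesis
  proof (rule is_dfI)
    show "prob_space (distr (N \<Otimes>\<^sub>M ?P) borel m)" by (rule prob_space_distr) measurable
    fix v :: "(real^'p) \<times> (real^'p) \<times> (real^'p)"
    obtain x y z where v: "v = (x, y, z)" by (cases v)
    define q :: "'p \<Rightarrow> 'b \<Rightarrow> real^3" where
      "q k \<omega> = vector [x $ k - s k \<omega>, y $ k - s k \<omega>, z $ k - s k \<omega>]" for k \<omega>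
    have fibre: "PP.prob {\<eta> \<in> space ?P. m (\<omega>, \<eta>) \<le> v}
        = exp (- (\<Sum>k\<in>UNIV. f (x $ k) (y $ k) (z $ k) * exp (s k \<omega>)))" for \<omega>
    proof -
      have "{\<eta> \<in> space ?P. m (\<omega>, \<eta>) \<le> v} = (\<Pi>\<^sub>E k\<in>UNIV. {..q k \<omega>})"
        by (auto simp: m_def c_def v less_eq_vec_def q_def forall_3 PiE_iff space_PiM sp algebra_simps)
      then have "PP.prob {\<eta> \<in> space ?P. m (\<omega>, \<eta>) \<le> v} = (\<Prod>k\<in>UNIV. \<rho>.prob {..q k \<omega>})"
        by (simp add: PP.prob_times)
      \<comment> \<open>By homogeneity, subtracting \<open>s k\<close> from all three arguments
        multiplies \<open>f\<close> by \<open>exp (s k)\<close>.\<close>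
      also have "\<dots> = (\<Prod>k\<in>UNIV. exp (- (f (x $ k) (y $ k) (z $ k) * exp (s k \<omega>))))"
        using shift[of "x $ _" "- s _ \<omega>" "y $ _" "z $ _"] by (simp add: \<rho> q_def mult.commute)
      finally show ?thesis by (simp add: exp_sum[symmetric] sum_negf)
    qed
    have S: "m -` {..v} \<inter> space (N \<Otimes>\<^sub>M ?P) \<in> sets (N \<Otimes>\<^sub>M ?P)"
      by (rule measurable_sets[OF m_meas]) (simp add: borel_closed)
    have "measure (distr (N \<Otimes>\<^sub>M ?P) borel m) {..v} = measure (N \<Otimes>\<^sub>M ?P) (m -` {..v} \<inter> space (N \<Otimes>\<^sub>M ?P))"
      by (subst measure_distr) (auto simp: borel_closed)
    also have "\<dots> = enn2real (\<integral>\<^sup>+\<omega>. emeasure ?P (Pair \<omega> -` (m -` {..v} \<inter> space (N \<Otimes>\<^sub>M ?P))) \<partial>N)"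
      unfolding measure_def by (subst PP.emeasure_pair_measure_alt[OF S]) auto
    also have "(\<integral>\<^sup>+\<omega>. emeasure ?P (Pair \<omega> -` (m -` {..v} \<inter> space (N \<Otimes>\<^sub>M ?P))) \<partial>N)
        = (\<integral>\<^sup>+\<omega>. ennreal (exp (- (\<Sum>k\<in>UNIV. f (x $ k) (y $ k) (z $ k) * exp (s k \<omega>)))) \<partial>N)"
    proof (rule nn_integral_cong)
      fix \<omega> assume "\<omega> \<in> space N"
      then have "Pair \<omega> -` (m -` {..v} \<inter> space (N \<Otimes>\<^sub>M ?P)) = {\<eta> \<in> space ?P. m (\<omega>, \<eta>) \<le> v}"
        by (auto simp: space_pair_measure)
      then show "emeasure ?P (Pair \<omega> -` (m -` {..v} \<inter> space (N \<Otimes>\<^sub>M ?P)))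
          = ennreal (exp (- (\<Sum>k\<in>UNIV. f (x $ k) (y $ k) (z $ k) * exp (s k \<omega>))))"
        by (simp only: PP.emeasure_eq_measure fibre)
    qed
    also have "enn2real \<dots> = (\<integral>\<omega>. exp (- (\<Sum>k\<in>UNIV. f (x $ k) (y $ k) (z $ k) * exp (s k \<omega>))) \<partial>N)"
      by (subst integral_eq_nn_integral) auto
    finally show "measure (distr (N \<Otimes>\<^sub>M ?P) borel m) {..v} = (case v of (x, y1, y2) \<Rightarrow> G_fun N Z r f x y1 y2)"
      by (simp add: G_fun_def v s_def)
  qed simp
qed

lemma sum_Basis_vec:
  fixes x :: "real^'p" and g :: "real \<Rightarrow> real"
  shows "(\<Sum>i\<in>Basis. g (x \<bullet> i)) = (\<Sum>k\<in>UNIV. g (x $ k))"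
proof -
  have Basis: "(Basis :: (real^'p) set) = range (\<lambda>k. axis k 1)" by (auto simp: Basis_vec_def)
  have inj: "inj (\<lambda>k :: 'p. axis k (1::real))" by (auto simp: inj_def axis_eq_axis)
  show ?thesis unfolding Basis sum.reindex[OF inj] by (simp add: inner_axis)
qed

lemma sum_Basis_prod:
  fixes h :: "'u::euclidean_space \<times> 'w::euclidean_space \<Rightarrow> real"
  shows "(\<Sum>i\<in>Basis. h i) = (\<Sum>i\<in>Basis. h (i, 0)) + (\<Sum>i\<in>Basis. h (0, i))"
proof -
  have "inj_on (\<lambda>u. (u::'u, 0::'w)) Basis" "inj_on (\<lambda>u. (0::'u, u::'w)) Basis"
    by (auto intro!: inj_onI)
  then show ?thesis
    unfolding Basis_prod_def by (subst sum.union_disjoint) (auto simp: sum.reindex)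
qed

lemma sum_Basis_triple:
  fixes x y z :: "real^'p" and g :: "real \<Rightarrow> real"
  shows "(\<Sum>i\<in>Basis. g ((x, y, z) \<bullet> i)) = (\<Sum>k\<in>UNIV. g (x $ k) + g (y $ k) + g (z $ k))"
  by (simp add: sum_Basis_prod sum_Basis_vec sum.distrib)

lemma marginal_limit:
  fixes \<mu> :: "'c::ordered_euclidean_space measure"
  assumes \<mu>: "prob_space \<mu>" "sets \<mu> = sets borel" and b: "b \<in> Basis"
  shows "(\<lambda>n. measure \<mu> {..real n *\<^sub>R One + (t - real n) *\<^sub>R b}) \<longlonglongrightarrow> cdf (distr \<mu> borel (\<lambda>z. z \<bullet> b)) t"
proof -
  interpret prob_space \<mu> by fact
  note [measurable_cong] = \<mu>(2)
  have sp: "space \<mu> = UNIV" using sets_eq_imp_space_eq[OF \<mu>(2)] by auto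
  \<comment> \<open>Coordinate \<open>b\<close> equals \<open>t\<close>, all others equal
    \<open>n\<close>; the orthants exhaust the half-space that defines the marginal.\<close>
  define w where "w n = real n *\<^sub>R One + (t - real n) *\<^sub>R b" for n
  have w: "w n \<bullet> i = (if i = b then t else real n)" if "i \<in> Basis" for n i
    using that b by (auto simp: w_def inner_add_left inner_Basis)
  have "(\<lambda>n. measure \<mu> {..w n}) \<longlonglongrightarrow> measure \<mu> (\<Union>n. {..w n})"
  proof (rule finite_Lim_measure_incseq)
    show "range (\<lambda>n. {..w n}) \<subseteq> events" by (auto simp: \<mu>)
    show "incseq (\<lambda>n. {..w n})"
      by (rule incseq_SucI) (auto simp: eucl_le[where 'a='c] w split: if_splits)
  qed
  moreover have "(\<Union>n. {..w n}) = {z. z \<bullet> b \<le> t}"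
  proof (intro set_eqI iffI)
    fix z assume "z \<in> {z. z \<bullet> b \<le> t}"
    then have zb: "z \<bullet> b \<le> t" by simp
    obtain n where n: "norm z \<le> real n" using real_arch_simple by blast
    have "z \<bullet> i \<le> w n \<bullet> i" if "i \<in> Basis" for i
      using Basis_le_norm[OF that, of z] zb n that by (auto simp: w)
    then show "z \<in> (\<Union>n. {..w n})" by (auto simp: eucl_le[where 'a='c])
  qed (use b in \<open>auto simp: eucl_le[where 'a='c] w\<close>)
  moreover have "cdf (distr \<mu> borel (\<lambda>z. z \<bullet> b)) t = measure \<mu> {z. z \<bullet> b \<le> t}"
    unfolding cdf_def by (subst measure_distr) (auto simp: vimage_def sp)
  ultimately show ?thesis by (simp add: w_def)
qed

text \<open>The lower bounds on \<open>f\<close> make the law proper; together with the upper bound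
  they pin down the marginals.\<close>

theorem max_stable_mixture:
  fixes f :: "real \<Rightarrow> real \<Rightarrow> real \<Rightarrow> real" and Z :: "'b \<Rightarrow> real^'p"
  assumes N: "prob_space N" and Z [measurable]: "\<And>k. (\<lambda>\<omega>. Z \<omega> $ k) \<in> borel_measurable N"
    and f: "exponent_function (\<lambda>v :: real^3. f (v $ 1) (v $ 2) (v $ 3))"
    and lower: "\<And>x y z. exp (- x) \<le> f x y z" "\<And>x y z. exp (- y) \<le> f x y z" "\<And>x y z. exp (- z) \<le> f x y z"
    and upper: "\<And>x y z. f x y z \<le> exp (- x) + exp (- y) + exp (- z)"
  shows "\<exists>\<mu> :: ((real^'p) \<times> (real^'p) \<times> (real^'p)) measure.
           distribution_function_of \<mu> (\<lambda>(x, y1, y2). G_fun N Z r f x y1 y2) \<and>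
           non_degenerate \<mu> \<and>
           ((\<forall>k. r $ k $ k = 0) \<longrightarrow>
              unit_Gumbel_marginals \<mu> \<and>
              (\<forall>x y1 y2. \<forall>n::nat. n \<ge> 1 \<longrightarrow>
                 (G_fun N Z r f (x + vec (ln (real n))) (y1 + vec (ln (real n)))
                    (y2 + vec (ln (real n)))) ^ n
                 = G_fun N Z r f x y1 y2))"
proof -
  interpret N: prob_space N by fact
  have shift: "f (x + s) (y + s) (z + s) = exp (- s) * f x y z" for x y z s
  proof -
    define v :: "real^3" where "v = vector [x, y, z]"
    have "f ((v + (\<chi> j. s)) $ 1) ((v + (\<chi> j. s)) $ 2) ((v + (\<chi> j. s)) $ 3) = exp (- s) * f (v $ 1) (v $ 2) (v $ 3)"
      using f unfolding exponent_function_def by blast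
    then show ?thesis by (simp add: v_def)
  qed
  have "is_df (\<lambda>v :: real^3. exp (- f (v $ 1) (v $ 2) (v $ 3)))"
  proof (rule is_df_exponent_function[OF f])
    show "exp (- v $ i) \<le> f (v $ 1) (v $ 2) (v $ 3)" for v :: "real^3" and i
      using lower exhaust_3[of i] by auto
  qed
  from is_df_shift_mixture[OF N Z this shift, of r]
  obtain \<mu> :: "((real^'p) \<times> (real^'p) \<times> (real^'p)) measure"
    where \<mu>: "distribution_function_of \<mu> (\<lambda>(x, y1, y2). G_fun N Z r f x y1 y2)"
    unfolding is_df_def by blast
  have prob_\<mu>: "prob_space \<mu>" and sets_\<mu>: "sets \<mu> = sets borel"
    and F: "G_fun N Z r f x y1 y2 = measure \<mu> {..(x, y1, y2)}" for x y1 y2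
    using \<mu> unfolding distribution_function_of_def by auto
  have f_pos: "0 < f x y z" for x y z
    using lower(1)[of x y z] exp_gt_zero[of "- x"] by linarith
  \<comment> \<open>A point mass gives every orthant probability 0 or 1, but \<open>G\<close> at the
    origin is the mean of a variable strictly between 0 and 1.\<close>
  have "non_degenerate \<mu>"
    unfolding non_degenerate_def
  proof (intro allI notI)
    fix c assume c: "\<mu> = return borel c"
    let ?e = "\<lambda>\<omega>. exp (- (\<Sum>k\<in>UNIV. f (0 $ k) (0 $ k) (0 $ k) * exp (- r $ k $ k + sqrt (2 * r $ k $ k) * Z \<omega> $ k)))"
    have pos: "0 < (\<Sum>k\<in>UNIV. f (0 $ k) (0 $ k) (0 $ k) * exp (- r $ k $ k + sqrt (2 * r $ k $ k) * Z \<omega> $ k))" for \<omega>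
      by (intro sum_pos) (auto simp: f_pos)
    have int: "integrable N ?e"
      using pos by (intro N.integrable_const_bound[where B=1]) (auto intro: less_imp_le)
    have "G_fun N Z r f 0 0 0 = indicator {..(0, 0, 0)} c"
      unfolding F c by (simp add: measure_return)
    then have "G_fun N Z r f 0 0 0 = 0 \<or> G_fun N Z r f 0 0 0 = 1"
      by (auto simp: indicator_def)
    then show False
    proof
      assume "G_fun N Z r f 0 0 0 = 0"
      then have "AE \<omega> in N. ?e \<omega> = 0"
        unfolding G_fun_def by (subst (asm) integral_nonneg_eq_0_iff_AE[OF int]) auto
      then show False by simp
    next
      assume "G_fun N Z r f 0 0 0 = 1"
      then have "(\<integral>\<omega>. 1 - ?e \<omega> \<partial>N) = 0"
        unfolding G_fun_def by (subst Bochner_Integration.integral_diff[OF _ int]) (auto simp: N.prob_space)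
      then have "AE \<omega> in N. 1 - ?e \<omega> = 0"
        using pos int by (subst (asm) integral_nonneg_eq_0_iff_AE) (auto intro: less_imp_le)
      then have "AE \<omega> in N. False"
        using pos by (auto simp: less_imp_neq[symmetric] elim!: eventually_mono)
      then show False by simp
    qed
  qed
  moreover have "unit_Gumbel_marginals \<mu> \<and> (\<forall>x y1 y2. \<forall>n::nat. n \<ge> 1 \<longrightarrow>
                 (G_fun N Z r f (x + vec (ln (real n))) (y1 + vec (ln (real n)))
                    (y2 + vec (ln (real n)))) ^ n
                 = G_fun N Z r f x y1 y2)" if r0: "\<forall>k. r $ k $ k = 0"
  proof
    have G: "G_fun N Z r f x y z = exp (- (\<Sum>k\<in>UNIV. f (x $ k) (y $ k) (z $ k)))" for x y z
      using r0 by (simp add: G_fun_def N.prob_space)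
    show "\<forall>x y1 y2. \<forall>n::nat. n \<ge> 1 \<longrightarrow>
                 (G_fun N Z r f (x + vec (ln (real n))) (y1 + vec (ln (real n)))
                    (y2 + vec (ln (real n)))) ^ n
                 = G_fun N Z r f x y1 y2"
    proof (intro allI impI)
      fix x y z :: "real^'p" and n :: nat assume n: "n \<ge> 1"
      let ?E = "\<Sum>k\<in>UNIV. f (x $ k) (y $ k) (z $ k)"
      have "G_fun N Z r f (x + vec (ln (real n))) (y + vec (ln (real n))) (z + vec (ln (real n)))
          = exp (- (?E / real n))"
        using n by (simp add: G shift exp_minus sum_divide_distrib inverse_eq_divide)
      then show "G_fun N Z r f (x + vec (ln (real n))) (y + vec (ln (real n))) (z + vec (ln (real n))) ^ n
          = G_fun N Z r f x y z"
        using n by (simp only: exp_of_nat_mult[symmetric] G) simp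
    qed
    show "unit_Gumbel_marginals \<mu>"
      unfolding unit_Gumbel_marginals_def
    proof (intro ballI allI)
      fix b :: "(real^'p) \<times> (real^'p) \<times> (real^'p)" and t assume b: "b \<in> Basis"
      define w where "w n = real n *\<^sub>R One + (t - real n) *\<^sub>R b" for n
      have w: "w n \<bullet> i = (if i = b then t else real n)" if "i \<in> Basis" for n i
        using that b by (auto simp: w_def inner_add_left inner_Basis)
      define E where "E n = (\<Sum>k\<in>UNIV. f (fst (w n) $ k) (fst (snd (w n)) $ k) (snd (snd (w n)) $ k))" for n
      have meas: "measure \<mu> {..w n} = exp (- E n)" for n
        using F[of "fst (w n)" "fst (snd (w n))" "snd (snd (w n))"] by (simp add: G E_def)
      \<comment> \<open>As all other coordinates tend to infinity, the lower bound in coordinate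
        \<open>b\<close> and the upper bound by the sum squeeze the exponent to
        \<open>exp (- t)\<close>.\<close>
      have "E \<longlonglongrightarrow> exp (- t)"
      proof (rule tendsto_sandwich[OF _ _ tendsto_const])
        show "\<forall>\<^sub>F n in sequentially. exp (- t) \<le> E n"
        proof (intro always_eventually allI)
          fix n
          have "\<exists>k. b = (axis k 1, 0, 0) \<or> b = (0, axis k 1, 0) \<or> b = (0, 0, axis k 1)"
            using b by (auto simp: Basis_prod_def Basis_vec_def zero_prod_def)
          then have "\<exists>k. w n \<bullet> b = fst (w n) $ k \<or> w n \<bullet> b = fst (snd (w n)) $ k \<or> w n \<bullet> b = snd (snd (w n)) $ k"
            by (cases "w n") (auto simp: inner_axis)
          then obtain k where "w n \<bullet> b = fst (w n) $ k \<or> w n \<bullet> b = fst (snd (w n)) $ k \<or> w n \<bullet> b = snd (snd (w n)) $ k"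
            by blast
          then have "exp (- (w n \<bullet> b)) \<le> f (fst (w n) $ k) (fst (snd (w n)) $ k) (snd (snd (w n)) $ k)"
            using lower by metis
          also have "\<dots> \<le> E n"
            unfolding E_def by (rule member_le_sum) (auto simp: less_imp_le[OF f_pos])
          finally show "exp (- t) \<le> E n" using w[OF b] by simp
        qed
        show "\<forall>\<^sub>F n in sequentially. E n \<le> exp (- t) + real (card (Basis - {b})) * exp (- real n)"
        proof (intro always_eventually allI)
          fix n
          have "E n \<le> (\<Sum>i\<in>Basis. exp (- ((fst (w n), fst (snd (w n)), snd (snd (w n))) \<bullet> i)))"
            unfolding E_def sum_Basis_triple[of "\<lambda>t. exp (- t)"] by (intro sum_mono upper)
          also have "\<dots> = (\<Sum>i\<in>Basis. exp (- (w n \<bullet> i)))" by simp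
          also have "\<dots> = exp (- (w n \<bullet> b)) + (\<Sum>i\<in>Basis - {b}. exp (- (w n \<bullet> i)))"
            using b by (subst sum.remove[of _ b]) auto
          also have "\<dots> = exp (- t) + real (card (Basis - {b})) * exp (- real n)"
            using b by (simp add: w)
          finally show "E n \<le> exp (- t) + real (card (Basis - {b})) * exp (- real n)" .
        qed
        show "(\<lambda>n. exp (- t) + real (card (Basis - {b})) * exp (- real n)) \<longlonglongrightarrow> exp (- t)"
          by real_asymp
      qed
      then have "(\<lambda>n. measure \<mu> {..w n}) \<longlonglongrightarrow> exp (- exp (- t))"
        unfolding meas by (intro tendsto_intros)
      then show "cdf (distr \<mu> borel (\<lambda>z. z \<bullet> b)) t = exp (- exp (- t))"
        using marginal_limit[OF prob_\<mu> sets_\<mu> b, of t] unfolding w_def by (rule LIMSEQ_unique[rotated])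
    qed
  qed
  ultimately show ?thesis using \<mu> by blast
qed

section \<open>Uniqueness of joint laws from characteristic functions\<close>

text \<open>A weight bounded away from 0 becomes a density after normalisation, so uniqueness for
  ordinary characteristic functions applies to the reweighted laws.\<close>

lemma real_weight_char_unique:
  fixes R :: "'a \<Rightarrow> real" and R' :: "'b \<Rightarrow> real" and h :: "real \<Rightarrow> complex"
  assumes "prob_space M" "prob_space M'"
    and [measurable]: "X \<in> borel_measurable M" "X' \<in> borel_measurable M'"
      "R \<in> borel_measurable M" "R' \<in> borel_measurable M'" "h \<in> borel_measurable borel"
    and bounds: "\<And>\<omega>. 1 \<le> R \<omega>" "\<And>\<omega>. R \<omega> \<le> K" "\<And>\<omega>. 1 \<le> R' \<omega>" "\<And>\<omega>. R' \<omega> \<le> K"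
    and char: "\<And>u. (\<integral>\<omega>. complex_of_real (R \<omega>) * iexp (u * X \<omega>) \<partial>M)
                   = (\<integral>\<omega>. complex_of_real (R' \<omega>) * iexp (u * X' \<omega>) \<partial>M')"
  shows "(\<integral>\<omega>. complex_of_real (R \<omega>) * h (X \<omega>) \<partial>M) = (\<integral>\<omega>. complex_of_real (R' \<omega>) * h (X' \<omega>) \<partial>M')"
proof -
  interpret M: prob_space M by fact
  interpret M': prob_space M' by fact
  have borel_measurable_iexp: "(\<lambda>x. iexp (u * x)) \<in> borel_measurable borel" for u :: real
    by measurable
  define c where "c = (\<integral>\<omega>. R \<omega> \<partial>M)"
  have "\<bar>R \<omega>\<bar> \<le> K" "\<bar>R' \<omega>'\<bar> \<le> K" for \<omega> \<omega>'
    using bounds(1,2)[of \<omega>] bounds(3,4)[of \<omega>'] by linarith+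
  then have int: "integrable M R" "integrable M' R'"
    by (auto intro!: M.integrable_const_bound[where B=K] M'.integrable_const_bound[where B=K])
  \<comment> \<open>At \<open>u = 0\<close> the hypothesis says that the total weights agree, so one
    constant normalises both.\<close>
  have "complex_of_real c = complex_of_real (\<integral>\<omega>. R' \<omega> \<partial>M')"
    using char[of 0] by (simp add: c_def)
  then have c': "c = (\<integral>\<omega>. R' \<omega> \<partial>M')" by simp
  have "(\<integral>\<omega>. 1 \<partial>M) \<le> c"
    unfolding c_def using int bounds by (intro integral_mono) auto
  then have c: "1 \<le> c" by (simp add: M.prob_space)
  define P where "P = density M (\<lambda>\<omega>. ennreal (R \<omega> / c))"
  define P' where "P' = density M' (\<lambda>\<omega>. ennreal (R' \<omega> / c))"
  have R0: "0 \<le> R \<omega>" "0 \<le> R' \<omega>'" for \<omega> \<omega>' using bounds(1)[of \<omega>] bounds(3)[of \<omega>'] by linarith+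
  have "prob_space P"
  proof
    have "emeasure P (space P) = ennreal (\<integral>\<omega>. R \<omega> / c \<partial>M)"
      using int c R0 by (simp add: P_def emeasure_density nn_integral_eq_integral cong: nn_integral_cong)
    then show "emeasure P (space P) = 1" using c by (simp add: c_def)
  qed
  moreover have "prob_space P'"
  proof
    have "emeasure P' (space P') = ennreal (\<integral>\<omega>. R' \<omega> / c \<partial>M')"
      using int c R0 by (simp add: P'_def emeasure_density nn_integral_eq_integral cong: nn_integral_cong)
    then show "emeasure P' (space P') = 1" using c by (simp add: c')
  qed
  moreover have integral_P: "(\<integral>x. g x \<partial>distr P borel X) = (\<integral>\<omega>. complex_of_real (R \<omega>) * g (X \<omega>) \<partial>M) / c"
    if [measurable]: "g \<in> borel_measurable borel" for g :: "real \<Rightarrow> complex"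
  proof -
    have "(\<integral>x. g x \<partial>distr P borel X) = (\<integral>\<omega>. g (X \<omega>) \<partial>P)"
      by (subst integral_distr) (auto simp: P_def)
    also have "\<dots> = (\<integral>\<omega>. (R \<omega> / c) *\<^sub>R g (X \<omega>) \<partial>M)"
      unfolding P_def using c R0 by (subst integral_density) auto
    also have "\<dots> = (\<integral>\<omega>. complex_of_real (R \<omega>) * g (X \<omega>) / c \<partial>M)"
      by (simp add: scaleR_conv_of_real)
    finally show ?thesis by simp
  qed
  moreover have integral_P': "(\<integral>x. g x \<partial>distr P' borel X') = (\<integral>\<omega>. complex_of_real (R' \<omega>) * g (X' \<omega>) \<partial>M') / c"
    if [measurable]: "g \<in> borel_measurable borel" for g :: "real \<Rightarrow> complex"
  proof -
    have "(\<integral>x. g x \<partial>distr P' borel X') = (\<integral>\<omega>. g (X' \<omega>) \<partial>P')"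
      by (subst integral_distr) (auto simp: P'_def)
    also have "\<dots> = (\<integral>\<omega>. (R' \<omega> / c) *\<^sub>R g (X' \<omega>) \<partial>M')"
      unfolding P'_def using c R0 by (subst integral_density) auto
    also have "\<dots> = (\<integral>\<omega>. complex_of_real (R' \<omega>) * g (X' \<omega>) / c \<partial>M')"
      by (simp add: scaleR_conv_of_real)
    finally show ?thesis by simp
  qed
  moreover have "char (distr P borel X) u = char (distr P' borel X') u" for u
    unfolding char_def integral_P[OF borel_measurable_iexp] integral_P'[OF borel_measurable_iexp] char ..
  ultimately have "distr P borel X = distr P' borel X'"
    by (intro Levy_uniqueness)
       (auto intro!: prob_space.real_distribution_distr simp: P_def P'_def fun_eq_iff)
  then show ?thesis
    using integral_P[of h] integral_P'[of h] c by simp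
qed

text \<open>The weight is split into real and imaginary part, and each part is lifted into
  \<open>[1, 3]\<close> by adding 2; the contribution of the constant is subtracted
  afterwards.\<close>

lemma weighted_char_unique:
  fixes \<Phi> :: "'a \<Rightarrow> complex" and \<Phi>' :: "'b \<Rightarrow> complex" and h :: "real \<Rightarrow> complex"
  assumes "prob_space M" "prob_space M'"
    and [measurable]: "X \<in> borel_measurable M" "X' \<in> borel_measurable M'"
      "\<Phi> \<in> borel_measurable M" "\<Phi>' \<in> borel_measurable M'" "h \<in> borel_measurable borel"
    and bounds: "\<And>\<omega>. norm (\<Phi> \<omega>) \<le> 1" "\<And>\<omega>. norm (\<Phi>' \<omega>) \<le> 1"
    and char: "\<And>u. (\<integral>\<omega>. iexp (u * X \<omega>) \<partial>M) = (\<integral>\<omega>. iexp (u * X' \<omega>) \<partial>M')"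
      "\<And>u. (\<integral>\<omega>. \<Phi> \<omega> * iexp (u * X \<omega>) \<partial>M) = (\<integral>\<omega>. \<Phi>' \<omega> * iexp (u * X' \<omega>) \<partial>M')"
    and int: "integrable M (\<lambda>\<omega>. h (X \<omega>))" "integrable M' (\<lambda>\<omega>. h (X' \<omega>))"
  shows "(\<integral>\<omega>. \<Phi> \<omega> * h (X \<omega>) \<partial>M) = (\<integral>\<omega>. \<Phi>' \<omega> * h (X' \<omega>) \<partial>M')"
proof -
  interpret M: prob_space M by fact
  interpret M': prob_space M' by fact
  have re: "(\<integral>\<omega>. complex_of_real (Re (\<Psi> \<omega>)) * h (X \<omega>) \<partial>M) = (\<integral>\<omega>. complex_of_real (Re (\<Psi>' \<omega>)) * h (X' \<omega>) \<partial>M')"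
    if [measurable]: "\<Psi> \<in> borel_measurable M" "\<Psi>' \<in> borel_measurable M'"
      and b: "\<And>\<omega>. norm (\<Psi> \<omega>) \<le> 1" "\<And>\<omega>. norm (\<Psi>' \<omega>) \<le> 1"
      and ch: "\<And>u. (\<integral>\<omega>. \<Psi> \<omega> * iexp (u * X \<omega>) \<partial>M) = (\<integral>\<omega>. \<Psi>' \<omega> * iexp (u * X' \<omega>) \<partial>M')"
    for \<Psi> :: "'a \<Rightarrow> complex" and \<Psi>' :: "'b \<Rightarrow> complex"
  proof -
    have b': "\<bar>Re (\<Psi> \<omega>)\<bar> \<le> 1" "\<bar>Re (\<Psi>' \<omega>')\<bar> \<le> 1" for \<omega> \<omega>'
      using b abs_Re_le_cmod order_trans by blast+
    \<comment> \<open>The transform of the real part is recovered from the transform of the whole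
      weight at \<open>u\<close> and at \<open>- u\<close>.\<close>
    have split: "complex_of_real (Re z) * iexp t = (z * iexp t + cnj (z * iexp (- t))) / 2" for z t
    proof -
      have "z * iexp t + cnj (z * iexp (- t)) = (z + cnj z) * iexp t"
        by (simp add: exp_cnj distrib_right)
      then show ?thesis by (simp add: complex_add_cnj)
    qed
    have bdd: "integrable M (\<lambda>\<omega>. \<Psi> \<omega> * iexp (t * X \<omega>))" "integrable M' (\<lambda>\<omega>. \<Psi>' \<omega> * iexp (t * X' \<omega>))" for t
      using b by (auto intro!: M.integrable_const_bound[where B=1] M'.integrable_const_bound[where B=1]
          simp: norm_mult)
    have intRe: "(\<integral>\<omega>. complex_of_real (Re (\<Psi> \<omega>)) * iexp (u * X \<omega>) \<partial>M)
       = ((\<integral>\<omega>. \<Psi> \<omega> * iexp (u * X \<omega>) \<partial>M) + cnj (\<integral>\<omega>. \<Psi> \<omega> * iexp ((- u) * X \<omega>) \<partial>M)) / 2" for u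
      unfolding split Bochner_Integration.integral_cnj[symmetric]
      using bdd(1)[of u] bdd(1)[of "-u"]
      by (subst Bochner_Integration.integral_add[symmetric]) (auto simp: complex_cnj_mult[symmetric] simp del: complex_cnj_mult)
    have intRe': "(\<integral>\<omega>. complex_of_real (Re (\<Psi>' \<omega>)) * iexp (u * X' \<omega>) \<partial>M')
       = ((\<integral>\<omega>. \<Psi>' \<omega> * iexp (u * X' \<omega>) \<partial>M') + cnj (\<integral>\<omega>. \<Psi>' \<omega> * iexp ((- u) * X' \<omega>) \<partial>M')) / 2" for u
      unfolding split Bochner_Integration.integral_cnj[symmetric]
      using bdd(2)[of u] bdd(2)[of "-u"]
      by (subst Bochner_Integration.integral_add[symmetric]) (auto simp: complex_cnj_mult[symmetric] simp del: complex_cnj_mult)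
    have bddRe: "integrable M (\<lambda>\<omega>. complex_of_real (Re (\<Psi> \<omega>)) * h (X \<omega>))"
        "integrable M' (\<lambda>\<omega>. complex_of_real (Re (\<Psi>' \<omega>)) * h (X' \<omega>))"
      using b' by (auto intro!: Bochner_Integration.integrable_bound[OF int(1)] Bochner_Integration.integrable_bound[OF int(2)]
          AE_I2 mult_left_le_one_le simp: norm_mult)
    have bddRe1: "integrable M (\<lambda>\<omega>. complex_of_real (Re (\<Psi> \<omega>)) * iexp (u * X \<omega>))"
        "integrable M' (\<lambda>\<omega>. complex_of_real (Re (\<Psi>' \<omega>)) * iexp (u * X' \<omega>))"
        "integrable M (\<lambda>\<omega>. iexp (u * X \<omega>))" "integrable M' (\<lambda>\<omega>. iexp (u * X' \<omega>))" for u
      using b' by (auto intro!: M.integrable_const_bound[where B=1] M'.integrable_const_bound[where B=1]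
          simp: norm_mult)
    have "(\<integral>\<omega>. complex_of_real (2 + Re (\<Psi> \<omega>)) * h (X \<omega>) \<partial>M) = (\<integral>\<omega>. complex_of_real (2 + Re (\<Psi>' \<omega>)) * h (X' \<omega>) \<partial>M')"
    proof (rule real_weight_char_unique[where K=3])
      show "1 \<le> 2 + Re (\<Psi> \<omega>)" "2 + Re (\<Psi> \<omega>) \<le> 3" for \<omega> using b'(1)[of \<omega>] by linarith+
      show "1 \<le> 2 + Re (\<Psi>' \<omega>)" "2 + Re (\<Psi>' \<omega>) \<le> 3" for \<omega> using b'(2)[of \<omega>] by linarith+
      show "(\<integral>\<omega>. complex_of_real (2 + Re (\<Psi> \<omega>)) * iexp (u * X \<omega>) \<partial>M)
          = (\<integral>\<omega>. complex_of_real (2 + Re (\<Psi>' \<omega>)) * iexp (u * X' \<omega>) \<partial>M')" for u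
      proof -
        have "(\<integral>\<omega>. complex_of_real (Re (\<Psi> \<omega>)) * iexp (u * X \<omega>) \<partial>M)
            = (\<integral>\<omega>. complex_of_real (Re (\<Psi>' \<omega>)) * iexp (u * X' \<omega>) \<partial>M')"
          by (simp only: intRe intRe' ch)
        then show ?thesis using bddRe1[of u] char(1)[of u] by (simp add: distrib_right)
      qed
    qed (use assms in auto)
    then show ?thesis
    proof -
      assume eq: "(\<integral>\<omega>. complex_of_real (2 + Re (\<Psi> \<omega>)) * h (X \<omega>) \<partial>M) = (\<integral>\<omega>. complex_of_real (2 + Re (\<Psi>' \<omega>)) * h (X' \<omega>) \<partial>M')"
      have "(\<integral>\<omega>. complex_of_real 1 * h (X \<omega>) \<partial>M) = (\<integral>\<omega>. complex_of_real 1 * h (X' \<omega>) \<partial>M')"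
        by (rule real_weight_char_unique[where K=1]) (use assms in auto)
      then show ?thesis using eq bddRe int by (simp add: distrib_right)
    qed
  qed
  \<comment> \<open>The imaginary part is the real part after multiplication by
    \<open>- \<i>\<close>.\<close>
  have split: "z * w = complex_of_real (Re z) * w + \<i> * (complex_of_real (Re (- \<i> * z)) * w)" for z w
    by (simp add: complex_eq_iff)
  have le1: "\<bar>Re z\<bar> \<le> 1" if "norm z \<le> 1" for z :: complex
    using that abs_Re_le_cmod order_trans by blast
  have I: "integrable M (\<lambda>\<omega>. complex_of_real (Re (c * \<Phi> \<omega>)) * h (X \<omega>))"
     "integrable M' (\<lambda>\<omega>. complex_of_real (Re (c * \<Phi>' \<omega>)) * h (X' \<omega>))" if "norm c = 1" for c
    using le1[of "c * \<Phi> _"] le1[of "c * \<Phi>' _"] bounds that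
    by (auto intro!: Bochner_Integration.integrable_bound[OF int(1)] Bochner_Integration.integrable_bound[OF int(2)]
        AE_I2 mult_left_le_one_le simp: norm_mult simp del: times_complex.sel)
  have 1: "(\<integral>\<omega>. complex_of_real (Re (\<Phi> \<omega>)) * h (X \<omega>) \<partial>M) = (\<integral>\<omega>. complex_of_real (Re (\<Phi>' \<omega>)) * h (X' \<omega>) \<partial>M')"
    by (rule re) (use bounds char in auto)
  have 2: "(\<integral>\<omega>. complex_of_real (Re (- \<i> * \<Phi> \<omega>)) * h (X \<omega>) \<partial>M) = (\<integral>\<omega>. complex_of_real (Re (- \<i> * \<Phi>' \<omega>)) * h (X' \<omega>) \<partial>M')"
    by (rule re) (use bounds char in \<open>auto simp: norm_mult mult.assoc\<close>)
  show ?thesis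
    unfolding split[of "\<Phi> _"] split[of "\<Phi>' _"]
    using I[of 1] I[of "-\<i>"] 1 2 by (simp del: times_complex.sel mult_minus_left)
qed

text \<open>Induction over the coordinates: one exponential after another is exchanged for an
  indicator, all other factors forming the bounded weight of
  \<open>weighted_char_unique\<close>.\<close>

lemma rectangle_prob_unique:
  fixes X :: "'i \<Rightarrow> 'a \<Rightarrow> real" and X' :: "'i \<Rightarrow> 'b \<Rightarrow> real"
  assumes M: "prob_space M" "prob_space M'" and J: "finite J"
    and meas: "\<And>j. j \<in> J \<Longrightarrow> X j \<in> borel_measurable M" "\<And>j. j \<in> J \<Longrightarrow> X' j \<in> borel_measurable M'"
    and char: "\<And>u. (\<integral>\<omega>. iexp (\<Sum>j\<in>J. u j * X j \<omega>) \<partial>M) = (\<integral>\<omega>. iexp (\<Sum>j\<in>J. u j * X' j \<omega>) \<partial>M')"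
  shows "\<P>(\<omega> in M. \<forall>j\<in>J. X j \<omega> \<le> a j) = \<P>(\<omega> in M'. \<forall>j\<in>J. X' j \<omega> \<le> a j)"
proof -
  interpret M: prob_space M by fact
  interpret M': prob_space M' by fact
  let ?I = "\<lambda>X A \<omega>. (\<Prod>j\<in>A. indicator {..a j} (X j \<omega>)) :: complex"
  have main: "(\<integral>\<omega>. ?I X A \<omega> * iexp (\<Sum>j\<in>J - A. u j * X j \<omega>) \<partial>M)
      = (\<integral>\<omega>. ?I X' A \<omega> * iexp (\<Sum>j\<in>J - A. u j * X' j \<omega>) \<partial>M')"
    if "finite A" "A \<subseteq> J" for A u
    using that
  proof (induction A arbitrary: u)
    case empty
    then show ?case using char by simp
  next
    case (insert k A)
    have k: "k \<in> J" "k \<notin> A" and A: "A \<subseteq> J" using insert by auto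
    have JA: "J - A = insert k (J - insert k A)" using k by auto
    have [measurable]: "X k \<in> borel_measurable M" "X' k \<in> borel_measurable M'" using meas k by auto
    have [measurable]: "?I X A \<in> borel_measurable M" "?I X' A \<in> borel_measurable M'"
      using meas A by (auto intro!: borel_measurable_prod measurable_compose[OF _ borel_measurable_indicator])
    have [measurable]: "(\<lambda>\<omega>. \<Sum>j\<in>J - insert k A. u j * X j \<omega>) \<in> borel_measurable M"
        "(\<lambda>\<omega>. \<Sum>j\<in>J - insert k A. u j * X' j \<omega>) \<in> borel_measurable M'"
      using meas by (auto intro!: borel_measurable_sum)
    have sum_upd: "(\<Sum>j\<in>J - A. (u(k := s)) j * Y j) = s * Y k + (\<Sum>j\<in>J - insert k A. u j * Y j)" for s and Y :: "'i \<Rightarrow> real"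
    proof -
      have "(\<Sum>j\<in>J - insert k A. (u(k := s)) j * Y j) = (\<Sum>j\<in>J - insert k A. u j * Y j)"
        by (intro sum.cong) auto
      then show ?thesis unfolding JA using J by (subst sum.insert) auto
    qed
    have sum_single: "(\<Sum>j\<in>J. (if j = k then s else 0) * Y j) = s * Y k" for s and Y :: "'i \<Rightarrow> real"
      using J k sum.delta[of J k "\<lambda>j. s * Y j"] by (simp add: if_distrib[of "\<lambda>x. x * _"] cong: if_cong)
    have bdd: "norm (?I Y A \<omega> * iexp t) \<le> 1" for Y :: "'i \<Rightarrow> 'c \<Rightarrow> real" and \<omega> t
      unfolding norm_mult prod_norm[symmetric]
      by (auto intro!: prod_le_1 simp: indicator_def)
    have "(\<integral>\<omega>. (?I X A \<omega> * iexp (\<Sum>j\<in>J - insert k A. u j * X j \<omega>)) * indicator {..a k} (X k \<omega>) \<partial>M)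
        = (\<integral>\<omega>. (?I X' A \<omega> * iexp (\<Sum>j\<in>J - insert k A. u j * X' j \<omega>)) * indicator {..a k} (X' k \<omega>) \<partial>M')"
    proof (rule weighted_char_unique[OF M])
      show "(\<integral>\<omega>. iexp (s * X k \<omega>) \<partial>M) = (\<integral>\<omega>. iexp (s * X' k \<omega>) \<partial>M')" for s
        using char[of "\<lambda>j. if j = k then s else 0"] by (simp only: sum_single)
      show "(\<integral>\<omega>. ?I X A \<omega> * iexp (\<Sum>j\<in>J - insert k A. u j * X j \<omega>) * iexp (s * X k \<omega>) \<partial>M)
          = (\<integral>\<omega>. ?I X' A \<omega> * iexp (\<Sum>j\<in>J - insert k A. u j * X' j \<omega>) * iexp (s * X' k \<omega>) \<partial>M')" for s
        using insert.IH[OF A, of "u(k := s)"]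
        by (simp only: sum_upd of_real_add distrib_left exp_add mult.assoc) (simp add: mult_ac)
      show "integrable M (\<lambda>\<omega>. indicator {..a k} (X k \<omega>) :: complex)"
        by (rule M.integrable_const_bound[where B=1]) (auto simp: indicator_def)
      show "integrable M' (\<lambda>\<omega>. indicator {..a k} (X' k \<omega>) :: complex)"
        by (rule M'.integrable_const_bound[where B=1]) (auto simp: indicator_def)
      show "(\<lambda>\<omega>. ?I X A \<omega> * iexp (\<Sum>j\<in>J - insert k A. u j * X j \<omega>)) \<in> borel_measurable M"
        "(\<lambda>\<omega>. ?I X' A \<omega> * iexp (\<Sum>j\<in>J - insert k A. u j * X' j \<omega>)) \<in> borel_measurable M'"
        by measurable
      show "norm (?I X A \<omega> * iexp (\<Sum>j\<in>J - insert k A. u j * X j \<omega>)) \<le> 1"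
        "norm (?I X' A \<omega>' * iexp (\<Sum>j\<in>J - insert k A. u j * X' j \<omega>')) \<le> 1" for \<omega> \<omega>'
        by (rule bdd)+
    qed auto
    then show ?case using insert.hyps by (simp add: mult_ac)
  qed
  have ind: "?I Y J \<omega> = indicator {\<omega>. \<forall>j\<in>J. Y j \<omega> \<le> a j} \<omega>" for Y :: "'i \<Rightarrow> 'c \<Rightarrow> real" and \<omega>
    using J by (auto simp: indicator_def prod_zero_iff intro!: prod.neutral)
  have sets: "{\<omega> \<in> space M. \<forall>j\<in>J. X j \<omega> \<le> a j} \<in> sets M" "{\<omega> \<in> space M'. \<forall>j\<in>J. X' j \<omega> \<le> a j} \<in> sets M'"
    using meas J by (auto intro!: sets.sets_Collect_finite_All borel_measurable_le)
  have "(\<integral>\<omega>. ?I X J \<omega> \<partial>M) = (\<integral>\<omega>. ?I X' J \<omega> \<partial>M')"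
    using main[OF J subset_refl] by simp
  moreover have "(\<integral>\<omega>. ?I X J \<omega> \<partial>M)
      = (\<integral>\<omega>. complex_of_real (indicator {\<omega> \<in> space M. \<forall>j\<in>J. X j \<omega> \<le> a j} \<omega>) \<partial>M)"
    unfolding ind by (intro Bochner_Integration.integral_cong) (auto simp: indicator_def)
  moreover have "(\<integral>\<omega>. ?I X' J \<omega> \<partial>M')
      = (\<integral>\<omega>. complex_of_real (indicator {\<omega> \<in> space M'. \<forall>j\<in>J. X' j \<omega> \<le> a j} \<omega>) \<partial>M')"
    unfolding ind by (intro Bochner_Integration.integral_cong) (auto simp: indicator_def)
  ultimately show ?thesis using sets by simp
qed

text \<open>The entry 0 gives the empty family a value; it changes nothing for a nonempty family of
  nonnegative terms.\<close>

definition weighted_max :: "'i set \<Rightarrow> ('i \<Rightarrow> real) \<Rightarrow> ('i \<Rightarrow> real) \<Rightarrow> real" where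
  "weighted_max J c v = Max (insert 0 ((\<lambda>j. c j * v j) ` J))"

lemma weighted_max_le_iff: "finite J \<Longrightarrow> weighted_max J c v \<le> s \<longleftrightarrow> 0 \<le> s \<and> (\<forall>j\<in>J. c j * v j \<le> s)"
  unfolding weighted_max_def by (subst Max_le_iff) auto

lemma weighted_max_measurable:
  assumes "finite J" "\<And>j. j \<in> J \<Longrightarrow> V j \<in> borel_measurable M"
  shows "(\<lambda>\<omega>. weighted_max J c (\<lambda>j. V j \<omega>)) \<in> borel_measurable M"
proof -
  have "weighted_max J c v = (if J = {} then 0 else max 0 (Max ((\<lambda>j. c j * v j) ` J)))" for v :: "'a \<Rightarrow> real"
    using assms(1) by (auto simp: weighted_max_def)
  then show ?thesis using assms by (auto intro!: borel_measurable_Max borel_measurable_max)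
qed

text \<open>That the maximum is at most \<open>s\<close> is a rectangle event, so the distribution
  function of the maximum is determined by the joint characteristic function.\<close>

lemma expectation_weighted_max_unique:
  fixes X :: "'i \<Rightarrow> 'a \<Rightarrow> real" and X' :: "'i \<Rightarrow> 'b \<Rightarrow> real"
  assumes M: "prob_space M" "prob_space M'" and J: "finite J"
    and meas: "\<And>j. j \<in> J \<Longrightarrow> X j \<in> borel_measurable M" "\<And>j. j \<in> J \<Longrightarrow> X' j \<in> borel_measurable M'"
    and char: "\<And>u. (\<integral>\<omega>. iexp (\<Sum>j\<in>J. u j * X j \<omega>) \<partial>M) = (\<integral>\<omega>. iexp (\<Sum>j\<in>J. u j * X' j \<omega>) \<partial>M')"
    and c: "\<And>j. j \<in> J \<Longrightarrow> 0 \<le> c j"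
  shows "(\<integral>\<omega>. weighted_max J c (\<lambda>j. exp (X j \<omega>)) \<partial>M) = (\<integral>\<omega>. weighted_max J c (\<lambda>j. exp (X' j \<omega>)) \<partial>M')"
proof -
  interpret M: prob_space M by fact
  interpret M': prob_space M' by fact
  have [measurable]: "(\<lambda>\<omega>. weighted_max J c (\<lambda>j. exp (X j \<omega>))) \<in> borel_measurable M"
     "(\<lambda>\<omega>. weighted_max J c (\<lambda>j. exp (X' j \<omega>))) \<in> borel_measurable M'"
    using meas J by (auto intro!: weighted_max_measurable borel_measurable_exp)
  define J' where "J' = {j\<in>J. 0 < c j}"
  have J': "finite J'" "J' \<subseteq> J" using J by (auto simp: J'_def)
  have ext: "(\<Sum>j\<in>J. (if j \<in> J' then u j else 0) * Y j) = (\<Sum>j\<in>J'. u j * Y j)" for u and Y :: "'i \<Rightarrow> real"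
    using J J' by (intro sum.mono_neutral_cong_right) auto
  have rect: "\<P>(\<omega> in M. \<forall>j\<in>J'. X j \<omega> \<le> a j) = \<P>(\<omega> in M'. \<forall>j\<in>J'. X' j \<omega> \<le> a j)" for a
  proof (rule rectangle_prob_unique[OF M J'(1)])
    show "(\<integral>\<omega>. iexp (\<Sum>j\<in>J'. u j * X j \<omega>) \<partial>M) = (\<integral>\<omega>. iexp (\<Sum>j\<in>J'. u j * X' j \<omega>) \<partial>M')" for u
      using char[of "\<lambda>j. if j \<in> J' then u j else 0"] by (simp only: ext)
  qed (use meas J' in auto)
  \<comment> \<open>Coordinates of weight 0 impose no condition. For \<open>s = 0\<close> the
    threshold \<open>ln (s / c j)\<close> would be wrong: any positive weight then excludes the
    event.\<close>
  have le_iff: "weighted_max J c (\<lambda>j. exp (y j)) \<le> s \<longleftrightarrow>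
      0 \<le> s \<and> (if s = 0 then J' = {} else \<forall>j\<in>J'. y j \<le> ln (s / c j))" for y s
  proof -
    have A: "c j * exp (y j) \<le> s \<longleftrightarrow> y j \<le> ln (s / c j)" if "0 < c j" "0 < s" for j
      using that by (simp add: ln_ge_iff field_simps)
    have B: "\<not> c j * exp (y j) \<le> 0" if "0 < c j" for j using that by (simp add: not_le)
    have C: "c j = 0" if "j \<in> J" "j \<notin> J'" for j using c[of j] that by (force simp: J'_def)
    have *: "c j * exp (y j) \<le> s \<longleftrightarrow> (j \<in> J' \<longrightarrow> (if s = 0 then False else y j \<le> ln (s / c j)))"
      if "j \<in> J" "0 \<le> s" for j
    proof (cases "j \<in> J'")
      case True
      then show ?thesis using A[of j] B[of j] that by (auto simp: J'_def)
    next
      case False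
      then show ?thesis using C[of j] that by simp
    qed
    show ?thesis
      unfolding weighted_max_le_iff[OF J] using * J'(2) by (auto split: if_splits)
  qed
  have "distr M borel (\<lambda>\<omega>. weighted_max J c (\<lambda>j. exp (X j \<omega>)))
      = distr M' borel (\<lambda>\<omega>. weighted_max J c (\<lambda>j. exp (X' j \<omega>)))"
  proof (rule cdf_unique)
    show "cdf (distr M borel (\<lambda>\<omega>. weighted_max J c (\<lambda>j. exp (X j \<omega>))))
      = cdf (distr M' borel (\<lambda>\<omega>. weighted_max J c (\<lambda>j. exp (X' j \<omega>))))"
    proof
      fix s
      have "\<P>(\<omega> in M. weighted_max J c (\<lambda>j. exp (X j \<omega>)) \<le> s) = \<P>(\<omega> in M'. weighted_max J c (\<lambda>j. exp (X' j \<omega>)) \<le> s)"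
        unfolding le_iff using rect[of "\<lambda>j. ln (s / c j)"]
        by (cases "0 \<le> s"; cases "s = 0"; cases "J' = {}") (simp_all add: M.prob_space M'.prob_space)
      then show "cdf (distr M borel (\<lambda>\<omega>. weighted_max J c (\<lambda>j. exp (X j \<omega>)))) s
          = cdf (distr M' borel (\<lambda>\<omega>. weighted_max J c (\<lambda>j. exp (X' j \<omega>)))) s"
        unfolding cdf_def by (subst (1 2) measure_distr) (auto simp: vimage_def Int_def conj_commute)
    qed
  qed auto
  then have "(\<integral>x. x \<partial>distr M borel (\<lambda>\<omega>. weighted_max J c (\<lambda>j. exp (X j \<omega>))))
      = (\<integral>x. x \<partial>distr M' borel (\<lambda>\<omega>. weighted_max J c (\<lambda>j. exp (X' j \<omega>))))" by simp
  then show ?thesis by (simp add: integral_distr)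
qed

section \<open>Gaussian linear space of a fractional Brownian motion\<close>

text \<open>Completing the square: the factor \<open>exp (s * x)\<close> shifts the normal density
  by \<open>s\<close>.\<close>

lemma std_normal_tilt:
  fixes g :: "real \<Rightarrow> complex"
  assumes [measurable]: "g \<in> borel_measurable borel"
  shows "(\<integral>x. complex_of_real (exp (s * x)) * g x \<partial>std_normal_distribution)
       = complex_of_real (exp (s\<^sup>2 / 2)) * (\<integral>x. g (x + s) \<partial>std_normal_distribution)"
proof -
  have dens: "std_normal_density x * exp (s * x) = exp (s\<^sup>2 / 2) * std_normal_density (x - s)" for x
    by (simp add: std_normal_density_def exp_add[symmetric] power2_eq_square field_simps)
  have "(\<integral>x. complex_of_real (exp (s * x)) * g x \<partial>std_normal_distribution)
      = (\<integral>x. complex_of_real (std_normal_density x * exp (s * x)) * g x \<partial>lborel)"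
    by (subst integral_density) (auto simp: scaleR_conv_of_real mult.assoc)
  also have "\<dots> = complex_of_real (exp (s\<^sup>2 / 2)) * (\<integral>x. complex_of_real (std_normal_density (x - s)) * g x \<partial>lborel)"
    unfolding dens by (simp add: mult.assoc)
  also have "(\<integral>x. complex_of_real (std_normal_density (x - s)) * g x \<partial>lborel)
      = (\<integral>x. complex_of_real (std_normal_density x) * g (x + s) \<partial>lborel)"
    using lborel_integral_real_affine[of 1 "\<lambda>x. complex_of_real (std_normal_density (x - s)) * g x" s]
    by (simp add: add.commute)
  also have "\<dots> = (\<integral>x. g (x + s) \<partial>std_normal_distribution)"
    by (subst integral_density) (auto simp: scaleR_conv_of_real)
  finally show ?thesis .
qed

lemma integrable_std_normal_exp: "integrable std_normal_distribution (\<lambda>x. exp (s * x))"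
proof -
  have "integrable lborel (\<lambda>x. exp (s\<^sup>2 / 2) * normal_density s 1 x)"
    by (intro integrable_mult_right) auto
  moreover have "exp (s\<^sup>2 / 2) * normal_density s 1 x = std_normal_density x * exp (s * x)" for x
    by (simp add: normal_density_def exp_add[symmetric] power2_eq_square field_simps)
  ultimately show ?thesis by (subst integrable_real_density) auto
qed

lemma std_normal_iexp:
  "(\<integral>x. iexp (t * x) \<partial>std_normal_distribution) = complex_of_real (exp (- t\<^sup>2 / 2))"
  using fun_cong[OF char_std_normal_distribution, of t] unfolding char_def by simp

lemma std_normal_exp_iexp:
  "(\<integral>x. complex_of_real (exp (s * x)) * iexp (t * x) \<partial>std_normal_distribution)
     = complex_of_real (exp (s\<^sup>2 / 2 - t\<^sup>2 / 2)) * iexp (t * s)"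
proof -
  have "(\<integral>x. complex_of_real (exp (s * x)) * iexp (t * x) \<partial>std_normal_distribution)
      = complex_of_real (exp (s\<^sup>2 / 2)) * (\<integral>x. iexp (t * (x + s)) \<partial>std_normal_distribution)"
    by (rule std_normal_tilt) measurable
  also have "(\<integral>x. iexp (t * (x + s)) \<partial>std_normal_distribution)
      = (\<integral>x. iexp (t * s) * iexp (t * x) \<partial>std_normal_distribution)"
    by (intro Bochner_Integration.integral_cong refl) (simp add: exp_add[symmetric] algebra_simps)
  also have "\<dots> = iexp (t * s) * complex_of_real (exp (- t\<^sup>2 / 2))"
    by (simp only: integral_mult_right_zero std_normal_iexp)
  also have "complex_of_real (exp (s\<^sup>2 / 2)) * (iexp (t * s) * complex_of_real (exp (- t\<^sup>2 / 2)))
      = complex_of_real (exp (s\<^sup>2 / 2) * exp (- t\<^sup>2 / 2)) * iexp (t * s)"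
    by (simp only: of_real_mult mult_ac)
  finally show ?thesis by (simp only: exp_add[symmetric]) simp
qed

lemma std_normal_exp: "(\<integral>x. exp (s * x) \<partial>std_normal_distribution) = exp (s\<^sup>2 / 2)"
proof -
  have "complex_of_real (\<integral>x. exp (s * x) \<partial>std_normal_distribution)
      = (\<integral>x. complex_of_real (exp (s * x)) * iexp (0 * x) \<partial>std_normal_distribution)"
    by (simp del: of_real_exp)
  also have "\<dots> = complex_of_real (exp (s\<^sup>2 / 2 - 0\<^sup>2 / 2)) * iexp (0 * s)"
    by (rule std_normal_exp_iexp)
  also have "\<dots> = complex_of_real (exp (s\<^sup>2 / 2))" by (simp del: of_real_exp)
  finally show ?thesis by (simp only: of_real_eq_iff)
qed

locale fbm =
  fixes M :: "'a measure" and B :: "real \<Rightarrow> 'a \<Rightarrow> real" and \<alpha> :: real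
  assumes \<alpha>: "0 < \<alpha>" "\<alpha> \<le> 2" and fbm: "fractional_brownian_motion M (\<alpha> / 2) B"
begin

sublocale prob_space M
  using fbm by (simp add: fractional_brownian_motion_def)

text \<open>The finite linear span of \<open>B\<close>. Each member is centred Gaussian with
  variance \<open>ip Y Y\<close>, so the exponential moments below reduce to computations with the
  bilinear form \<open>ip\<close>.\<close>

definition gspace :: "('a \<Rightarrow> real) set" where
  "gspace = {Y. \<exists>J c. finite J \<and> J \<subseteq> {0..} \<and> Y = (\<lambda>\<omega>. \<Sum>t\<in>J. c t * B t \<omega>)}"

lemma gspace_B: assumes "0 \<le> t" shows "B t \<in> gspace"
  unfolding gspace_def using assms
  by (auto intro!: exI[of _ "{t}"] exI[of _ "\<lambda>_. 1"])

lemma gspace_scale: assumes "Y \<in> gspace" shows "(\<lambda>\<omega>. a * Y \<omega>) \<in> gspace"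
proof -
  from assms obtain J c where "finite J" "J \<subseteq> {0..}" "Y = (\<lambda>\<omega>. \<Sum>t\<in>J. c t * B t \<omega>)"
    unfolding gspace_def by blast
  then show ?thesis unfolding gspace_def
    by (intro CollectI exI[of _ J] exI[of _ "\<lambda>t. a * c t"]) (simp add: sum_distrib_left mult.assoc)
qed

lemma gspace_add: assumes "Y \<in> gspace" "W \<in> gspace" shows "(\<lambda>\<omega>. Y \<omega> + W \<omega>) \<in> gspace"
proof -
  from assms obtain J c K d where J: "finite J" "J \<subseteq> {0..}" "Y = (\<lambda>\<omega>. \<Sum>t\<in>J. c t * B t \<omega>)"
    and K: "finite K" "K \<subseteq> {0..}" "W = (\<lambda>\<omega>. \<Sum>t\<in>K. d t * B t \<omega>)"
    unfolding gspace_def by blast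
  define e where "e t = (if t \<in> J then c t else 0) + (if t \<in> K then d t else 0)" for t
  have "(\<Sum>t\<in>J. c t * B t \<omega>) + (\<Sum>t\<in>K. d t * B t \<omega>) = (\<Sum>t\<in>J \<union> K. e t * B t \<omega>)" for \<omega>
  proof -
    have "(\<Sum>t\<in>J. c t * B t \<omega>) = (\<Sum>t\<in>J \<union> K. (if t \<in> J then c t else 0) * B t \<omega>)"
      using J K by (intro sum.mono_neutral_cong_left) auto
    moreover have "(\<Sum>t\<in>K. d t * B t \<omega>) = (\<Sum>t\<in>J \<union> K. (if t \<in> K then d t else 0) * B t \<omega>)"
      using J K by (intro sum.mono_neutral_cong_left) auto
    ultimately show ?thesis by (simp add: e_def sum.distrib distrib_right)
  qed
  then show ?thesis unfolding gspace_def J(3) K(3) using J K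
    by (intro CollectI exI[of _ "J \<union> K"] exI[of _ e]) auto
qed

lemma gspace_diff: "Y \<in> gspace \<Longrightarrow> W \<in> gspace \<Longrightarrow> (\<lambda>\<omega>. Y \<omega> - W \<omega>) \<in> gspace"
  using gspace_add[OF _ gspace_scale[of W "-1"], of Y] by simp

lemma gspace_sum:
  assumes "finite I" "\<And>i. i \<in> I \<Longrightarrow> Y i \<in> gspace"
  shows "(\<lambda>\<omega>. \<Sum>i\<in>I. Y i \<omega>) \<in> gspace"
  using assms
proof (induction I rule: finite_induct)
  case empty
  show ?case unfolding gspace_def by (auto intro!: exI[of _ "{}"])
qed (auto intro!: gspace_add)

lemma gspace_gaussian: assumes "Y \<in> gspace" shows "gaussian_rv M Y"
  using assms fbm unfolding gspace_def fractional_brownian_motion_def jointly_gaussian_def by auto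

lemma gspace_measurable [measurable_dest]: "Y \<in> gspace \<Longrightarrow> Y \<in> borel_measurable M"
  using gspace_gaussian by (auto simp: gaussian_rv_def)

lemma gaussian_integrable_mean:
  assumes Y: "Y \<in> gspace" and d: "distr M borel Y = distr std_normal_distribution borel (\<lambda>x. m + s * x)"
  shows "integrable M Y \<and> expectation Y = m"
proof -
  note [measurable] = gspace_measurable[OF Y]
  interpret N: prob_space std_normal_distribution by (rule prob_space_normal_density) simp
  have i: "integrable std_normal_distribution (\<lambda>x. x)"
    using integrable_std_normal_distribution_moment[of 1] by simp
  have z: "(\<integral>x. x \<partial>std_normal_distribution) = 0"
    using integral_std_normal_distribution_moment_odd[of 1] by simp
  have aff: "integrable std_normal_distribution (\<lambda>x. m + s * x)"
    using i by (intro Bochner_Integration.integrable_add integrable_mult_right) auto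
  have "(\<integral>x. m + s * x \<partial>std_normal_distribution)
      = (\<integral>x. m \<partial>std_normal_distribution) + (\<integral>x. s * x \<partial>std_normal_distribution)"
    using i by (intro Bochner_Integration.integral_add integrable_mult_right) auto
  also have "\<dots> = m"
    by (simp only: integral_mult_right_zero z Bochner_Integration.lebesgue_integral_const N.prob_space) simp
  finally have aff_int: "(\<integral>x. m + s * x \<partial>std_normal_distribution) = m" .
  have "integrable (distr M borel Y) (\<lambda>x. x)"
    unfolding d by (subst integrable_distr_eq) (use aff in auto)
  then have "integrable M Y" by (subst (asm) integrable_distr_eq) auto
  moreover have "expectation Y = (\<integral>x. x \<partial>distr M borel Y)" by (subst integral_distr) auto
  then have "expectation Y = m"
    unfolding d by (subst (asm) integral_distr) (use aff_int in auto)
  ultimately show ?thesis ..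
qed

lemma gspace_integrable: "Y \<in> gspace \<Longrightarrow> integrable M Y"
  using gspace_gaussian gaussian_integrable_mean unfolding gaussian_rv_def by blast

lemma gspace_mean: assumes "Y \<in> gspace" shows "expectation Y = 0"
proof -
  from assms obtain J c where J: "finite J" "J \<subseteq> {0..}" "Y = (\<lambda>\<omega>. \<Sum>t\<in>J. c t * B t \<omega>)"
    unfolding gspace_def by blast
  have "expectation Y = (\<Sum>t\<in>J. c t * expectation (B t))"
    unfolding J(3) using J(2) by (subst Bochner_Integration.integral_sum) (auto intro!: gspace_integrable gspace_B)
  also have "\<dots> = 0"
    using J(2) fbm by (intro sum.neutral) (auto simp: fractional_brownian_motion_def subset_eq)
  finally show ?thesis .
qed

definition ip :: "('a \<Rightarrow> real) \<Rightarrow> ('a \<Rightarrow> real) \<Rightarrow> real" where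
  "ip Y W = expectation (\<lambda>\<omega>. Y \<omega> * W \<omega>)"

lemma gspace_law_sq:
  assumes Y: "Y \<in> gspace"
  shows "\<exists>s. distr M borel Y = distr std_normal_distribution borel (\<lambda>x. s * x) \<and> s\<^sup>2 = ip Y Y
    \<and> integrable M (\<lambda>\<omega>. (Y \<omega>)\<^sup>2)"
proof -
  note [measurable] = gspace_measurable[OF Y]
  obtain m s where d: "distr M borel Y = distr std_normal_distribution borel (\<lambda>x. m + s * x)"
    using gspace_gaussian[OF Y] unfolding gaussian_rv_def by blast
  have "m = 0" using gaussian_integrable_mean[OF Y d] gspace_mean[OF Y] by simp
  with d have d: "distr M borel Y = distr std_normal_distribution borel (\<lambda>x. s * x)" by simp
  have i: "integrable std_normal_distribution (\<lambda>x. x\<^sup>2)"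
    using integrable_std_normal_distribution_moment[of 2] by simp
  have z: "(\<integral>x. x\<^sup>2 \<partial>std_normal_distribution) = 1"
    using std_normal_distribution_even_moments(1)[of 1] by simp
  have "integrable (distr M borel Y) (\<lambda>x. x\<^sup>2)"
    unfolding d using i by (subst integrable_distr_eq) (auto simp: power_mult_distrib)
  then have 1: "integrable M (\<lambda>\<omega>. (Y \<omega>)\<^sup>2)" by (subst (asm) integrable_distr_eq) auto
  have "ip Y Y = (\<integral>x. x\<^sup>2 \<partial>distr M borel Y)" unfolding ip_def by (subst integral_distr) (auto simp: power2_eq_square)
  also have "\<dots> = s\<^sup>2"
    unfolding d using i z by (subst integral_distr) (auto simp: power_mult_distrib)
  finally show ?thesis using d 1 by auto
qed

lemma gspace_prod_integrable: assumes "Y \<in> gspace" "W \<in> gspace" shows "integrable M (\<lambda>\<omega>. Y \<omega> * W \<omega>)"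
proof (rule Bochner_Integration.integrable_bound)
  note [measurable] = assms[THEN gspace_measurable]
  show "integrable M (\<lambda>\<omega>. (Y \<omega>)\<^sup>2 + (W \<omega>)\<^sup>2)"
    using gspace_law_sq[OF assms(1)] gspace_law_sq[OF assms(2)] by auto
  show "AE \<omega> in M. norm (Y \<omega> * W \<omega>) \<le> norm ((Y \<omega>)\<^sup>2 + (W \<omega>)\<^sup>2)"
  proof (rule AE_I2)
    fix \<omega>
    have "0 \<le> (\<bar>Y \<omega>\<bar> - \<bar>W \<omega>\<bar>)\<^sup>2" by simp
    then have "2 * (\<bar>Y \<omega>\<bar> * \<bar>W \<omega>\<bar>) \<le> (Y \<omega>)\<^sup>2 + (W \<omega>)\<^sup>2" by (simp add: power2_diff)
    moreover have "0 \<le> \<bar>Y \<omega>\<bar> * \<bar>W \<omega>\<bar>" by simp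
    ultimately show "norm (Y \<omega> * W \<omega>) \<le> norm ((Y \<omega>)\<^sup>2 + (W \<omega>)\<^sup>2)"
      unfolding real_norm_def abs_mult by linarith
  qed
  show "(\<lambda>\<omega>. Y \<omega> * W \<omega>) \<in> borel_measurable M"
    using assms[THEN gspace_measurable] by (rule borel_measurable_times)
qed

lemma ip_commute: "ip Y W = ip W Y" by (simp add: ip_def mult.commute)

lemma ip_scale: "ip (\<lambda>\<omega>. a * Y \<omega>) W = a * ip Y W" "ip W (\<lambda>\<omega>. a * Y \<omega>) = a * ip W Y"
  by (simp_all add: ip_def mult.assoc mult.left_commute)

lemma ip_add: assumes "Y \<in> gspace" "Y' \<in> gspace" "W \<in> gspace"
  shows "ip (\<lambda>\<omega>. Y \<omega> + Y' \<omega>) W = ip Y W + ip Y' W" "ip W (\<lambda>\<omega>. Y \<omega> + Y' \<omega>) = ip W Y + ip W Y'"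
  using assms by (simp_all add: ip_def distrib_right distrib_left gspace_prod_integrable)

lemma ip_diff: assumes "Y \<in> gspace" "Y' \<in> gspace" "W \<in> gspace"
  shows "ip (\<lambda>\<omega>. Y \<omega> - Y' \<omega>) W = ip Y W - ip Y' W" "ip W (\<lambda>\<omega>. Y \<omega> - Y' \<omega>) = ip W Y - ip W Y'"
  using assms by (simp_all add: ip_def left_diff_distrib right_diff_distrib gspace_prod_integrable)

lemma ip_sum: assumes "finite I" "\<And>i. i \<in> I \<Longrightarrow> Y i \<in> gspace" "W \<in> gspace"
  shows "ip (\<lambda>\<omega>. \<Sum>i\<in>I. Y i \<omega>) W = (\<Sum>i\<in>I. ip (Y i) W)" "ip W (\<lambda>\<omega>. \<Sum>i\<in>I. Y i \<omega>) = (\<Sum>i\<in>I. ip W (Y i))"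
  using assms by (simp_all add: ip_def sum_distrib_left sum_distrib_right gspace_prod_integrable)

lemma ip_B: assumes "0 \<le> s" "0 \<le> t"
  shows "ip (B s) (B t) = (s powr \<alpha> + t powr \<alpha> - \<bar>t - s\<bar> powr \<alpha>) / 2"
proof -
  have "covariance M (B s) (B t) = (\<bar>s\<bar> powr (2 * (\<alpha> / 2)) + \<bar>t\<bar> powr (2 * (\<alpha> / 2)) - \<bar>t - s\<bar> powr (2 * (\<alpha> / 2))) / 2"
    using fbm assms unfolding fractional_brownian_motion_def by blast
  moreover have "expectation (B s) = 0" "expectation (B t) = 0"
    using assms by (auto intro!: gspace_mean gspace_B)
  ultimately show ?thesis using assms by (simp add: covariance_def ip_def)
qed

lemma ip_B_diag: "0 \<le> t \<Longrightarrow> ip (B t) (B t) = t powr \<alpha>"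
  using ip_B[of t t] by simp

lemma gspace_exp:
  assumes Y: "Y \<in> gspace"
  shows gspace_integrable_exp: "integrable M (\<lambda>\<omega>. exp (Y \<omega>))"
    and gspace_expectation_exp: "expectation (\<lambda>\<omega>. exp (Y \<omega>)) = exp (ip Y Y / 2)"
    and gspace_iexp: "(\<integral>\<omega>. iexp (Y \<omega>) \<partial>M) = complex_of_real (exp (- ip Y Y / 2))"
    and gspace_exp_iexp: "(\<integral>\<omega>. complex_of_real (exp (Y \<omega>)) * iexp (r * Y \<omega>) \<partial>M)
      = complex_of_real (exp (ip Y Y / 2 - r\<^sup>2 * ip Y Y / 2)) * iexp (r * ip Y Y)"
proof -
  note [measurable] = gspace_measurable[OF Y]
  obtain s where d: "distr M borel Y = distr std_normal_distribution borel (\<lambda>x. s * x)" and s: "s\<^sup>2 = ip Y Y"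
    using gspace_law_sq[OF Y] by blast
  have "integrable (distr M borel Y) exp"
    unfolding d using integrable_std_normal_exp by (subst integrable_distr_eq) auto
  then show "integrable M (\<lambda>\<omega>. exp (Y \<omega>))" by (subst (asm) integrable_distr_eq) auto
  have "expectation (\<lambda>\<omega>. exp (Y \<omega>)) = (\<integral>x. exp x \<partial>distr M borel Y)" by (subst integral_distr) auto
  then show "expectation (\<lambda>\<omega>. exp (Y \<omega>)) = exp (ip Y Y / 2)"
    unfolding d by (subst (asm) integral_distr) (auto simp: std_normal_exp s)
  have "(\<integral>\<omega>. iexp (Y \<omega>) \<partial>M) = (\<integral>x. iexp x \<partial>distr M borel Y)" by (subst integral_distr) auto
  also have "\<dots> = (\<integral>x. iexp (s * x) \<partial>std_normal_distribution)"
    unfolding d by (subst integral_distr) auto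
  finally show "(\<integral>\<omega>. iexp (Y \<omega>) \<partial>M) = complex_of_real (exp (- ip Y Y / 2))" by (simp only: std_normal_iexp s)
  have "(\<integral>\<omega>. complex_of_real (exp (Y \<omega>)) * iexp (r * Y \<omega>) \<partial>M)
      = (\<integral>x. complex_of_real (exp x) * iexp (r * x) \<partial>distr M borel Y)" by (subst integral_distr) auto
  also have "\<dots> = (\<integral>x. complex_of_real (exp (s * x)) * iexp ((r * s) * x) \<partial>std_normal_distribution)"
    unfolding d by (subst integral_distr) (auto simp: mult.assoc)
  also have "\<dots> = complex_of_real (exp (s\<^sup>2 / 2 - (r * s)\<^sup>2 / 2)) * iexp ((r * s) * s)"
    by (rule std_normal_exp_iexp)
  also have "(r * s) * s = r * ip Y Y" by (simp add: s[symmetric] power2_eq_square)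
  also have "(r * s)\<^sup>2 = r\<^sup>2 * ip Y Y" by (simp add: s[symmetric] power_mult_distrib)
  finally show "(\<integral>\<omega>. complex_of_real (exp (Y \<omega>)) * iexp (r * Y \<omega>) \<partial>M)
      = complex_of_real (exp (ip Y Y / 2 - r\<^sup>2 * ip Y Y / 2)) * iexp (r * ip Y Y)" by (simp only: s)
qed

text \<open>The component of \<open>Y\<close> orthogonal to \<open>W\<close> factors out, by uniqueness of characteristic
  functions; this is the Cameron--Martin formula.\<close>

lemma gspace_tilt:
  assumes W: "W \<in> gspace" and Y: "Y \<in> gspace"
  shows "(\<integral>\<omega>. complex_of_real (exp (W \<omega>)) * iexp (Y \<omega>) \<partial>M)
       = complex_of_real (exp (ip W W / 2 - ip Y Y / 2)) * iexp (ip W Y)"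
proof (cases "ip W W = 0")
  case True
  note [measurable] = gspace_measurable[OF W] gspace_measurable[OF Y]
  have "AE \<omega> in M. W \<omega> * W \<omega> = 0"
    using True gspace_prod_integrable[OF W W] unfolding ip_def
    by (subst (asm) integral_nonneg_eq_0_iff_AE) auto
  then have ae: "AE \<omega> in M. W \<omega> = 0" by simp
  have "ip W Y = expectation (\<lambda>\<omega>. 0)"
    unfolding ip_def using ae by (intro integral_cong_AE) auto
  moreover have "(\<integral>\<omega>. complex_of_real (exp (W \<omega>)) * iexp (Y \<omega>) \<partial>M) = (\<integral>\<omega>. iexp (Y \<omega>) \<partial>M)"
    using ae by (intro integral_cong_AE) auto
  ultimately show ?thesis using True by (simp only: gspace_iexp[OF Y]) simp
next
  case False
  note [measurable] = gspace_measurable[OF W] gspace_measurable[OF Y]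
  define \<rho> where "\<rho> = ip W Y / ip W W"
  define Y' where "Y' = (\<lambda>\<omega>. Y \<omega> - \<rho> * W \<omega>)"
  have \<rho>W: "(\<lambda>\<omega>. \<rho> * W \<omega>) \<in> gspace" by (rule gspace_scale[OF W])
  have Y': "Y' \<in> gspace" unfolding Y'_def by (rule gspace_diff[OF Y \<rho>W])
  note [measurable] = gspace_measurable[OF Y']
  have orth: "ip W Y' = 0"
  proof -
    have "ip W Y' = ip W Y - \<rho> * ip W W"
      unfolding Y'_def using W Y \<rho>W by (simp add: ip_diff ip_scale)
    then show ?thesis using False by (simp add: \<rho>_def)
  qed
  have "ip Y' Y' = ip Y Y - \<rho> * ip W Y - \<rho> * (ip W Y - \<rho> * ip W W)"
    unfolding Y'_def using W Y \<rho>W gspace_diff[OF Y \<rho>W]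
    by (simp add: ip_diff ip_scale ip_commute[of Y W])
  then have norm_Y': "ip Y' Y' = ip Y Y - \<rho>\<^sup>2 * ip W W"
    using False by (simp add: \<rho>_def power2_eq_square)
  have "(\<integral>\<omega>. iexp (Y' \<omega>) * (complex_of_real (exp (W \<omega>)) * iexp (\<rho> * W \<omega>)) \<partial>M)
      = (\<integral>\<omega>. complex_of_real (exp (- ip Y' Y' / 2)) * (complex_of_real (exp (W \<omega>)) * iexp (\<rho> * W \<omega>)) \<partial>M)"
  \<comment> \<open>The weight \<open>iexp Y'\<close> is compared with its constant mean; agreement
    on the functions \<open>iexp (u * W)\<close> transfers to the unbounded test function
    \<open>h\<close>.\<close>
  proof (rule weighted_char_unique[where h = "\<lambda>x. complex_of_real (exp x) * iexp (\<rho> * x)"])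
    show "(\<integral>\<omega>. iexp (Y' \<omega>) * iexp (u * W \<omega>) \<partial>M) = (\<integral>\<omega>. complex_of_real (exp (- ip Y' Y' / 2)) * iexp (u * W \<omega>) \<partial>M)" for u
    proof -
      have uW: "(\<lambda>\<omega>. u * W \<omega>) \<in> gspace" by (rule gspace_scale[OF W])
      have "ip (\<lambda>\<omega>. Y' \<omega> + u * W \<omega>) (\<lambda>\<omega>. Y' \<omega> + u * W \<omega>) = ip Y' Y' + u * (u * ip W W)"
        using W Y' uW gspace_add[OF Y' uW] orth by (simp add: ip_add ip_scale ip_commute[of Y' W])
      then have "(\<integral>\<omega>. iexp (Y' \<omega> + u * W \<omega>) \<partial>M) = complex_of_real (exp (- (ip Y' Y' + u * (u * ip W W)) / 2))"
        using gspace_iexp[OF gspace_add[OF Y' uW]] by simp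
      moreover have "(\<integral>\<omega>. iexp (u * W \<omega>) \<partial>M) = complex_of_real (exp (- (u * (u * ip W W)) / 2))"
        using gspace_iexp[OF uW] by (simp add: ip_scale)
      moreover have "iexp (Y' \<omega>) * iexp (u * W \<omega>) = iexp (Y' \<omega> + u * W \<omega>)" for \<omega>
        by (simp add: exp_add[symmetric] distrib_left)
      ultimately show ?thesis
        by (simp only: integral_mult_right_zero of_real_mult[symmetric] exp_add[symmetric])
           (simp add: add_divide_distrib del: of_real_exp)
    qed
    show "integrable M (\<lambda>\<omega>. complex_of_real (exp (W \<omega>)) * iexp (\<rho> * W \<omega>))"
      by (rule Bochner_Integration.integrable_bound[OF gspace_integrable_exp[OF W]]) (auto simp: norm_mult)
    then show "integrable M (\<lambda>\<omega>. complex_of_real (exp (W \<omega>)) * iexp (\<rho> * W \<omega>))" .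
    have "0 \<le> ip Y' Y'" unfolding ip_def by simp
    then show "norm (complex_of_real (exp (- ip Y' Y' / 2))) \<le> 1" by simp
  qed (auto intro: prob_space_axioms)
  moreover have "iexp (Y' \<omega>) * (complex_of_real (exp (W \<omega>)) * iexp (\<rho> * W \<omega>)) = complex_of_real (exp (W \<omega>)) * iexp (Y \<omega>)" for \<omega>
  proof -
    have "iexp (Y' \<omega>) * iexp (\<rho> * W \<omega>) = iexp (Y \<omega>)"
      by (simp add: exp_add[symmetric] Y'_def algebra_simps)
    then show ?thesis by (metis mult.left_commute)
  qed
  ultimately have "(\<integral>\<omega>. complex_of_real (exp (W \<omega>)) * iexp (Y \<omega>) \<partial>M)
      = complex_of_real (exp (- ip Y' Y' / 2)) * (\<integral>\<omega>. complex_of_real (exp (W \<omega>)) * iexp (\<rho> * W \<omega>) \<partial>M)"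
    by (simp only: integral_mult_right_zero)
  also have "\<dots> = complex_of_real (exp (- ip Y' Y' / 2) * exp (ip W W / 2 - \<rho>\<^sup>2 * ip W W / 2)) * iexp (\<rho> * ip W W)"
    by (simp only: gspace_exp_iexp[OF W]) simp
  also have "exp (- ip Y' Y' / 2) * exp (ip W W / 2 - \<rho>\<^sup>2 * ip W W / 2) = exp (ip W W / 2 - ip Y Y / 2)"
    by (simp add: exp_add[symmetric] norm_Y' field_simps)
  also have "\<rho> * ip W W = ip W Y" using False by (simp add: \<rho>_def)
  finally show ?thesis .
qed

section \<open>Shift invariance of expected weighted maxima\<close>

abbreviation X :: "real \<Rightarrow> 'a \<Rightarrow> real" where
  "X \<equiv> Bstar B \<alpha>"

abbreviation V :: "real \<Rightarrow> 'a \<Rightarrow> real" where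
  "V t \<omega> \<equiv> exp (X t \<omega>)"

lemma X_measurable: "0 \<le> t \<Longrightarrow> X t \<in> borel_measurable M"
  using gspace_measurable[OF gspace_B[of t]] unfolding Bstar_def by measurable

lemma V_integrable: assumes "0 \<le> t" shows "integrable M (V t)"
proof -
  have "(\<lambda>\<omega>. sqrt 2 * B t \<omega>) \<in> gspace" by (intro gspace_scale gspace_B assms)
  from gspace_integrable_exp[OF this] show ?thesis
    by (simp add: Bstar_def exp_diff)
qed

lemma V_expectation: assumes "0 \<le> t" shows "expectation (V t) = 1"
proof -
  have "(\<lambda>\<omega>. sqrt 2 * B t \<omega>) \<in> gspace" by (intro gspace_scale gspace_B assms)
  from gspace_expectation_exp[OF this] show ?thesis
    using assms by (simp add: Bstar_def exp_diff ip_scale ip_B_diag)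
qed

text \<open>The increments of \<open>B\<close> after \<open>h\<close> have the covariance of
  \<open>B\<close> itself, and the density \<open>V h\<close> adds the mean \<open>ip W Y\<close>,
  which turns the drift \<open>- ?S\<close> of the increments into the drift \<open>- ?T\<close> of
  the unshifted process.\<close>

lemma tilted_char:
  assumes h: "0 \<le> h" and J: "finite J" and \<tau>: "\<And>j. j \<in> J \<Longrightarrow> 0 \<le> \<tau> j"
  shows "(\<integral>\<omega>. complex_of_real (V h \<omega>) * iexp (\<Sum>j\<in>J. u j * (X (\<tau> j + h) \<omega> - X h \<omega>)) \<partial>M)
       = (\<integral>\<omega>. iexp (\<Sum>j\<in>J. u j * X (\<tau> j) \<omega>) \<partial>M)"
proof -
  define W where "W = (\<lambda>\<omega>. sqrt 2 * B h \<omega>)"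
  define Y where "Y = (\<lambda>\<omega>. \<Sum>j\<in>J. (sqrt 2 * u j) * (B (\<tau> j + h) \<omega> - B h \<omega>))"
  define U where "U = (\<lambda>\<omega>. \<Sum>j\<in>J. (sqrt 2 * u j) * B (\<tau> j) \<omega>)"
  have W: "W \<in> gspace" unfolding W_def by (intro gspace_scale gspace_B h)
  have d: "(\<lambda>\<omega>. B (\<tau> j + h) \<omega> - B h \<omega>) \<in> gspace" if "j \<in> J" for j
    using \<tau>[OF that] h by (intro gspace_diff gspace_B) auto
  have d': "(\<lambda>\<omega>. (sqrt 2 * u j) * (B (\<tau> j + h) \<omega> - B h \<omega>)) \<in> gspace" if "j \<in> J" for j
    by (rule gspace_scale[OF d[OF that]])
  have b': "(\<lambda>\<omega>. (sqrt 2 * u j) * B (\<tau> j) \<omega>) \<in> gspace" if "j \<in> J" for j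
    by (rule gspace_scale[OF gspace_B[OF \<tau>[OF that]]])
  have Y: "Y \<in> gspace" unfolding Y_def using J d' by (rule gspace_sum)
  have U: "U \<in> gspace" unfolding U_def using J b' by (rule gspace_sum)
  have ipWW: "ip W W = 2 * h powr \<alpha>" using h by (simp add: W_def ip_scale ip_B_diag)
  have ip_dd: "ip (\<lambda>\<omega>. B (\<tau> i + h) \<omega> - B h \<omega>) (\<lambda>\<omega>. B (\<tau> j + h) \<omega> - B h \<omega>) = ip (B (\<tau> i)) (B (\<tau> j))"
    if "i \<in> J" "j \<in> J" for i j
    using \<tau>[OF that(1)] \<tau>[OF that(2)] h d[OF that(2)]
    by (simp add: ip_diff ip_B gspace_B field_simps)
  have "ip Y Y = (\<Sum>i\<in>J. \<Sum>j\<in>J. (sqrt 2 * u i) * ((sqrt 2 * u j) * ip (B (\<tau> i)) (B (\<tau> j))))"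
    unfolding Y_def using J d d' Y[unfolded Y_def]
    by (simp add: ip_sum ip_scale ip_dd sum_distrib_left cong: sum.cong)
  also have "\<dots> = ip U U"
    unfolding U_def using J b' gspace_B \<tau> U[unfolded U_def]
    by (simp add: ip_sum ip_scale sum_distrib_left cong: sum.cong)
  finally have ipYY: "ip Y Y = ip U U" .
  have "ip W Y = (\<Sum>j\<in>J. u j * ((\<tau> j + h) powr \<alpha> - h powr \<alpha> - \<tau> j powr \<alpha>))"
  proof -
    have "ip W Y = (\<Sum>j\<in>J. sqrt 2 * ((sqrt 2 * u j) * (ip (B h) (B (\<tau> j + h)) - ip (B h) (B h))))"
      unfolding W_def Y_def using J d' W[unfolded W_def] \<tau> h
      by (simp add: ip_sum ip_scale ip_diff gspace_B sum_distrib_left cong: sum.cong)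
    also have "\<dots> = (\<Sum>j\<in>J. u j * ((\<tau> j + h) powr \<alpha> - h powr \<alpha> - \<tau> j powr \<alpha>))"
    proof (intro sum.cong refl)
      fix j assume "j \<in> J"
      have "sqrt 2 * (sqrt 2 * u j * x) = 2 * u j * x" for x
        by (simp add: mult.assoc[symmetric])
      then show "sqrt 2 * ((sqrt 2 * u j) * (ip (B h) (B (\<tau> j + h)) - ip (B h) (B h)))
          = u j * ((\<tau> j + h) powr \<alpha> - h powr \<alpha> - \<tau> j powr \<alpha>)"
        using \<tau>[OF \<open>j \<in> J\<close>] h by (simp only:) (simp add: ip_B field_simps)
    qed
    finally show ?thesis .
  qed
  note ipWY = this
  let ?S = "\<Sum>j\<in>J. u j * ((\<tau> j + h) powr \<alpha> - h powr \<alpha>)"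
  let ?T = "\<Sum>j\<in>J. u j * \<tau> j powr \<alpha>"
  have ipWY': "ip W Y = ?S - ?T" by (simp add: ipWY sum_subtractf[symmetric] algebra_simps)
  have sumY: "(\<Sum>j\<in>J. u j * (X (\<tau> j + h) \<omega> - X h \<omega>)) = Y \<omega> - ?S" for \<omega>
    unfolding Y_def sum_subtractf[symmetric] Bstar_def
    using \<tau> h by (intro sum.cong) (auto simp: algebra_simps)
  have sumU: "(\<Sum>j\<in>J. u j * X (\<tau> j) \<omega>) = U \<omega> - ?T" for \<omega>
    unfolding U_def sum_subtractf[symmetric] Bstar_def
    using \<tau> by (intro sum.cong) (auto simp: algebra_simps)
  have iexp_diff: "iexp (a - b) = iexp a * iexp (- b)" for a b
    by (simp add: exp_add[symmetric] algebra_simps)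
  have "(\<integral>\<omega>. complex_of_real (V h \<omega>) * iexp (\<Sum>j\<in>J. u j * (X (\<tau> j + h) \<omega> - X h \<omega>)) \<partial>M)
      = (\<integral>\<omega>. (complex_of_real (exp (- (h powr \<alpha>))) * iexp (- ?S)) * (complex_of_real (exp (W \<omega>)) * iexp (Y \<omega>)) \<partial>M)"
    unfolding sumY iexp_diff[of "Y _"] using h
    by (intro Bochner_Integration.integral_cong refl) (simp add: Bstar_def W_def exp_diff exp_minus field_simps)
  also have "\<dots> = (complex_of_real (exp (- (h powr \<alpha>))) * iexp (- ?S)) * (complex_of_real (exp (ip W W / 2 - ip Y Y / 2)) * iexp (ip W Y))"
    by (simp only: integral_mult_right_zero gspace_tilt[OF W Y])
  also have "\<dots> = complex_of_real (exp (- (h powr \<alpha>)) * exp (ip W W / 2 - ip Y Y / 2)) * (iexp (- ?S) * iexp (ip W Y))"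
    by (simp only: of_real_mult mult_ac)
  also have "exp (- (h powr \<alpha>)) * exp (ip W W / 2 - ip Y Y / 2) = exp (- ip U U / 2)"
    by (simp add: exp_add[symmetric] ipWW ipYY)
  also have "iexp (- ?S) * iexp (ip W Y) = iexp (- ?T)"
    unfolding ipWY' by (simp add: exp_add[symmetric] distrib_left[symmetric] right_diff_distrib)
  also have "complex_of_real (exp (- ip U U / 2)) * iexp (- ?T) = (\<integral>\<omega>. iexp (U \<omega>) * iexp (- ?T) \<partial>M)"
    by (simp only: integral_mult_left_zero gspace_iexp[OF U])
  also have "\<dots> = (\<integral>\<omega>. iexp (\<Sum>j\<in>J. u j * X (\<tau> j) \<omega>) \<partial>M)"
    by (simp only: sumU iexp_diff[of "U _"])
  finally show ?thesis .
qed

text \<open>\<open>V h\<close> factors out of the maximum and becomes a density; under it the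
  increments after \<open>h\<close> are distributed like the process itself.\<close>

lemma weighted_max_shift:
  assumes h: "0 \<le> h" and J: "finite J" and \<tau>: "\<And>j. j \<in> J \<Longrightarrow> 0 \<le> \<tau> j" and c: "\<And>j. j \<in> J \<Longrightarrow> 0 \<le> c j"
  shows "expectation (\<lambda>\<omega>. weighted_max J c (\<lambda>j. V (\<tau> j + h) \<omega>))
       = expectation (\<lambda>\<omega>. weighted_max J c (\<lambda>j. V (\<tau> j) \<omega>))"
proof -
  have X_meas: "X (\<tau> j + h) \<in> borel_measurable M" "X (\<tau> j) \<in> borel_measurable M" if "j \<in> J" for j
    using \<tau>[OF that] h by (auto intro!: X_measurable)
  note [measurable] = X_measurable[OF h]
  define Q where "Q = density M (\<lambda>\<omega>. ennreal (V h \<omega>))"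
  have "prob_space Q"
  proof
    have "emeasure Q (space Q) = ennreal (expectation (V h))"
      using V_integrable[OF h] by (simp add: Q_def emeasure_density nn_integral_eq_integral cong: nn_integral_cong)
    then show "emeasure Q (space Q) = 1" using V_expectation[OF h] by simp
  qed
  have wm: "weighted_max J c (\<lambda>j. V (\<tau> j + h) \<omega>) = V h \<omega> * weighted_max J c (\<lambda>j. exp (X (\<tau> j + h) \<omega> - X h \<omega>))" for \<omega>
  proof -
    have "weighted_max J c (\<lambda>j. V (\<tau> j + h) \<omega>) \<le> s \<longleftrightarrow> weighted_max J c (\<lambda>j. exp (X (\<tau> j + h) \<omega> - X h \<omega>)) \<le> s / V h \<omega>" for s
      unfolding weighted_max_le_iff[OF J]
      by (simp add: exp_diff divide_le_cancel zero_le_divide_iff)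
    also have "\<dots> s \<longleftrightarrow> V h \<omega> * weighted_max J c (\<lambda>j. exp (X (\<tau> j + h) \<omega> - X h \<omega>)) \<le> s" for s
      by (simp add: field_simps)
    finally show ?thesis by (meson antisym order_refl)
  qed
  have m1: "(\<lambda>\<omega>. weighted_max J c (\<lambda>j. exp (X (\<tau> j + h) \<omega> - X h \<omega>))) \<in> borel_measurable M"
    using X_meas X_measurable[OF h]
    by (intro weighted_max_measurable[OF J] measurable_compose[OF _ borel_measurable_exp] borel_measurable_diff)
  have "expectation (\<lambda>\<omega>. weighted_max J c (\<lambda>j. V (\<tau> j + h) \<omega>))
      = (\<integral>\<omega>. weighted_max J c (\<lambda>j. exp (X (\<tau> j + h) \<omega> - X h \<omega>)) \<partial>Q)"
    unfolding wm Q_def using m1 by (subst integral_density) auto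
  also have "\<dots> = expectation (\<lambda>\<omega>. weighted_max J c (\<lambda>j. V (\<tau> j) \<omega>))"
  proof (rule expectation_weighted_max_unique[OF \<open>prob_space Q\<close> prob_space_axioms J _ _ _ c])
    fix u :: "'b \<Rightarrow> real"
    define S where "S = (\<lambda>\<omega>. \<Sum>j\<in>J. u j * (X (\<tau> j + h) \<omega> - X h \<omega>))"
    have [measurable]: "S \<in> borel_measurable M"
      unfolding S_def using X_meas X_measurable[OF h]
      by (intro borel_measurable_sum borel_measurable_times borel_measurable_diff) auto
    have "(\<integral>\<omega>. iexp (S \<omega>) \<partial>Q) = (\<integral>\<omega>. complex_of_real (V h \<omega>) * iexp (S \<omega>) \<partial>M)"
      unfolding Q_def by (subst integral_density) (auto simp: scaleR_conv_of_real)
    then show "(\<integral>\<omega>. iexp (\<Sum>j\<in>J. u j * (X (\<tau> j + h) \<omega> - X h \<omega>)) \<partial>Q) = (\<integral>\<omega>. iexp (\<Sum>j\<in>J. u j * X (\<tau> j) \<omega>) \<partial>M)"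
      by (simp only: S_def tilted_char[OF h J \<tau>])
  qed (use X_meas X_measurable[OF h] in \<open>auto simp: Q_def\<close>)
  finally show ?thesis .
qed

end

context fbm
begin

section \<open>Finite maxima of the exponential process\<close>

text \<open>A pair is a time with its weight. Carrying the weight along lets the interval and the
  two grids, with different weights, be united, split and shifted as plain sets.\<close>

definition mx :: "(real \<times> real) set \<Rightarrow> 'a \<Rightarrow> real" where
  "mx P \<omega> = weighted_max P snd (\<lambda>p. V (fst p) \<omega>)"

definition marked :: "(real \<times> real) set \<Rightarrow> bool" where
  "marked P \<longleftrightarrow> finite P \<and> P \<subseteq> {0..} \<times> {0..}"

lemma markedD: "marked P \<Longrightarrow> finite P" "marked P \<Longrightarrow> p \<in> P \<Longrightarrow> 0 \<le> fst p" "marked P \<Longrightarrow> p \<in> P \<Longrightarrow> 0 \<le> snd p"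
  by (auto simp: marked_def)

lemma marked_Un: "marked P \<Longrightarrow> marked Q \<Longrightarrow> marked (P \<union> Q)"
  by (auto simp: marked_def)

lemma marked_subset: "marked P \<Longrightarrow> Q \<subseteq> P \<Longrightarrow> marked Q"
  by (auto simp: marked_def intro: finite_subset)

lemma mx_le_iff: "marked P \<Longrightarrow> mx P \<omega> \<le> s \<longleftrightarrow> 0 \<le> s \<and> (\<forall>p\<in>P. snd p * V (fst p) \<omega> \<le> s)"
  unfolding mx_def by (rule weighted_max_le_iff) (rule markedD)

lemma mx_nonneg: "marked P \<Longrightarrow> 0 \<le> mx P \<omega>"
  using mx_le_iff[of P \<omega> "mx P \<omega>"] by simp

lemma mx_ge: "marked P \<Longrightarrow> p \<in> P \<Longrightarrow> snd p * V (fst p) \<omega> \<le> mx P \<omega>"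
  using mx_le_iff[of P \<omega> "mx P \<omega>"] by simp

lemma mx_Un: assumes "marked P" "marked Q" shows "mx (P \<union> Q) \<omega> = max (mx P \<omega>) (mx Q \<omega>)"
proof -
  have "mx (P \<union> Q) \<omega> \<le> s \<longleftrightarrow> max (mx P \<omega>) (mx Q \<omega>) \<le> s" for s
    using assms marked_Un[OF assms] by (auto simp: mx_le_iff)
  then show ?thesis by (meson antisym order_refl)
qed

lemma mx_mono: "marked Q \<Longrightarrow> P \<subseteq> Q \<Longrightarrow> mx P \<omega> \<le> mx Q \<omega>"
  using marked_subset[of Q P] by (auto simp: mx_le_iff mx_nonneg intro!: mx_ge)

lemma mx_measurable: assumes "marked P" shows "mx P \<in> borel_measurable M"
  unfolding mx_def using assms
  by (intro weighted_max_measurable measurable_compose[OF X_measurable borel_measurable_exp]) (auto dest: markedD)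

lemma mx_le_sum: assumes "marked P" shows "mx P \<omega> \<le> (\<Sum>p\<in>P. snd p * V (fst p) \<omega>)"
proof -
  have "0 \<le> snd p * V (fst p) \<omega>" if "p \<in> P" for p
    using markedD(3)[OF assms that] by simp
  then show ?thesis
    unfolding mx_le_iff[OF assms] using markedD(1)[OF assms]
    by (intro conjI ballI sum_nonneg member_le_sum) auto
qed

lemma mx_integrable: assumes "marked P" shows "integrable M (mx P)"
proof (rule Bochner_Integration.integrable_bound)
  show "integrable M (\<lambda>\<omega>. \<Sum>p\<in>P. snd p * V (fst p) \<omega>)"
    using assms by (intro Bochner_Integration.integrable_sum integrable_mult_right V_integrable) (auto dest: markedD)
  show "AE \<omega> in M. norm (mx P \<omega>) \<le> norm (\<Sum>p\<in>P. snd p * V (fst p) \<omega>)"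
  proof (rule AE_I2)
    fix \<omega>
    show "norm (mx P \<omega>) \<le> norm (\<Sum>p\<in>P. snd p * V (fst p) \<omega>)"
      using mx_le_sum[OF assms, of \<omega>] mx_nonneg[OF assms, of \<omega>] unfolding real_norm_def by linarith
  qed
qed (rule mx_measurable[OF assms])

definition Phi :: "(real \<times> real) set \<Rightarrow> real" where
  "Phi P = expectation (mx P)"

lemma Phi_Un: assumes "marked P" "marked Q" shows "Phi (P \<union> Q) \<le> Phi P + Phi Q"
proof -
  have "expectation (mx (P \<union> Q)) \<le> expectation (\<lambda>\<omega>. mx P \<omega> + mx Q \<omega>)"
    using assms mx_nonneg[OF assms(1)] mx_nonneg[OF assms(2)]
    by (intro integral_mono) (auto intro!: mx_integrable marked_Un simp: mx_Un)
  then show ?thesis using assms by (simp add: Phi_def mx_integrable)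
qed

lemma Phi_mono: "marked Q \<Longrightarrow> P \<subseteq> Q \<Longrightarrow> Phi P \<le> Phi Q"
  unfolding Phi_def using marked_subset[of Q P]
  by (intro integral_mono) (auto intro!: mx_integrable mx_mono)

lemma Phi_shift:
  assumes "marked P" "0 \<le> h" shows "Phi ((\<lambda>(t, c). (t + h, c)) ` P) = Phi P"
proof -
  have "expectation (\<lambda>\<omega>. weighted_max P snd (\<lambda>p. V (fst p + h) \<omega>)) = expectation (\<lambda>\<omega>. weighted_max P snd (\<lambda>p. V (fst p) \<omega>))"
    using assms by (intro weighted_max_shift) (auto dest: markedD)
  then show ?thesis
    by (simp add: Phi_def mx_def[abs_def] weighted_max_def image_image case_prod_beta)
qed

text \<open>In the variance of \<open>B s + B t\<close> everything but the term
  \<open>\<bar>t - s\<bar> powr \<alpha>\<close> is compensated by the drift. The formula serves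
  small distances in \<open>V_modulus\<close> and large ones in
  \<open>sup_grid_linear_lower\<close>.\<close>

lemma sqrt_V_expectation:
  assumes "0 \<le> s" "0 \<le> t"
  shows "integrable M (\<lambda>\<omega>. exp (X s \<omega> / 2) * exp (X t \<omega> / 2))"
    and "expectation (\<lambda>\<omega>. exp (X s \<omega> / 2) * exp (X t \<omega> / 2)) = exp (- (\<bar>t - s\<bar> powr \<alpha>) / 4)"
proof -
  define Y where "Y = (\<lambda>\<omega>. (sqrt 2 / 2) * (B s \<omega> + B t \<omega>))"
  have 1: "(\<lambda>\<omega>. B s \<omega> + B t \<omega>) \<in> gspace" using assms by (intro gspace_add gspace_B)
  then have Y: "Y \<in> gspace" unfolding Y_def by (rule gspace_scale)
  have eq: "exp (X s \<omega> / 2) * exp (X t \<omega> / 2) = exp (- (s powr \<alpha> + t powr \<alpha>) / 2) * exp (Y \<omega>)" for \<omega>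
    using assms by (simp add: exp_add[symmetric] Bstar_def Y_def field_simps)
  show "integrable M (\<lambda>\<omega>. exp (X s \<omega> / 2) * exp (X t \<omega> / 2))"
    unfolding eq by (intro integrable_mult_right gspace_integrable_exp Y)
  have "ip Y Y = (sqrt 2 / 2) * ((sqrt 2 / 2) * ip (\<lambda>\<omega>. B s \<omega> + B t \<omega>) (\<lambda>\<omega>. B s \<omega> + B t \<omega>))"
    by (simp only: Y_def ip_scale)
  also have "ip (\<lambda>\<omega>. B s \<omega> + B t \<omega>) (\<lambda>\<omega>. B s \<omega> + B t \<omega>) = 2 * s powr \<alpha> + 2 * t powr \<alpha> - \<bar>t - s\<bar> powr \<alpha>"
    using assms 1 by (simp add: ip_add gspace_B ip_B abs_minus_commute field_simps)
  also have "(sqrt 2 / 2) * ((sqrt 2 / 2) * (2 * s powr \<alpha> + 2 * t powr \<alpha> - \<bar>t - s\<bar> powr \<alpha>))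
      = (2 * s powr \<alpha> + 2 * t powr \<alpha> - \<bar>t - s\<bar> powr \<alpha>) / 2"
    by (simp add: field_simps)
  finally have ipY: "ip Y Y = (2 * s powr \<alpha> + 2 * t powr \<alpha> - \<bar>t - s\<bar> powr \<alpha>) / 2" .
  show "expectation (\<lambda>\<omega>. exp (X s \<omega> / 2) * exp (X t \<omega> / 2)) = exp (- (\<bar>t - s\<bar> powr \<alpha>) / 4)"
    unfolding eq integral_mult_right_zero gspace_expectation_exp[OF Y] ipY
    by (simp add: exp_add[symmetric] field_simps)
qed

text \<open>With \<open>k\<close> the affinity at distance \<delta> and
  \<open>l = sqrt (1 - k)\<close>, the estimate in \<open>V_modulus\<close> yields
  \<open>l * (2 + k)\<close>; the 3 bounds \<open>2 + k\<close>.\<close>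

definition modulus :: "real \<Rightarrow> real" where
  "modulus \<delta> = 3 * sqrt (1 - exp (- (\<delta> powr \<alpha>) / 4))"

lemma modulus_mono: assumes "0 \<le> x" "x \<le> y" shows "modulus x \<le> modulus y"
proof -
  have "x powr \<alpha> \<le> y powr \<alpha>" using assms \<alpha> by (intro powr_mono2) auto
  then show ?thesis by (simp add: modulus_def)
qed

lemma modulus_nonneg: "0 \<le> modulus x"
  by (simp add: modulus_def)

lemma modulus_tendsto: "(\<lambda>n. modulus (1 / real (Suc n))) \<longlonglongrightarrow> 0"
proof -
  have "(\<lambda>n. (1 / real (Suc n)) powr \<alpha>) \<longlonglongrightarrow> 0"
    using \<alpha> by real_asymp
  then have "(\<lambda>n. 3 * sqrt (1 - exp (- ((1 / real (Suc n)) powr \<alpha>) / 4))) \<longlonglongrightarrow> 3 * sqrt (1 - exp (- 0 / 4))"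
    by (intro tendsto_intros) auto
  then show ?thesis by (simp add: modulus_def)
qed

text \<open>By AM--GM, \<open>\<bar>a\<^sup>2 - b\<^sup>2\<bar> \<le> (a - b)\<^sup>2 / (2 * l) + l * (a + b)\<^sup>2 / 2\<close> for \<open>a = exp (X s / 2)\<close> and
  \<open>b = exp (X t / 2)\<close>.\<close>

lemma V_modulus:
  assumes st: "0 \<le> s" "0 \<le> t" and "\<bar>t - s\<bar> \<le> \<delta>"
  shows "expectation (\<lambda>\<omega>. \<bar>V s \<omega> - V t \<omega>\<bar>) \<le> modulus \<delta>"
proof (cases "s = t")
  case True
  then show ?thesis by (simp add: modulus_nonneg)
next
  case False
  define k where "k = exp (- (\<bar>t - s\<bar> powr \<alpha>) / 4)"
  have k: "k < 1" using False by (simp add: k_def)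
  \<comment> \<open>As \<open>(a - b)\<^sup>2\<close> has mean \<open>2 - 2 * k\<close>, this choice
    makes the first term of the bound equal to \<open>l\<close>.\<close>
  define l where "l = sqrt (1 - k)"
  have l: "0 < l" "l\<^sup>2 = 1 - k" using k by (simp_all add: l_def)
  let ?a = "\<lambda>\<omega>. exp (X s \<omega> / 2)" and ?b = "\<lambda>\<omega>. exp (X t \<omega> / 2)"
  note ab = sqrt_V_expectation[OF st]
  have sq: "?a \<omega> * ?a \<omega> = V s \<omega>" "?b \<omega> * ?b \<omega> = V t \<omega>" for \<omega>
    by (simp_all add: exp_add[symmetric])
  have I: "integrable M (\<lambda>\<omega>. (V s \<omega> + V t \<omega> - 2 * (?a \<omega> * ?b \<omega>)) / (2 * l) + l * (V s \<omega> + V t \<omega> + 2 * (?a \<omega> * ?b \<omega>)) / 2)"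
    using V_integrable st ab
    by (intro Bochner_Integration.integrable_add Bochner_Integration.integrable_diff integrable_divide_zero
        integrable_mult_right) auto
  have "expectation (\<lambda>\<omega>. \<bar>V s \<omega> - V t \<omega>\<bar>)
     \<le> expectation (\<lambda>\<omega>. (V s \<omega> + V t \<omega> - 2 * (?a \<omega> * ?b \<omega>)) / (2 * l) + l * (V s \<omega> + V t \<omega> + 2 * (?a \<omega> * ?b \<omega>)) / 2)"
  proof (rule integral_mono[OF _ I])
    show "integrable M (\<lambda>\<omega>. \<bar>V s \<omega> - V t \<omega>\<bar>)"
      using V_integrable st by auto
    fix \<omega>
    define a b where "a = ?a \<omega>" and "b = ?b \<omega>"
    have "0 \<le> (\<bar>a - b\<bar> - l * \<bar>a + b\<bar>)\<^sup>2 / (2 * l)" using l by simp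
    also have "\<dots> = (a - b)\<^sup>2 / (2 * l) + l * (a + b)\<^sup>2 / 2 - \<bar>a - b\<bar> * \<bar>a + b\<bar>"
      using l by (simp add: power2_diff power_mult_distrib field_simps power2_eq_square)
    also have "\<bar>a - b\<bar> * \<bar>a + b\<bar> = \<bar>V s \<omega> - V t \<omega>\<bar>"
      unfolding abs_mult[symmetric] sq[symmetric] a_def b_def by (simp add: algebra_simps)
    also have "(a - b)\<^sup>2 = V s \<omega> + V t \<omega> - 2 * (?a \<omega> * ?b \<omega>)"
      unfolding sq[symmetric] a_def b_def by (simp add: power2_eq_square algebra_simps)
    also have "(a + b)\<^sup>2 = V s \<omega> + V t \<omega> + 2 * (?a \<omega> * ?b \<omega>)"
      unfolding sq[symmetric] a_def b_def by (simp add: power2_eq_square algebra_simps)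
    finally show "\<bar>V s \<omega> - V t \<omega>\<bar> \<le> (V s \<omega> + V t \<omega> - 2 * (?a \<omega> * ?b \<omega>)) / (2 * l) + l * (V s \<omega> + V t \<omega> + 2 * (?a \<omega> * ?b \<omega>)) / 2"
      by linarith
  qed
  also have "\<dots> = (2 - 2 * k) / (2 * l) + l * (2 + 2 * k) / 2"
    using V_integrable[OF st(1)] V_integrable[OF st(2)] ab V_expectation[OF st(1)] V_expectation[OF st(2)]
    by (simp add: k_def)
  also have "\<dots> = l + l * (1 + k)"
  proof -
    have "(2 - 2 * k) / (2 * l) = l\<^sup>2 / l" by (simp only: l(2)) (simp add: diff_divide_distrib)
    then show ?thesis using l(1) by (simp add: power2_eq_square algebra_simps)
  qed
  also have "\<dots> \<le> 3 * l"
    using k l(1) mult_left_mono[of "1 + k" 2 l] by simp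
  also have "\<dots> = modulus \<bar>t - s\<bar>" by (simp add: modulus_def l_def k_def)
  also have "\<dots> \<le> modulus \<delta>" using assms by (intro modulus_mono) auto
  finally show ?thesis .
qed

text \<open>\<open>Y\<close> dominates each term once the times of the points in \<open>S\<close>
  are replaced by \<open>g p\<close>. The replacement errors are summed, since any of these terms
  may be the largest.\<close>

lemma Phi_perturb:
  assumes P: "marked P" and S: "S \<subseteq> P" and Y: "integrable M Y" "\<And>\<omega>. \<omega> \<in> space M \<Longrightarrow> 0 \<le> Y \<omega>"
    and fixed: "\<And>\<omega> p. \<omega> \<in> space M \<Longrightarrow> p \<in> P - S \<Longrightarrow> snd p * V (fst p) \<omega> \<le> Y \<omega>"
    and moved: "\<And>\<omega> p. \<omega> \<in> space M \<Longrightarrow> p \<in> S \<Longrightarrow> snd p * V (g p) \<omega> \<le> Y \<omega>"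
    and g: "\<And>p. p \<in> S \<Longrightarrow> 0 \<le> g p \<and> \<bar>g p - fst p\<bar> \<le> \<delta>"
  shows "Phi P \<le> expectation Y + (\<Sum>p\<in>S. snd p) * modulus \<delta>"
proof -
  have fin: "finite S" using P S by (auto simp: marked_def intro: finite_subset)
  have pos: "0 \<le> snd p" "0 \<le> fst p" if "p \<in> S" for p
    using that S markedD(2,3)[OF P, of p] by auto
  have I: "integrable M (\<lambda>\<omega>. \<bar>V (fst p) \<omega> - V (g p) \<omega>\<bar>)" if "p \<in> S" for p
    using pos[OF that] g[OF that] V_integrable by auto
  have "Phi P \<le> expectation (\<lambda>\<omega>. Y \<omega> + (\<Sum>p\<in>S. snd p * \<bar>V (fst p) \<omega> - V (g p) \<omega>\<bar>))"
    unfolding Phi_def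
  proof (rule integral_mono)
    show "integrable M (\<lambda>\<omega>. Y \<omega> + (\<Sum>p\<in>S. snd p * \<bar>V (fst p) \<omega> - V (g p) \<omega>\<bar>))"
      using I Y by (intro Bochner_Integration.integrable_add Bochner_Integration.integrable_sum integrable_mult_right) auto
    fix \<omega> assume \<omega>: "\<omega> \<in> space M"
    have nn: "0 \<le> (\<Sum>p\<in>S. snd p * \<bar>V (fst p) \<omega> - V (g p) \<omega>\<bar>)"
      using pos by (intro sum_nonneg) auto
    have "snd p * V (fst p) \<omega> \<le> Y \<omega> + (\<Sum>p\<in>S. snd p * \<bar>V (fst p) \<omega> - V (g p) \<omega>\<bar>)" if "p \<in> P" for p
    proof (cases "p \<in> S")
      case True
      have "snd p * V (fst p) \<omega> \<le> snd p * (V (g p) \<omega> + \<bar>V (fst p) \<omega> - V (g p) \<omega>\<bar>)"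
        using pos[OF True] by (intro mult_left_mono) auto
      also have "\<dots> = snd p * V (g p) \<omega> + snd p * \<bar>V (fst p) \<omega> - V (g p) \<omega>\<bar>"
        by (rule distrib_left)
      also have "\<dots> \<le> Y \<omega> + (\<Sum>p\<in>S. snd p * \<bar>V (fst p) \<omega> - V (g p) \<omega>\<bar>)"
        using pos True fin by (intro add_mono moved[OF \<omega> True] member_le_sum) auto
      finally show ?thesis .
    next
      case False
      then show ?thesis using fixed[OF \<omega>, of p] that nn by simp
    qed
    then show "mx P \<omega> \<le> Y \<omega> + (\<Sum>p\<in>S. snd p * \<bar>V (fst p) \<omega> - V (g p) \<omega>\<bar>)"
      using Y(2)[OF \<omega>] nn by (simp add: mx_le_iff[OF P])
  qed (rule mx_integrable[OF P])
  also have "\<dots> = expectation Y + (\<Sum>p\<in>S. snd p * expectation (\<lambda>\<omega>. \<bar>V (fst p) \<omega> - V (g p) \<omega>\<bar>))"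
    using I Y(1) by (simp add: Bochner_Integration.integral_sum)
  also have "\<dots> \<le> expectation Y + (\<Sum>p\<in>S. snd p * modulus \<delta>)"
    using g pos by (intro add_left_mono sum_mono mult_left_mono V_modulus) auto
  finally show ?thesis by (simp add: sum_distrib_right)
qed

section \<open>Exponential integrability of the supremum by chaining\<close>

definition incr :: "nat \<Rightarrow> nat \<Rightarrow> 'a \<Rightarrow> real" where
  "incr n k \<omega> = B (real (Suc k) / 2 ^ n) \<omega> - B (real k / 2 ^ n) \<omega>"

definition max_incr :: "nat \<Rightarrow> 'a \<Rightarrow> real" where
  "max_incr n \<omega> = (MAX k\<in>{..<2 ^ n}. \<bar>incr n k \<omega>\<bar>)"

lemma max_incr_ge: "k < 2 ^ n \<Longrightarrow> \<bar>incr n k \<omega>\<bar> \<le> max_incr n \<omega>"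
  unfolding max_incr_def by (intro Max_ge) auto

lemma max_incr_nonneg: "0 \<le> max_incr n \<omega>"
  using max_incr_ge[of 0 n \<omega>] by (auto intro: order_trans[OF abs_ge_zero])

lemma max_incr_attained: "\<exists>k<2 ^ n. max_incr n \<omega> = \<bar>incr n k \<omega>\<bar>"
proof -
  have "max_incr n \<omega> \<in> (\<lambda>k. \<bar>incr n k \<omega>\<bar>) ` {..<2 ^ n}"
    unfolding max_incr_def by (intro Max_in) (auto simp: lessThan_empty_iff)
  then show ?thesis by auto
qed

text \<open>An even index is a point of the coarser level; an odd one is a single fine step beyond
  such a point.\<close>

lemma dyadic_chain: "j \<le> 2 ^ N \<Longrightarrow> B (real j / 2 ^ N) \<omega> - B 0 \<omega> \<le> (\<Sum>n\<le>N. max_incr n \<omega>)"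
proof (induction N arbitrary: j)
  case 0
  then have "j = 0 \<or> j = 1" by auto
  then show ?case using max_incr_ge[of 0 0 \<omega>] max_incr_nonneg[of 0 \<omega>] by (auto simp: incr_def)
next
  case (Suc N)
  obtain i where i: "j = 2 * i \<or> j = Suc (2 * i)" by (metis oddE evenE Suc_eq_plus1)
  then have "i \<le> 2 ^ N" using Suc.prems by auto
  then have IH: "B (real i / 2 ^ N) \<omega> - B 0 \<omega> \<le> (\<Sum>n\<le>N. max_incr n \<omega>)" by (rule Suc.IH)
  have half: "real (2 * i) / 2 ^ Suc N = real i / 2 ^ N" by simp
  from i show ?case
  proof
    assume "j = 2 * i"
    then show ?thesis using IH max_incr_nonneg[of "Suc N" \<omega>] by (simp only: half sum.atMost_Suc)
  next
    assume j: "j = Suc (2 * i)"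
    then have "2 * i < 2 ^ Suc N" using Suc.prems by auto
    from max_incr_ge[OF this, of \<omega>]
    have "B (real j / 2 ^ Suc N) \<omega> - B (real i / 2 ^ N) \<omega> \<le> max_incr (Suc N) \<omega>"
      unfolding incr_def half j by linarith
    then show ?thesis using IH by (simp only: sum.atMost_Suc)
  qed
qed

text \<open>Jensen's inequality; the mass missing from the weights is put on an additional node
  \<open>Suc N\<close> with value 0, which contributes at most 1.\<close>

lemma exp_convex_sum:
  fixes p z :: "nat \<Rightarrow> real"
  assumes "\<And>n. 0 \<le> p n" "(\<Sum>n\<le>N. p n) \<le> 1"
  shows "exp (\<Sum>n\<le>N. p n * z n) \<le> 1 + (\<Sum>n\<le>N. p n * exp (z n))"
proof -
  define q where "q = 1 - (\<Sum>n\<le>N. p n)"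
  have "exp (\<Sum>i\<in>insert (Suc N) {..N}. (if i = Suc N then q else p i) *\<^sub>R (if i = Suc N then 0 else z i))
     \<le> (\<Sum>i\<in>insert (Suc N) {..N}. (if i = Suc N then q else p i) * exp (if i = Suc N then 0 else z i))"
    using assms by (intro convex_on_sum[OF _ _ exp_convex]) (auto simp: q_def)
  moreover have "(\<Sum>i\<in>{..N}. (if i = Suc N then q else p i) *\<^sub>R (if i = Suc N then 0 else z i)) = (\<Sum>n\<le>N. p n * z n)"
    by (intro sum.cong) auto
  moreover have "(\<Sum>i\<in>{..N}. (if i = Suc N then q else p i) * exp (if i = Suc N then 0 else z i)) = (\<Sum>n\<le>N. p n * exp (z n))"
    by (intro sum.cong) auto
  moreover have "q \<le> 1" using assms(1) by (simp add: q_def sum_nonneg)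
  ultimately show ?thesis by simp
qed

lemma ip_increment:
  assumes "0 \<le> s" "0 \<le> t"
  shows "ip (\<lambda>\<omega>. B t \<omega> - B s \<omega>) (\<lambda>\<omega>. B t \<omega> - B s \<omega>) = \<bar>t - s\<bar> powr \<alpha>"
proof -
  have "(\<lambda>\<omega>. B t \<omega> - B s \<omega>) \<in> gspace" using assms by (intro gspace_diff gspace_B)
  then show ?thesis
    using assms by (simp add: ip_diff gspace_B ip_B abs_minus_commute field_simps)
qed

lemma incr_exp:
  shows "integrable M (\<lambda>\<omega>. exp (a * incr n k \<omega>))"
    "expectation (\<lambda>\<omega>. exp (a * incr n k \<omega>)) = exp (a\<^sup>2 * (1 / 2 ^ n) powr \<alpha> / 2)"
proof -
  have d: "incr n k \<in> gspace"
    unfolding incr_def[abs_def] by (intro gspace_diff gspace_B) auto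
  have Y: "(\<lambda>\<omega>. a * incr n k \<omega>) \<in> gspace" by (rule gspace_scale[OF d])
  show "integrable M (\<lambda>\<omega>. exp (a * incr n k \<omega>))" by (rule gspace_integrable_exp[OF Y])
  have "ip (incr n k) (incr n k) = \<bar>real (Suc k) / 2 ^ n - real k / 2 ^ n\<bar> powr \<alpha>"
    unfolding incr_def[abs_def] by (rule ip_increment) auto
  also have "\<bar>real (Suc k) / 2 ^ n - real k / 2 ^ n\<bar> = 1 / 2 ^ n"
    by (simp add: add_divide_distrib)
  finally show "expectation (\<lambda>\<omega>. exp (a * incr n k \<omega>)) = exp (a\<^sup>2 * (1 / 2 ^ n) powr \<alpha> / 2)"
    unfolding gspace_expectation_exp[OF Y] by (simp add: ip_scale power2_eq_square)
qed

definition dyadics :: "real \<Rightarrow> nat \<Rightarrow> real set" where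
  "dyadics L m = (\<lambda>k. L * (real k / 2 ^ m)) ` {..2 ^ m}"

lemma marked_dyadics: "0 \<le> L \<Longrightarrow> 0 \<le> c \<Longrightarrow> marked (dyadics L m \<times> {c})"
  by (auto simp: marked_def dyadics_def)

lemma B_0: "AE \<omega> in M. B 0 \<omega> = 0"
proof -
  have B0: "B 0 \<in> gspace" by (rule gspace_B) simp
  have "ip (B 0) (B 0) = 0" by (simp add: ip_B_diag)
  then have "AE \<omega> in M. B 0 \<omega> * B 0 \<omega> = 0"
    using gspace_prod_integrable[OF B0 B0] unfolding ip_def
    by (subst (asm) integral_nonneg_eq_0_iff_AE) auto
  then show ?thesis by simp
qed

text \<open>Chaining in exponential form: up to centring, the sum over the levels is a convex
  combination of rescaled level maxima, so Jensen's inequality leaves one exponential moment per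
  level, for which a union bound over its \<open>2 ^ n\<close> increments suffices.\<close>

lemma Phi_dyadics_bounded: "\<exists>K. \<forall>N. Phi (dyadics 1 N \<times> {1}) \<le> K"
proof -
  \<comment> \<open>An increment of level \<open>n\<close> has standard deviation
    \<open>q ^ n\<close>. The convex weights \<open>p\<close> decay at the same rate, so the factor
    \<open>b n = sqrt 2 / p n\<close> gives all rescaled increments the same exponential moment
    \<open>K0\<close>.\<close>
  define q :: real where "q = 2 powr (- \<alpha> / 2)"
  have q: "0 < q" "q < 1" using \<alpha> by (simp_all add: q_def powr_less_one)
  define p where "p n = (1 - q) * q ^ n" for n
  have p_pos: "0 < p n" for n using q by (simp add: p_def)
  have geo: "(\<Sum>n\<le>N. p n) \<le> 1" for N
  proof -
    have "(\<Sum>n\<le>N. p n) = 1 - q ^ Suc N"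
      by (induction N) (simp_all add: p_def algebra_simps)
    then show ?thesis using q by simp
  qed
  have sq: "(1 / 2 ^ n) powr \<alpha> = (q ^ n)\<^sup>2" for n
  proof -
    have "(1 / 2 ^ n) powr \<alpha> = (2 powr (- real n)) powr \<alpha>" by (simp add: powr_minus powr_realpow inverse_eq_divide)
    also have "\<dots> = (2 powr (- \<alpha> / 2)) powr (real n * 2)" by (simp add: powr_powr algebra_simps)
    also have "\<dots> = q ^ (n * 2)" using q by (simp add: q_def powr_realpow[symmetric])
    finally show ?thesis by (simp add: power_mult)
  qed
  define K0 where "K0 = exp (1 / (1 - q)\<^sup>2)"
  \<comment> \<open>A centring with convergent sum. Rescaled, it produces the factor
    \<open>exp (- (sqrt 2 * (n + 1)))\<close>, which outweighs the \<open>2 ^ (n + 1)\<close>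
    exponentials of level \<open>n\<close>, one for each increment and sign.\<close>
  define a where "a n = real (Suc n) * p n" for n
  have summable_a: "summable a"
  proof -
    have "summable (\<lambda>n. real (Suc n) * q ^ n)"
      using geometric_deriv_sums[of q] q by (simp add: sums_iff)
    then have "summable (\<lambda>n. (1 - q) * (real (Suc n) * q ^ n))" by (rule summable_mult)
    moreover have "(\<lambda>n. (1 - q) * (real (Suc n) * q ^ n)) = a"
      by (rule ext) (simp add: a_def p_def mult_ac)
    ultimately show ?thesis by (simp only:)
  qed
  define A where "A = exp (sqrt 2 * suminf a)"
  have a_nonneg: "0 \<le> a n" for n using p_pos[of n] by (simp add: a_def)
  have sum_a: "(\<Sum>n\<le>N. a n) \<le> suminf a" for N
    using summable_a a_nonneg by (intro sum_le_suminf) auto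
  define b where "b n = sqrt 2 / p n" for n
  have exp_int: "integrable M (\<lambda>\<omega>. exp (b n * incr n k \<omega>))" "integrable M (\<lambda>\<omega>. exp (- b n * incr n k \<omega>))" for n k
    by (rule incr_exp)+
  define E where "E n \<omega> = (\<Sum>k<(2::nat) ^ n. (exp (b n * incr n k \<omega>) + exp (- b n * incr n k \<omega>)) * exp (- (sqrt 2 * real (Suc n))))" for n \<omega>
  have E_int: "integrable M (E n)" for n
    unfolding E_def
    by (intro Bochner_Integration.integrable_sum integrable_mult_left Bochner_Integration.integrable_add exp_int)
  have E_le: "expectation (E n) \<le> K0" for n
  proof -
    have "(b n)\<^sup>2 * (1 / 2 ^ n) powr \<alpha> / 2 = 1 / (1 - q)\<^sup>2"
      unfolding sq p_def b_def using q by (simp add: power_divide power_mult_distrib)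
    then have ex: "expectation (\<lambda>\<omega>. exp (b n * incr n k \<omega>)) = K0"
        "expectation (\<lambda>\<omega>. exp (- b n * incr n k \<omega>)) = K0" for k
      unfolding incr_exp by (simp_all add: K0_def)
    have "expectation (E n) = (\<Sum>k<(2::nat) ^ n. (K0 + K0) * exp (- (sqrt 2 * real (Suc n))))"
      unfolding E_def
    proof (subst Bochner_Integration.integral_sum)
      show "integrable M (\<lambda>\<omega>. (exp (b n * incr n k \<omega>) + exp (- b n * incr n k \<omega>)) * exp (- (sqrt 2 * real (Suc n))))" for k
        by (intro integrable_mult_left Bochner_Integration.integrable_add exp_int)
      show "(\<Sum>k<(2::nat) ^ n. expectation (\<lambda>\<omega>. (exp (b n * incr n k \<omega>) + exp (- b n * incr n k \<omega>)) * exp (- (sqrt 2 * real (Suc n)))))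
          = (\<Sum>k<(2::nat) ^ n. (K0 + K0) * exp (- (sqrt 2 * real (Suc n))))"
        by (simp only: integral_mult_left_zero Bochner_Integration.integral_add[OF exp_int] ex)
    qed
    also have "\<dots> = K0 * (2 ^ Suc n * exp (- (sqrt 2 * real (Suc n))))" by simp
    also have "\<dots> \<le> K0 * 1"
    proof (rule mult_left_mono)
      have "(2::real) \<le> exp 1" using exp_ge_add_one_self[of 1] by simp
      also have "\<dots> \<le> exp (sqrt 2)" by simp
      finally have "2 ^ Suc n \<le> exp (sqrt 2) ^ Suc n" by (intro power_mono) auto
      also have "\<dots> = exp (sqrt 2 * real (Suc n))" by (metis exp_of_nat2_mult)
      finally show "2 ^ Suc n * exp (- (sqrt 2 * real (Suc n))) \<le> 1"
        by (simp add: exp_minus field_simps del: of_nat_Suc power_Suc)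
    qed (simp add: K0_def)
    finally show ?thesis by simp
  qed
  have "Phi (dyadics 1 N \<times> {1}) \<le> A * (1 + K0)" for N
  proof -
    have "AE \<omega> in M. mx (dyadics 1 N \<times> {1}) \<omega> \<le> A * (1 + (\<Sum>n\<le>N. p n * E n \<omega>))"
      using B_0
    proof eventually_elim
      case (elim \<omega>)
      define z where "z n = sqrt 2 * (max_incr n \<omega> - a n) / p n" for n
      have z: "exp (z n) \<le> E n \<omega>" for n
      proof -
        obtain k where k: "k < 2 ^ n" "max_incr n \<omega> = \<bar>incr n k \<omega>\<bar>" using max_incr_attained by blast
        have "z n = b n * \<bar>incr n k \<omega>\<bar> - sqrt 2 * real (Suc n)"
          using p_pos[of n] by (simp add: z_def k a_def b_def field_simps)
        then have "exp (z n) = exp (b n * \<bar>incr n k \<omega>\<bar>) * exp (- (sqrt 2 * real (Suc n)))"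
          by (simp add: exp_diff exp_minus divide_inverse)
        also have "\<dots> \<le> (exp (b n * incr n k \<omega>) + exp (- b n * incr n k \<omega>)) * exp (- (sqrt 2 * real (Suc n)))"
          by (intro mult_right_mono) (auto simp: abs_if)
        also have "\<dots> \<le> E n \<omega>"
          unfolding E_def using k(1) by (intro member_le_sum) (auto intro: add_nonneg_nonneg)
        finally show ?thesis .
      qed
      have "sqrt 2 * (\<Sum>n\<le>N. max_incr n \<omega>) = sqrt 2 * (\<Sum>n\<le>N. a n) + (\<Sum>n\<le>N. p n * z n)"
      proof -
        have "p n * z n = sqrt 2 * max_incr n \<omega> - sqrt 2 * a n" for n
          using p_pos[of n] unfolding z_def by (simp add: field_simps)
        then show ?thesis by (simp add: sum_subtractf sum_distrib_left)
      qed
      also have "\<dots> \<le> sqrt 2 * suminf a + (\<Sum>n\<le>N. p n * z n)"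
        using sum_a[of N] by simp
      finally have "exp (sqrt 2 * (\<Sum>n\<le>N. max_incr n \<omega>)) \<le> A * exp (\<Sum>n\<le>N. p n * z n)"
        by (simp add: A_def exp_add[symmetric])
      also have "\<dots> \<le> A * (1 + (\<Sum>n\<le>N. p n * exp (z n)))"
        using p_pos geo by (intro mult_left_mono exp_convex_sum) (auto simp: A_def less_imp_le)
      also have "\<dots> \<le> A * (1 + (\<Sum>n\<le>N. p n * E n \<omega>))"
        using p_pos z by (intro mult_left_mono add_left_mono sum_mono) (auto simp: A_def less_imp_le)
      finally have le: "exp (sqrt 2 * (\<Sum>n\<le>N. max_incr n \<omega>)) \<le> A * (1 + (\<Sum>n\<le>N. p n * E n \<omega>))" .
      have "V (real j / 2 ^ N) \<omega> \<le> exp (sqrt 2 * (\<Sum>n\<le>N. max_incr n \<omega>))" if "j \<le> 2 ^ N" for j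
      proof -
        have "X (real j / 2 ^ N) \<omega> \<le> sqrt 2 * B (real j / 2 ^ N) \<omega>"
          by (simp add: Bstar_def)
        also have "\<dots> \<le> sqrt 2 * (\<Sum>n\<le>N. max_incr n \<omega>)"
          using dyadic_chain[OF that, of \<omega>] elim by simp
        finally show ?thesis by simp
      qed
      then have "V (real j / 2 ^ N) \<omega> \<le> A * (1 + (\<Sum>n\<le>N. p n * E n \<omega>))" if "j \<le> 2 ^ N" for j
        using that le order_trans by blast
      moreover have "marked (dyadics 1 N \<times> {1})" by (simp add: marked_dyadics)
      moreover have "0 \<le> A * (1 + (\<Sum>n\<le>N. p n * E n \<omega>))"
        by (rule order_trans[OF less_imp_le[OF exp_gt_zero] le])
      ultimately show ?case by (simp add: mx_le_iff) (auto simp: dyadics_def)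
    qed
    then have "Phi (dyadics 1 N \<times> {1}) \<le> expectation (\<lambda>\<omega>. A * (1 + (\<Sum>n\<le>N. p n * E n \<omega>)))"
      unfolding Phi_def using E_int by (intro integral_mono_AE) (auto intro!: mx_integrable marked_dyadics)
    also have "\<dots> = A * (1 + (\<Sum>n\<le>N. p n * expectation (E n)))"
      using E_int by (simp add: prob_space Bochner_Integration.integral_sum)
    also have "\<dots> \<le> A * (1 + (\<Sum>n\<le>N. p n * K0))"
      using p_pos E_le by (intro mult_left_mono add_left_mono sum_mono) (auto simp: A_def less_imp_le)
    also have "\<dots> \<le> A * (1 + 1 * K0)"
      unfolding sum_distrib_right[symmetric] using geo by (intro mult_left_mono add_left_mono mult_right_mono) (auto simp: A_def K0_def)
    finally show ?thesis by simp
  qed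
  then show ?thesis by blast
qed

end

section \<open>Almost subadditive functions\<close>

text \<open>Fekete's argument with an error. As the linear error is charged to the appended piece
  \<open>L2\<close>, appending \<open>n\<close> blocks of length \<open>a\<close> costs
  \<open>n * (C + \<epsilon> * a)\<close>, small against \<open>n * a\<close> once \<epsilon> is
  small and \<open>a\<close> is large.\<close>

lemma almost_subadditive_convergent:
  fixes \<phi> :: "real \<Rightarrow> real"
  assumes nonneg: "\<And>L. 0 \<le> L \<Longrightarrow> 0 \<le> \<phi> L" and growth: "\<And>L. 0 \<le> L \<Longrightarrow> \<phi> L \<le> G * (L + 1)"
    and sub: "\<And>\<epsilon>. 0 < \<epsilon> \<Longrightarrow> \<exists>C\<ge>0. \<forall>L1\<ge>0. \<forall>L2\<ge>0. \<phi> (L1 + L2) \<le> \<phi> L1 + \<phi> L2 + C + \<epsilon> * L2"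
  shows "\<exists>l. ((\<lambda>L. \<phi> L / L) \<longlongrightarrow> l) at_top"
proof -
  have G: "0 \<le> G" using nonneg[of 0] growth[of 0] by simp
  \<comment> \<open>Its infimum is the lower limit of \<open>\<phi> L / L\<close>.\<close>
  define S where "S = {x. \<forall>L0. \<exists>L\<ge>L0. \<phi> L / L < x}"
  have "2 * G + 1 \<in> S"
    unfolding S_def
  proof (intro CollectI allI)
    fix L0 :: real
    define L where "L = max 1 L0"
    have L: "1 \<le> L" "L0 \<le> L" by (auto simp: L_def)
    have "\<phi> L \<le> G * (L + 1)" using L by (intro growth) auto
    also have "\<dots> \<le> G * (2 * L)" using L G by (intro mult_left_mono) auto
    finally have "\<phi> L / L \<le> 2 * G" using L by (simp add: divide_le_eq mult_ac)
    then show "\<exists>L\<ge>L0. \<phi> L / L < 2 * G + 1" using L by (intro exI[of _ L]) auto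
  qed
  then have S_ne: "S \<noteq> {}" by blast
  have S_nonneg: "0 \<le> x" if "x \<in> S" for x
  proof -
    from that obtain L where "L \<ge> 1" "\<phi> L / L < x" unfolding S_def by blast
    then show ?thesis using nonneg[of L] divide_nonneg_nonneg[of "\<phi> L" L] by linarith
  qed
  have bdd: "bdd_below S" using S_nonneg by (intro bdd_belowI) auto
  define l where "l = Inf S"
  have l: "0 \<le> l" unfolding l_def using S_ne S_nonneg by (rule cInf_greatest)
  have "((\<lambda>L. \<phi> L / L) \<longlongrightarrow> l) at_top"
  proof (rule tendstoI)
    fix e :: real assume e: "0 < e"
    have "l - e / 2 \<notin> S" using cInf_lower[OF _ bdd, of "l - e / 2"] e by (auto simp: l_def)
    then obtain L0 where L0: "\<And>L. L \<ge> L0 \<Longrightarrow> l - e / 2 \<le> \<phi> L / L" unfolding S_def by (auto simp: not_less)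
    obtain x where x: "x \<in> S" "x < l + e / 4"
      using cInf_lessD[OF S_ne, of "l + e / 4"] e by (auto simp: l_def)
    obtain C where C: "C \<ge> 0" "\<And>L1 L2. L1 \<ge> 0 \<Longrightarrow> L2 \<ge> 0 \<Longrightarrow> \<phi> (L1 + L2) \<le> \<phi> L1 + \<phi> L2 + C + e / 4 * L2"
      using sub[of "e / 4"] e by auto
    \<comment> \<open>So long that \<open>C\<close> costs at most \<open>e / 4\<close> per unit
      length; quotient, constant and linear error then add up to at most
      \<open>l + 3 * e / 4\<close>.\<close>
    obtain a where a: "a \<ge> max 1 (4 * C / e)" "\<phi> a / a < x" using x(1) unfolding S_def by blast
    have a1: "1 \<le> a" and aC: "C \<le> e / 4 * a" using a(1) e by (auto simp: field_simps)
    have "\<phi> a \<le> (l + e / 4) * a" using a(2) x(2) a1 by (simp add: divide_less_eq) (smt (verit) mult_right_mono)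
    then have step: "\<phi> a + C + e / 4 * a \<le> (l + 3 * e / 4) * a" using aC by (simp add: algebra_simps)
    define q where "q = (l + 3 * e / 4) * a"
    have iter: "\<phi> (r + real n * a) \<le> \<phi> r + real n * q" if "0 \<le> r" for r n
    proof (induction n)
      case (Suc n)
      have "\<phi> (r + real n * a + a) \<le> \<phi> (r + real n * a) + \<phi> a + C + e / 4 * a"
        using that a1 by (intro C(2)) auto
      also have "\<dots> \<le> \<phi> r + real n * q + q"
        using Suc step[folded q_def] by linarith
      finally show ?case by (simp add: algebra_simps)
    qed simp
    have upper: "\<phi> L / L < l + e" if L: "L \<ge> max a (4 * G * (a + 1) / e + 1)" for L
    proof -
      define n where "n = nat \<lfloor>L / a\<rfloor>"
      define r where "r = L - real n * a"
      have L_pos: "0 < L" using L a1 by auto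
      have rn: "real n = of_int \<lfloor>L / a\<rfloor>" using L_pos a1 by (simp add: n_def)
      have "real n \<le> L / a" "L / a < real n + 1" unfolding rn by linarith+
      then have na: "real n * a \<le> L" "L < real n * a + a" using a1 by (simp_all add: field_simps)
      then have r: "0 \<le> r" "r \<le> a" by (auto simp: r_def)
      have "\<phi> L \<le> \<phi> r + real n * ((l + 3 * e / 4) * a)"
        using iter[OF r(1), of n] by (simp add: r_def q_def)
      also have "\<phi> r \<le> G * (a + 1)"
        using growth[OF r(1)] r mult_left_mono[of "r + 1" "a + 1" G] G by linarith
      also have "real n * ((l + 3 * e / 4) * a) = (l + 3 * e / 4) * (real n * a)" by simp
      also have "\<dots> \<le> (l + 3 * e / 4) * L" using l e na by (intro mult_left_mono) auto
      finally have "\<phi> L \<le> G * (a + 1) + (l + 3 * e / 4) * L" by simp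
      moreover have "4 * G * (a + 1) / e < L" using L by auto
      then have "G * (a + 1) < e / 4 * L" using e by (simp add: field_simps)
      ultimately have "\<phi> L < (l + e) * L" by (simp add: algebra_simps)
      then show ?thesis using L_pos by (simp add: divide_less_eq)
    qed
    have "\<forall>\<^sub>F L in at_top. L \<ge> max L0 (max a (4 * G * (a + 1) / e + 1))" by (rule eventually_ge_at_top)
    then show "\<forall>\<^sub>F L in at_top. dist (\<phi> L / L) l < e"
    proof eventually_elim
      case (elim L)
      then show ?case using L0[of L] upper[of L] e by (simp add: dist_real_def abs_less_iff)
    qed
  qed
  then show ?thesis by blast
qed

text \<open>Pigeonhole on the fractional parts of \<open>k * D1 / D2\<close>: subtracting from \<open>k + K\<close> the least
  index visiting the same bin moves it back by at most \<open>K\<close> and lands close to a multiple of \<open>D2\<close>.\<close>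

lemma near_return:
  assumes D: "0 < (D1::real)" "0 < D2" and \<delta>: "0 < \<delta>"
  shows "\<exists>K. \<forall>k::nat. \<exists>k' j::nat. k \<le> k' \<and> k' \<le> k + K \<and> \<bar>real k' * D1 - real j * D2\<bar> < \<delta>"
proof -
  obtain N :: nat where N: "D2 / \<delta> < real N" using reals_Archimedean2 by blast
  have N0: "0 < N" using N D \<delta> by (metis divide_pos_pos less_trans of_nat_0_less_iff)
  define bin where "bin k = nat \<lfloor>frac (real k * D1 / D2) * real N\<rfloor>" for k :: nat
  have bin_less: "bin k < N" for k
  proof -
    have "frac (real k * D1 / D2) * real N < 1 * real N"
      using N0 frac_lt_1 by (intro mult_strict_right_mono) auto
    then have "\<lfloor>frac (real k * D1 / D2) * real N\<rfloor> < int N" by (simp add: floor_less_iff)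
    then show ?thesis using N0 by (simp add: bin_def nat_less_iff)
  qed
  define rep where "rep b = (LEAST k. bin k = b)" for b
  define K where "K = Max (rep ` {..<N})"
  have rep_le: "rep (bin k) \<le> K" for k
    unfolding K_def using bin_less by (intro Max_ge) auto
  have rep: "bin (rep (bin k)) = bin k" "rep (bin k) \<le> k" for k
    unfolding rep_def by (rule LeastI[of _ k], simp) (rule Least_le, simp)
  show ?thesis
  proof (rule exI[of _ K], rule allI)
    fix k :: nat
    define n where "n = k + K"
    define m where "m = rep (bin n)"
    have m: "m \<le> n" "m \<le> K" "bin m = bin n" using rep[of n] rep_le[of n] by (auto simp: m_def)
    define x y where "x = frac (real n * D1 / D2)" and "y = frac (real m * D1 / D2)"
    have xy: "0 \<le> x" "0 \<le> y" by (auto simp: x_def y_def)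
    have "nat \<lfloor>x * real N\<rfloor> = nat \<lfloor>y * real N\<rfloor>" using m(3) by (simp add: bin_def x_def y_def)
    then have "\<lfloor>x * real N\<rfloor> = \<lfloor>y * real N\<rfloor>" using xy by (subst (asm) eq_nat_nat_iff) auto
    then have "\<bar>x * real N - y * real N\<bar> < 1" by linarith
    then have "\<bar>x - y\<bar> * real N < 1" by (simp add: abs_mult left_diff_distrib[symmetric])
    then have "\<bar>x - y\<bar> < 1 / real N" using N0 by (simp add: field_simps)
    also have "\<dots> < \<delta> / D2" using N N0 D \<delta> by (simp add: field_simps)
    finally have diff: "\<bar>x - y\<bar> * D2 < \<delta>" using D by (simp add: field_simps)
    define j where "j = nat (\<lfloor>real n * D1 / D2\<rfloor> - \<lfloor>real m * D1 / D2\<rfloor>)"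
    have "real m * D1 / D2 \<le> real n * D1 / D2" using m D by (intro divide_right_mono mult_right_mono) auto
    then have j: "real j = of_int \<lfloor>real n * D1 / D2\<rfloor> - of_int \<lfloor>real m * D1 / D2\<rfloor>"
      unfolding j_def using floor_mono by (subst of_nat_nat) auto
    have "real (n - m) * D1 - real j * D2 = (real n * D1 / D2 - real m * D1 / D2 - real j) * D2"
      using D m by (simp add: of_nat_diff field_simps)
    also have "real n * D1 / D2 - real m * D1 / D2 - real j = x - y"
      unfolding j x_def y_def frac_def by simp
    finally have "\<bar>real (n - m) * D1 - real j * D2\<bar> < \<delta>" using diff D by (simp add: abs_mult)
    moreover have "k \<le> n - m" "n - m \<le> k + K" using m by (auto simp: n_def)
    ultimately show "\<exists>k' j. k \<le> k' \<and> k' \<le> k + K \<and> \<bar>real k' * D1 - real j * D2\<bar> < \<delta>" by blast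
  qed
qed

section \<open>Suprema over intervals and grids\<close>

lemma finite_grid: assumes "0 < D" shows "finite (grid D L)"
proof (rule finite_subset)
  show "grid D L \<subseteq> (\<lambda>k. real k * D) ` {..nat \<lceil>L / D\<rceil>}"
  proof
    fix t assume "t \<in> grid D L"
    then obtain k where k: "t = real k * D" "real k * D \<le> L" unfolding grid_def by auto
    then have "real k \<le> L / D" using assms by (simp add: field_simps)
    then have "k \<le> nat \<lceil>L / D\<rceil>" by linarith
    then show "t \<in> (\<lambda>k. real k * D) ` {..nat \<lceil>L / D\<rceil>}" using k by auto
  qed
qed simp

lemma gridI: "0 \<le> D \<Longrightarrow> real k * D \<le> L \<Longrightarrow> real k * D \<in> grid D L"
  unfolding grid_def by auto

lemma gridE:
  assumes "t \<in> grid D L"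
  obtains k :: nat where "t = real k * D" "0 \<le> t" "t \<le> L"
  using assms unfolding grid_def by auto

lemma grid_nonempty: "0 \<le> D \<Longrightarrow> 0 \<le> L \<Longrightarrow> grid D L \<noteq> {}"
  using gridI[of D 0 L] by auto

context fbm
begin

lemma path_continuous: assumes "\<omega> \<in> space M" shows "continuous_on {0..} (\<lambda>t. X t \<omega>)"
proof -
  have "continuous_on {0..} (\<lambda>t. B t \<omega>)"
    using fbm assms unfolding fractional_brownian_motion_def by blast
  then show ?thesis
    unfolding Bstar_def using \<alpha> by (intro continuous_intros continuous_on_powr') auto
qed

lemma max_cont_attained:
  assumes "0 \<le> L" "\<omega> \<in> space M"
  obtains t where "0 \<le> t" "t \<le> L" "max_cont B \<alpha> L \<omega> = X t \<omega>" "\<And>s. 0 \<le> s \<Longrightarrow> s \<le> L \<Longrightarrow> X s \<omega> \<le> X t \<omega>"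
proof -
  have "continuous_on {0..L} (\<lambda>t. X t \<omega>)"
    using path_continuous[OF assms(2)] by (rule continuous_on_subset) auto
  then obtain t where t: "t \<in> {0..L}" "\<And>s. s \<in> {0..L} \<Longrightarrow> X s \<omega> \<le> X t \<omega>"
    using continuous_attains_sup[of "{0..L}" "\<lambda>t. X t \<omega>"] assms by auto
  then have "max_cont B \<alpha> L \<omega> = X t \<omega>"
    unfolding max_cont_def by (intro cSup_eq_maximum) auto
  with t show ?thesis by (intro that[of t]) auto
qed

lemma max_grid_attained:
  assumes "0 < D" "0 \<le> L"
  obtains t where "t \<in> grid D L" "max_grid B \<alpha> D L \<omega> = X t \<omega>" "\<And>s. s \<in> grid D L \<Longrightarrow> X s \<omega> \<le> X t \<omega>"
proof -
  have fin: "finite ((\<lambda>t. X t \<omega>) ` grid D L)" and ne: "(\<lambda>t. X t \<omega>) ` grid D L \<noteq> {}"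
    using finite_grid[of D L] grid_nonempty[of D L] assms by auto
  from Max_in[OF fin ne] obtain t where t: "t \<in> grid D L" "Max ((\<lambda>t. X t \<omega>) ` grid D L) = X t \<omega>" by auto
  have le: "X s \<omega> \<le> X t \<omega>" if "s \<in> grid D L" for s
    using Max_ge[OF fin, of "X s \<omega>"] that t by auto
  have "max_grid B \<alpha> D L \<omega> = X t \<omega>"
    unfolding max_grid_def using t le by (intro cSup_eq_maximum) auto
  with t le show ?thesis by (intro that[of t]) auto
qed

lemma marked_grid: "0 < D \<Longrightarrow> 0 \<le> c \<Longrightarrow> marked (grid D L \<times> {c})"
  using finite_grid[of D L] by (auto simp: marked_def grid_def)

lemma mx_grid:
  assumes "0 < D" "0 \<le> L" "0 \<le> c"
  shows "mx (grid D L \<times> {c}) \<omega> = c * exp (max_grid B \<alpha> D L \<omega>)"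
proof -
  obtain t where t: "t \<in> grid D L" "max_grid B \<alpha> D L \<omega> = X t \<omega>" "\<And>s. s \<in> grid D L \<Longrightarrow> X s \<omega> \<le> X t \<omega>"
    using max_grid_attained[OF assms(1,2), of \<omega>] by blast
  have m: "marked (grid D L \<times> {c})" using assms by (intro marked_grid)
  show ?thesis
  proof (rule antisym)
    show "mx (grid D L \<times> {c}) \<omega> \<le> c * exp (max_grid B \<alpha> D L \<omega>)"
      using t assms by (auto simp: mx_le_iff[OF m] intro!: mult_left_mono)
    show "c * exp (max_grid B \<alpha> D L \<omega>) \<le> mx (grid D L \<times> {c}) \<omega>"
      using mx_ge[OF m, of "(t, c)" \<omega>] t by simp
  qed
qed

lemma mx_const:
  assumes "marked (S \<times> {1})" "0 \<le> c"
  shows "mx (S \<times> {c}) \<omega> = c * mx (S \<times> {1}) \<omega>"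
proof (cases "S = {} \<or> c = 0")
  case True
  have "marked (S \<times> {c})" using assms by (auto simp: marked_def finite_cartesian_product_iff)
  then have "mx (S \<times> {c}) \<omega> \<le> s \<longleftrightarrow> 0 \<le> s" for s using True by (auto simp: mx_le_iff)
  then have z: "mx (S \<times> {c}) \<omega> = 0" by (meson antisym order_refl)
  have "mx ({} :: (real \<times> real) set) \<omega> \<le> s \<longleftrightarrow> 0 \<le> s" for s
    by (subst mx_le_iff) (auto simp: marked_def)
  then have "mx ({} :: (real \<times> real) set) \<omega> = 0" by (meson antisym order_refl)
  then show ?thesis using True z by auto
next
  case False
  then have c: "0 < c" using assms by auto
  have m: "marked (S \<times> {c})" using assms by (auto simp: marked_def finite_cartesian_product_iff)
  have "mx (S \<times> {c}) \<omega> \<le> s \<longleftrightarrow> mx (S \<times> {1}) \<omega> \<le> s / c" for s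
    using c by (auto simp: mx_le_iff[OF m] mx_le_iff[OF assms(1)] field_simps zero_le_divide_iff zero_le_mult_iff)
  then have "mx (S \<times> {c}) \<omega> \<le> s \<longleftrightarrow> c * mx (S \<times> {1}) \<omega> \<le> s" for s
    using c by (simp add: field_simps)
  then show ?thesis by (meson antisym order_refl)
qed

lemma dyadics_mono: "dyadics L m \<subseteq> dyadics L (Suc m)"
proof
  fix t assume "t \<in> dyadics L m"
  then obtain k where "k \<le> 2 ^ m" "t = L * (real k / 2 ^ m)" unfolding dyadics_def by auto
  then show "t \<in> dyadics L (Suc m)" unfolding dyadics_def
    by (intro image_eqI[of _ _ "2 * k"]) auto
qed

lemma dyadics_subset: assumes "0 \<le> L" shows "dyadics L m \<subseteq> {0..L}"
proof
  fix t assume "t \<in> dyadics L m"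
  then obtain k where k: "k \<le> 2 ^ m" "t = L * (real k / 2 ^ m)" unfolding dyadics_def by auto
  have "real k \<le> 2 ^ m" using k(1) by (metis of_nat_le_iff of_nat_numeral of_nat_power)
  then have "L * (real k / 2 ^ m) \<le> L * 1" using assms by (intro mult_left_mono) auto
  then show "t \<in> {0..L}" using assms k by auto
qed

text \<open>The maximum over the interval is attained at some \<open>t\<close>; dyadic points below
  \<open>t\<close> approach it, and paths are continuous.\<close>

lemma mx_dyadics_tendsto:
  assumes L: "0 \<le> L" and \<omega>: "\<omega> \<in> space M"
  shows "(\<lambda>m. mx (dyadics L m \<times> {1}) \<omega>) \<longlonglongrightarrow> exp (max_cont B \<alpha> L \<omega>)"
proof -
  obtain t where t: "0 \<le> t" "t \<le> L" "max_cont B \<alpha> L \<omega> = X t \<omega>" "\<And>s. 0 \<le> s \<Longrightarrow> s \<le> L \<Longrightarrow> X s \<omega> \<le> X t \<omega>"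
    using max_cont_attained[OF L \<omega>] by blast
  have m: "marked (dyadics L m \<times> {1})" for m using L by (simp add: marked_dyadics)
  \<comment> \<open>For \<open>L = 0\<close> the quotient \<open>t / L\<close> is 0, which is right
    because then \<open>t = 0\<close>.\<close>
  define k where "k m = nat \<lfloor>t / L * 2 ^ m\<rfloor>" for m
  define s where "s m = L * (real (k m) / 2 ^ m)" for m
  have tL: "0 \<le> t / L" "t / L \<le> 1" using t L by (auto simp: divide_le_eq_1)
  have k_le: "k m \<le> 2 ^ m" for m
  proof -
    have "t / L * 2 ^ m \<le> 1 * 2 ^ m" using tL by (intro mult_right_mono) auto
    then have "\<lfloor>t / L * 2 ^ m\<rfloor> \<le> \<lfloor>2 ^ m :: real\<rfloor>" by (intro floor_mono) simp
    also have "\<lfloor>2 ^ m :: real\<rfloor> = 2 ^ m" by (metis floor_of_int of_int_numeral of_int_power)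
    finally have "\<lfloor>t / L * 2 ^ m\<rfloor> \<le> 2 ^ m" .
    then show ?thesis unfolding k_def by (simp add: nat_le_iff)
  qed
  have s_in: "s m \<in> dyadics L m" for m
    unfolding dyadics_def s_def using k_le by auto
  have s_le: "L * (t / L - 1 / 2 ^ m) \<le> s m" "s m \<le> t" for m
  proof -
    have "0 \<le> t / L * 2 ^ m" using tL by (intro mult_nonneg_nonneg) auto
    then have rk: "real (k m) = of_int \<lfloor>t / L * 2 ^ m\<rfloor>" unfolding k_def by (subst of_nat_nat) auto
    have "t / L * 2 ^ m - 1 \<le> real (k m)" "real (k m) \<le> t / L * 2 ^ m" unfolding rk by linarith+
    then have "(t / L * 2 ^ m - 1) / 2 ^ m \<le> real (k m) / 2 ^ m" "real (k m) / 2 ^ m \<le> (t / L * 2 ^ m) / 2 ^ m"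
      by (intro divide_right_mono; simp)+
    then have *: "t / L - 1 / 2 ^ m \<le> real (k m) / 2 ^ m" "real (k m) / 2 ^ m \<le> t / L"
      by (simp_all only: diff_divide_distrib nonzero_mult_div_cancel_right power_not_zero) simp_all
    then show "L * (t / L - 1 / 2 ^ m) \<le> s m" unfolding s_def using L by (intro mult_left_mono)
    have "s m \<le> L * (t / L)" unfolding s_def using L * by (intro mult_left_mono)
    then show "s m \<le> t" using t L by (cases "L = 0") auto
  qed
  have "s \<longlonglongrightarrow> t"
  proof (rule tendsto_sandwich[OF _ _ _ tendsto_const])
    have "(\<lambda>m. L * (t / L - 1 / 2 ^ m)) \<longlonglongrightarrow> L * (t / L - 0)"
      by (intro tendsto_intros LIMSEQ_divide_realpow_zero) auto
    moreover have "L * (t / L - 0) = t" using t by (cases "L = 0") auto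
    ultimately show "(\<lambda>m. L * (t / L - 1 / 2 ^ m)) \<longlonglongrightarrow> t" by simp
  qed (use s_le in auto)
  then have "(\<lambda>m. X (s m) \<omega>) \<longlonglongrightarrow> X t \<omega>"
    using t L subsetD[OF dyadics_subset[OF L] s_in]
    by (intro continuous_on_tendsto_compose[OF path_continuous[OF \<omega>]]) (auto intro!: always_eventually)
  then have lim: "(\<lambda>m. V (s m) \<omega>) \<longlonglongrightarrow> V t \<omega>" by (intro tendsto_intros)
  show ?thesis unfolding t(3)
  proof (rule tendsto_sandwich[OF _ _ lim tendsto_const])
    show "\<forall>\<^sub>F m in sequentially. V (s m) \<omega> \<le> mx (dyadics L m \<times> {1}) \<omega>"
      using mx_ge[OF m, of "(s _, 1)"] s_in by (intro always_eventually) simp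
    show "\<forall>\<^sub>F m in sequentially. mx (dyadics L m \<times> {1}) \<omega> \<le> V t \<omega>"
      using t(4) subsetD[OF dyadics_subset[OF L]]
      by (intro always_eventually) (auto simp: mx_le_iff[OF m] simp del: atLeastAtMost_iff dest!: atLeastAtMost_iff[THEN iffD1])
  qed
qed

text \<open>An uncountable supremum, measurable as a limit of finite maxima.\<close>

lemma exp_max_cont_measurable:
  assumes "0 \<le> L" shows "(\<lambda>\<omega>. exp (max_cont B \<alpha> L \<omega>)) \<in> borel_measurable M"
  by (rule borel_measurable_LIMSEQ_real[OF mx_dyadics_tendsto[OF assms]])
     (auto intro!: mx_measurable marked_dyadics assms)

lemma sup_integrable_if_Phi_bounded:
  assumes L: "0 \<le> L" and K: "\<And>m. Phi (dyadics L m \<times> {1}) \<le> K"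
  shows "integrable M (\<lambda>\<omega>. exp (max_cont B \<alpha> L \<omega>))"
proof -
  have m: "marked (dyadics L m \<times> {1})" for m using L by (simp add: marked_dyadics)
  have sub: "dyadics L m \<times> {1::real} \<subseteq> dyadics L (Suc m) \<times> {1}" for m using dyadics_mono by auto
  have "incseq (\<lambda>m. Phi (dyadics L m \<times> {1}))"
    by (intro incseq_SucI Phi_mono m sub)
  then obtain l where l: "(\<lambda>m. Phi (dyadics L m \<times> {1})) \<longlonglongrightarrow> l"
    using incseq_convergent[of "\<lambda>m. Phi (dyadics L m \<times> {1})" K] K by blast
  show ?thesis
  proof (rule integrable_monotone_convergence)
    show "AE \<omega> in M. mono (\<lambda>m. mx (dyadics L m \<times> {1}) \<omega>)"
      by (intro AE_I2 incseq_SucI mx_mono m sub)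
    show "AE \<omega> in M. (\<lambda>m. mx (dyadics L m \<times> {1}) \<omega>) \<longlonglongrightarrow> exp (max_cont B \<alpha> L \<omega>)"
      using mx_dyadics_tendsto[OF L] by (intro AE_I2)
    show "(\<lambda>m. \<integral>\<omega>. mx (dyadics L m \<times> {1}) \<omega> \<partial>M) \<longlonglongrightarrow> l" using l by (simp add: Phi_def)
  qed (auto intro!: mx_integrable m exp_max_cont_measurable L)
qed

text \<open>The price of a unit block: by shift invariance it bounds \<open>Phi\<close> on every
  unit interval with weights at most 1.\<close>

definition K1 :: real where
  "K1 = expectation (\<lambda>\<omega>. exp (max_cont B \<alpha> 1 \<omega>))"

lemma K1_integrable: "integrable M (\<lambda>\<omega>. exp (max_cont B \<alpha> 1 \<omega>))"
proof -
  obtain K where "\<And>N. Phi (dyadics 1 N \<times> {1}) \<le> K" using Phi_dyadics_bounded by blast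
  then show ?thesis by (intro sup_integrable_if_Phi_bounded) auto
qed

lemma K1_nonneg: "0 \<le> K1"
  unfolding K1_def by simp

lemma Phi_shift_back:
  assumes P: "marked P" and a: "0 \<le> a" "\<And>p. p \<in> P \<Longrightarrow> a \<le> fst p"
  shows "Phi P = Phi ((\<lambda>(t, c). (t - a, c)) ` P)" "marked ((\<lambda>(t, c). (t - a, c)) ` P)"
proof -
  show m: "marked ((\<lambda>(t, c). (t - a, c)) ` P)" using P a(2) by (force simp: marked_def)
  have "(\<lambda>(t, c). (t + a, c)) ` (\<lambda>(t, c). (t - a, c)) ` P = P"
    by (simp add: image_image case_prod_beta)
  then show "Phi P = Phi ((\<lambda>(t, c). (t - a, c)) ` P)"
    using Phi_shift[OF m a(1)] by simp
qed

lemma Phi_unit: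
  assumes P: "marked P" and a: "0 \<le> a" "\<And>p. p \<in> P \<Longrightarrow> a \<le> fst p \<and> fst p \<le> a + 1 \<and> snd p \<le> c" and c: "0 \<le> c"
  shows "Phi P \<le> c * K1"
proof -
  let ?Q = "(\<lambda>(t, c). (t - a, c)) ` P"
  have m: "marked ?Q" and eq: "Phi P = Phi ?Q" using Phi_shift_back[OF P a(1)] a(2) by auto
  have "expectation (mx ?Q) \<le> expectation (\<lambda>\<omega>. c * exp (max_cont B \<alpha> 1 \<omega>))"
  proof (rule integral_mono[OF mx_integrable[OF m]])
    show "integrable M (\<lambda>\<omega>. c * exp (max_cont B \<alpha> 1 \<omega>))" using K1_integrable by simp
    fix \<omega> assume \<omega>: "\<omega> \<in> space M"
    obtain t where t: "max_cont B \<alpha> 1 \<omega> = X t \<omega>" "\<And>s. 0 \<le> s \<Longrightarrow> s \<le> 1 \<Longrightarrow> X s \<omega> \<le> X t \<omega>"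
      using max_cont_attained[of 1 \<omega>] \<omega> by (metis zero_le_one)
    have "snd q * V (fst q) \<omega> \<le> c * V t \<omega>" if "q \<in> ?Q" for q
    proof -
      from that obtain p where p: "p \<in> P" "q = (fst p - a, snd p)" by force
      have "V (fst p - a) \<omega> \<le> V t \<omega>" using a(2)[OF p(1)] by (auto intro!: t(2))
      then show ?thesis using a(2)[OF p(1)] c p by (auto intro!: mult_mono)
    qed
    then show "mx ?Q \<omega> \<le> c * exp (max_cont B \<alpha> 1 \<omega>)"
      unfolding mx_le_iff[OF m] t using c by auto
  qed
  then show ?thesis by (simp add: eq Phi_def[symmetric] K1_def)
qed

lemma Phi_interval:
  assumes P: "marked P" and a: "0 \<le> a" "\<And>p. p \<in> P \<Longrightarrow> a \<le> fst p \<and> fst p \<le> a + real (Suc n) \<and> snd p \<le> c" and c: "0 \<le> c"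
  shows "Phi P \<le> real (Suc n) * (c * K1)"
  using P a(2)
proof (induction n arbitrary: P)
  case 0
  then show ?case using Phi_unit[of P a c] a(1) c by simp
next
  case (Suc n)
  let ?P1 = "{p\<in>P. fst p \<le> a + real (Suc n)}" and ?P2 = "{p\<in>P. a + real (Suc n) < fst p}"
  have m: "marked ?P1" "marked ?P2" using Suc.prems(1) by (auto intro: marked_subset)
  have "Phi ?P1 \<le> real (Suc n) * (c * K1)" using Suc.prems(2) m by (intro Suc.IH) auto
  moreover have "Phi ?P2 \<le> c * K1"
    using Suc.prems(2) m a(1) c by (intro Phi_unit[where a = "a + real (Suc n)"]) (auto simp: algebra_simps)
  moreover have "Phi P \<le> Phi ?P1 + Phi ?P2"
  proof -
    have "P = ?P1 \<union> ?P2" by auto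
    then show ?thesis using Phi_Un[OF m] by simp
  qed
  ultimately show ?case by (simp add: algebra_simps)
qed

lemma sup_integrable:
  assumes L: "0 \<le> L" shows "integrable M (\<lambda>\<omega>. exp (max_cont B \<alpha> L \<omega>))"
proof (rule sup_integrable_if_Phi_bounded[OF L])
  fix m
  have n: "L \<le> real (Suc (nat \<lceil>L\<rceil>))" by linarith
  show "Phi (dyadics L m \<times> {1}) \<le> real (Suc (nat \<lceil>L\<rceil>)) * (1 * K1)"
  proof (rule Phi_interval[where a = 0])
    fix p assume "p \<in> dyadics L m \<times> {1::real}"
    then have "fst p \<in> {0..L}" "snd p = 1" using subsetD[OF dyadics_subset[OF L, of m], of "fst p"] by auto
    then show "0 \<le> fst p \<and> fst p \<le> 0 + real (Suc (nat \<lceil>L\<rceil>)) \<and> snd p \<le> 1" using n by auto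
  qed (use L in \<open>auto intro!: marked_dyadics\<close>)
qed

end

context fbm
begin

section \<open>Joint weighted suprema over the interval and the two grids\<close>

definition marks :: "real \<Rightarrow> real \<Rightarrow> real \<Rightarrow> real \<Rightarrow> real \<Rightarrow> real \<Rightarrow> (real \<times> real) set" where
  "marks D1 D2 c1 c2 c3 L = {0..L} \<times> {c1} \<union> grid D1 L \<times> {c2} \<union> grid D2 L \<times> {c3}"

definition sup3 :: "real \<Rightarrow> real \<Rightarrow> real \<Rightarrow> real \<Rightarrow> real \<Rightarrow> real \<Rightarrow> 'a \<Rightarrow> real" where
  "sup3 D1 D2 c1 c2 c3 L \<omega> =
     max (c1 * exp (max_cont B \<alpha> L \<omega>)) (max (c2 * exp (max_grid B \<alpha> D1 L \<omega>)) (c3 * exp (max_grid B \<alpha> D2 L \<omega>)))"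

lemma exp_max_grid_measurable:
  assumes "0 < D" "0 \<le> L" shows "(\<lambda>\<omega>. exp (max_grid B \<alpha> D L \<omega>)) \<in> borel_measurable M"
  using mx_measurable[OF marked_grid[OF assms(1), of 1 L]] mx_grid[OF assms, of 1] by (simp cong: measurable_cong)

lemma exp_max_grid_integrable:
  assumes "0 < D" "0 \<le> L" shows "integrable M (\<lambda>\<omega>. exp (max_grid B \<alpha> D L \<omega>))"
proof -
  have "integrable M (mx (grid D L \<times> {1}))" using assms by (intro mx_integrable marked_grid) auto
  moreover have "mx (grid D L \<times> {1}) = (\<lambda>\<omega>. exp (max_grid B \<alpha> D L \<omega>))"
    using mx_grid[OF assms, of 1] by auto
  ultimately show ?thesis by simp
qed

lemma marks_restrict: "p \<in> marks D1 D2 c1 c2 c3 L \<Longrightarrow> fst p \<le> L' \<Longrightarrow> p \<in> marks D1 D2 c1 c2 c3 L'"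
  unfolding marks_def by (auto simp: grid_def)

lemma marks_marked: "finite P \<Longrightarrow> P \<subseteq> marks D1 D2 c1 c2 c3 L \<Longrightarrow> 0 \<le> c1 \<Longrightarrow> 0 \<le> c2 \<Longrightarrow> 0 \<le> c3 \<Longrightarrow> marked P"
  unfolding marked_def marks_def grid_def by auto

lemma sup3_ge:
  assumes D: "0 < D1" "0 < D2" and L: "0 \<le> L" and c: "0 \<le> c1" "0 \<le> c2" "0 \<le> c3"
    and \<omega>: "\<omega> \<in> space M" and p: "p \<in> marks D1 D2 c1 c2 c3 L"
  shows "snd p * V (fst p) \<omega> \<le> sup3 D1 D2 c1 c2 c3 L \<omega>"
proof -
  from p consider "fst p \<in> {0..L}" "snd p = c1" | "fst p \<in> grid D1 L" "snd p = c2" | "fst p \<in> grid D2 L" "snd p = c3"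
    unfolding marks_def by auto
  then show ?thesis
  proof cases
    case 1
    obtain t where t: "max_cont B \<alpha> L \<omega> = X t \<omega>" "\<And>s. 0 \<le> s \<Longrightarrow> s \<le> L \<Longrightarrow> X s \<omega> \<le> X t \<omega>"
      using max_cont_attained[OF L \<omega>] by metis
    then have "snd p * V (fst p) \<omega> \<le> c1 * exp (max_cont B \<alpha> L \<omega>)"
      using 1 c by (auto intro!: mult_left_mono)
    then show ?thesis unfolding sup3_def by (rule max.coboundedI1)
  next
    case 2
    have "snd p * V (fst p) \<omega> \<le> c2 * exp (max_grid B \<alpha> D1 L \<omega>)"
      using mx_ge[OF marked_grid[OF D(1) c(2), of L], of p \<omega>] 2 mx_grid[OF D(1) L c(2), of \<omega>] by (cases p) auto
    then show ?thesis unfolding sup3_def by (intro max.coboundedI2 max.coboundedI1)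
  next
    case 3
    have "snd p * V (fst p) \<omega> \<le> c3 * exp (max_grid B \<alpha> D2 L \<omega>)"
      using mx_ge[OF marked_grid[OF D(2) c(3), of L], of p \<omega>] 3 mx_grid[OF D(2) L c(3), of \<omega>] by (cases p) auto
    then show ?thesis unfolding sup3_def by (intro max.coboundedI2)
  qed
qed

lemma sup3_nonneg: "0 \<le> c1 \<Longrightarrow> 0 \<le> sup3 D1 D2 c1 c2 c3 L \<omega>"
  unfolding sup3_def by (rule max.coboundedI1) simp

lemma sup3_integrable:
  assumes D: "0 < D1" "0 < D2" and L: "0 \<le> L"
  shows "integrable M (sup3 D1 D2 c1 c2 c3 L)"
  unfolding sup3_def[abs_def]
  using D L by (intro integrable_max integrable_mult_right sup_integrable exp_max_grid_integrable)

lemma Phi_le_sup3: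
  assumes D: "0 < D1" "0 < D2" and L: "0 \<le> L" and c: "0 \<le> c1" "0 \<le> c2" "0 \<le> c3"
    and P: "finite P" "P \<subseteq> marks D1 D2 c1 c2 c3 L"
  shows "Phi P \<le> expectation (sup3 D1 D2 c1 c2 c3 L)"
proof -
  have m: "marked P" using P c by (rule marks_marked)
  show ?thesis
    unfolding Phi_def
  proof (rule integral_mono[OF mx_integrable[OF m] sup3_integrable[OF D L]])
    fix \<omega> assume "\<omega> \<in> space M"
    then show "mx P \<omega> \<le> sup3 D1 D2 c1 c2 c3 L \<omega>"
      unfolding mx_le_iff[OF m] using P c sup3_ge[OF D L c] by (auto intro: sup3_nonneg)
  qed
qed

text \<open>Together with \<open>Phi_le_sup3\<close>, this makes the expected supremum the least
  upper bound of \<open>Phi\<close> over finite sets of marks, so that splitting and shifting can be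
  done on finite sets. Dyadic points joined with the full grids exhaust the supremum.\<close>

lemma sup3_le:
  assumes D: "0 < D1" "0 < D2" and L: "0 \<le> L" and c: "0 \<le> c1" "0 \<le> c2" "0 \<le> c3"
    and K: "\<And>P. finite P \<Longrightarrow> P \<subseteq> marks D1 D2 c1 c2 c3 L \<Longrightarrow> Phi P \<le> K"
  shows "expectation (sup3 D1 D2 c1 c2 c3 L) \<le> K"
proof -
  define P where "P m = dyadics L m \<times> {c1} \<union> (grid D1 L \<times> {c2} \<union> grid D2 L \<times> {c3})" for m
  have md: "marked (dyadics L m \<times> {c})" if "0 \<le> c" for m c using L that by (rule marked_dyadics)
  have mg: "marked (grid D1 L \<times> {c2})" "marked (grid D2 L \<times> {c3})" using D c by (auto intro: marked_grid)
  have mP: "marked (P m)" for m unfolding P_def using md[OF c(1)] mg by (intro marked_Un)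
  have sub: "P m \<subseteq> marks D1 D2 c1 c2 c3 L" for m
    using dyadics_subset[OF L, of m] unfolding P_def marks_def by auto
  have mxP: "mx (P m) \<omega> = max (c1 * mx (dyadics L m \<times> {1}) \<omega>)
      (max (c2 * exp (max_grid B \<alpha> D1 L \<omega>)) (c3 * exp (max_grid B \<alpha> D2 L \<omega>)))" for m \<omega>
    unfolding P_def
    using md[OF c(1)] mg D L c mx_const[OF md[OF zero_le_one] c(1), of m \<omega>] by (simp add: mx_Un marked_Un mx_grid)
  have "(\<lambda>m. expectation (mx (P m))) \<longlonglongrightarrow> expectation (sup3 D1 D2 c1 c2 c3 L)"
  proof (rule integral_dominated_convergence)
    show "integrable M (sup3 D1 D2 c1 c2 c3 L)" by (rule sup3_integrable[OF D L])
    then show "sup3 D1 D2 c1 c2 c3 L \<in> borel_measurable M" by auto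
    show "mx (P m) \<in> borel_measurable M" for m by (rule mx_measurable[OF mP])
    show "AE \<omega> in M. (\<lambda>m. mx (P m) \<omega>) \<longlonglongrightarrow> sup3 D1 D2 c1 c2 c3 L \<omega>"
      unfolding mxP sup3_def using mx_dyadics_tendsto[OF L] by (intro AE_I2 tendsto_max tendsto_intros)
    show "AE \<omega> in M. norm (mx (P m) \<omega>) \<le> sup3 D1 D2 c1 c2 c3 L \<omega>" for m
    proof (rule AE_I2)
      fix \<omega> assume \<omega>: "\<omega> \<in> space M"
      have "mx (P m) \<omega> \<le> sup3 D1 D2 c1 c2 c3 L \<omega>"
        unfolding mx_le_iff[OF mP] using sub sup3_ge[OF D L c \<omega>] c by (auto intro: sup3_nonneg)
      then show "norm (mx (P m) \<omega>) \<le> sup3 D1 D2 c1 c2 c3 L \<omega>" using mx_nonneg[OF mP] by simp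
    qed
  qed
  then show ?thesis
    using K[OF markedD(1)[OF mP] sub] by (intro LIMSEQ_le_const2) (auto simp: Phi_def)
qed

lemma sup3_growth:
  assumes D: "0 < D1" "0 < D2" and L: "0 \<le> L" and c: "0 \<le> c1" "0 \<le> c2" "0 \<le> c3"
  shows "expectation (sup3 D1 D2 c1 c2 c3 L) \<le> 2 * ((c1 + c2 + c3) * K1) * (L + 1)"
proof (rule sup3_le[OF D L c])
  fix P assume P: "finite P" "P \<subseteq> marks D1 D2 c1 c2 c3 L"
  define n where "n = nat \<lceil>L\<rceil>"
  have "real n = of_int \<lceil>L\<rceil>" using L by (simp add: n_def)
  then have n: "L \<le> real (Suc n)" "real (Suc n) \<le> 2 * (L + 1)" using L by (simp_all, linarith+)
  have "Phi P \<le> real (Suc n) * ((c1 + c2 + c3) * K1)"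
  proof (rule Phi_interval[where a = 0])
    show "marked P" using P c by (rule marks_marked)
    fix p assume "p \<in> P"
    then have "fst p \<in> {0..L}" "snd p \<in> {c1, c2, c3}" using P(2) unfolding marks_def grid_def by auto
    then show "0 \<le> fst p \<and> fst p \<le> 0 + real (Suc n) \<and> snd p \<le> c1 + c2 + c3" using n(1) c by auto
  qed (use c in auto)
  also have "\<dots> \<le> (2 * (L + 1)) * ((c1 + c2 + c3) * K1)"
    using n c K1_nonneg by (intro mult_right_mono) auto
  finally show "Phi P \<le> 2 * ((c1 + c2 + c3) * K1) * (L + 1)" by (simp add: algebra_simps)
qed

text \<open>After a nearby common almost-return time of the two grids, the part beyond \<open>L1\<close> is shifted
  back to the origin; the second grid then has to be moved by less than \<open>\<delta>\<close>.\<close>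

lemma sup3_almost_subadditive:
  assumes D: "0 < D1" "0 < D2" and c: "0 \<le> c1" "0 \<le> c2" "0 \<le> c3" and \<epsilon>: "0 < \<epsilon>"
  defines "\<phi> \<equiv> \<lambda>L. expectation (sup3 D1 D2 c1 c2 c3 L)"
  shows "\<exists>C\<ge>0. \<forall>L1\<ge>0. \<forall>L2\<ge>0. \<phi> (L1 + L2) \<le> \<phi> L1 + \<phi> L2 + C + \<epsilon> * L2"
proof -
  define c where "c = c1 + c2 + c3"
  have c0: "0 \<le> c" and cc: "c1 \<le> c" "c2 \<le> c" "c3 \<le> c" using c by (auto simp: c_def)
  \<comment> \<open>At most \<open>L2 / D2 + 1\<close> points of the second grid are moved, so each
    may cost \<open>\<epsilon> * D2\<close>. The bound \<open>\<delta> < D2\<close> keeps their grid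
    indices nonnegative, and \<open>\<delta> \<le> 1\<close> confines the exceptional points to the
    last unit of \<open>[0, L2]\<close>.\<close>
  have "(\<lambda>n. c3 * modulus (1 / real (Suc n))) \<longlonglongrightarrow> c3 * 0"
    by (intro tendsto_intros modulus_tendsto)
  then have "\<forall>\<^sub>F n in sequentially. c3 * modulus (1 / real (Suc n)) < \<epsilon> * D2"
    using \<epsilon> D by (intro order_tendstoD(2)) auto
  moreover have "\<forall>\<^sub>F n in sequentially. 1 / real (Suc n) < D2"
    using LIMSEQ_inverse_real_of_nat D by (intro order_tendstoD(2)) (auto simp: inverse_eq_divide)
  ultimately have "\<forall>\<^sub>F n in sequentially. c3 * modulus (1 / real (Suc n)) < \<epsilon> * D2 \<and> 1 / real (Suc n) < D2"
    by (rule eventually_conj)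
  then obtain n where n: "c3 * modulus (1 / real (Suc n)) < \<epsilon> * D2" "1 / real (Suc n) < D2"
    unfolding eventually_sequentially by blast
  define \<delta> where "\<delta> = 1 / real (Suc n)"
  have \<delta>: "0 < \<delta>" "\<delta> \<le> 1" "\<delta> < D2" "c3 * modulus \<delta> \<le> \<epsilon> * D2" using n by (auto simp: \<delta>_def)
  obtain K :: nat where K: "\<And>k. \<exists>k' j::nat. k \<le> k' \<and> k' \<le> k + K \<and> \<bar>real k' * D1 - real j * D2\<bar> < \<delta>"
    using near_return[OF D \<delta>(1)] by blast
  define n0 where "n0 = nat \<lceil>real (K + 1) * D1\<rceil>"
  have n0: "real (K + 1) * D1 \<le> real (Suc n0)" unfolding n0_def by linarith
  \<comment> \<open>The terms pay for the points between \<open>L1\<close> and the return time, for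
    the points near the end of \<open>[0, L2]\<close>, and for the 1 in
    \<open>L2 / D2 + 1\<close>.\<close>
  define C where "C = real (Suc n0) * (c * K1) + c * K1 + \<epsilon> * D2"
  have C0: "0 \<le> C" unfolding C_def using c0 K1_nonneg \<epsilon> D by (intro add_nonneg_nonneg mult_nonneg_nonneg) auto
  have "\<phi> (L1 + L2) \<le> \<phi> L1 + \<phi> L2 + C + \<epsilon> * L2" if L: "0 \<le> L1" "0 \<le> L2" for L1 L2
    unfolding \<phi>_def
  proof (rule sup3_le[OF D _ c])
    show "0 \<le> L1 + L2" using L by simp
    fix P assume P: "finite P" "P \<subseteq> marks D1 D2 c1 c2 c3 (L1 + L2)"
    have mP: "marked P" using P c by (rule marks_marked)
    define k where "k = nat \<lceil>L1 / D1\<rceil>"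
    have rk: "real k = of_int \<lceil>L1 / D1\<rceil>" using L D by (simp add: k_def)
    have "L1 / D1 \<le> real k" "real k < L1 / D1 + 1" unfolding rk by linarith+
    then have k: "L1 \<le> real k * D1" "real k * D1 < L1 + D1" using D by (simp_all add: field_simps)
    obtain k' j where kj: "k \<le> k'" "k' \<le> k + K" "\<bar>real k' * D1 - real j * D2\<bar> < \<delta>" using K by blast
    define t0 where "t0 = real k' * D1"
    \<comment> \<open>The offset of the second grid from the return time \<open>t0\<close>, which
      lies exactly on the first grid.\<close>
    define e where "e = real j * D2 - t0"
    have e: "\<bar>e\<bar> < \<delta>" using kj(3) by (simp add: e_def t0_def)
    have "real k * D1 \<le> t0" unfolding t0_def using kj D by (intro mult_right_mono) auto
    then have t0_ge: "L1 \<le> t0" using k by linarith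
    have "t0 \<le> real (k + K) * D1" unfolding t0_def using kj D by (intro mult_right_mono) auto
    then have t0_le: "t0 \<le> L1 + real (Suc n0)" using k(2) n0 by (simp add: algebra_simps)
    have t0_pos: "0 \<le> t0" using t0_ge L by linarith
    let ?Pa = "{p\<in>P. fst p \<le> L1}" and ?Pb = "{p\<in>P. L1 < fst p \<and> fst p < t0}" and ?Pc = "{p\<in>P. L1 < fst p \<and> t0 \<le> fst p}"
    have ms: "marked ?Pa" "marked ?Pb" "marked ?Pc" using mP by (auto intro: marked_subset)
    have "P = ?Pa \<union> (?Pb \<union> ?Pc)" by auto
    then have split: "Phi P \<le> Phi ?Pa + (Phi ?Pb + Phi ?Pc)"
      using Phi_Un[OF ms(1) marked_Un[OF ms(2,3)]] Phi_Un[OF ms(2,3)] by simp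
    have "?Pa \<subseteq> marks D1 D2 c1 c2 c3 L1"
      using P(2) by (auto intro: marks_restrict)
    then have a: "Phi ?Pa \<le> expectation (sup3 D1 D2 c1 c2 c3 L1)"
      using P(1) by (intro Phi_le_sup3[OF D L(1) c]) auto
    have snd_le: "snd p \<le> c" if "p \<in> P" for p
      using P(2) that cc unfolding marks_def by auto
    have b: "Phi ?Pb \<le> real (Suc n0) * (c * K1)"
      using ms(2) L t0_le snd_le c0 by (intro Phi_interval[where a = L1]) auto
    define Q where "Q = (\<lambda>(t, c). (t - t0, c)) ` ?Pc"
    have mQ: "marked Q" and PcQ: "Phi ?Pc = Phi Q" unfolding Q_def using Phi_shift_back[OF ms(3) t0_pos] by auto
    have Qq: "0 \<le> fst q" "fst q \<le> L2" "snd q \<le> c"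
        "snd q = c1 \<or> (snd q = c2 \<and> fst q + t0 \<in> grid D1 (L1 + L2)) \<or> (snd q = c3 \<and> fst q + t0 \<in> grid D2 (L1 + L2))"
      if "q \<in> Q" for q
    proof -
      from that[unfolded Q_def] obtain p where p: "p \<in> P" "t0 \<le> fst p" "q = (fst p - t0, snd p)" by force
      have "fst p \<le> L1 + L2" using P(2) p(1) unfolding marks_def grid_def by auto
      then show "0 \<le> fst q" "fst q \<le> L2" using p t0_ge by auto
      show "snd q \<le> c" using snd_le[OF p(1)] p by simp
      show "snd q = c1 \<or> (snd q = c2 \<and> fst q + t0 \<in> grid D1 (L1 + L2)) \<or> (snd q = c3 \<and> fst q + t0 \<in> grid D2 (L1 + L2))"
        using P(2) p unfolding marks_def by auto
    qed
    \<comment> \<open>\<open>S\<close> collects the misaligned points of the second grid whose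
      aligned position stays in \<open>[0, L2]\<close>. In \<open>R\<close> are those whose aligned
      position exceeds \<open>L2\<close>; they lie in the last unit interval and are paid for
      separately.\<close>
    define S where "S = {q\<in>Q. q \<notin> marks D1 D2 c1 c2 c3 L2 \<and> snd q = c3 \<and> (\<exists>m::nat. real m * D2 \<le> L2 \<and> fst q = real m * D2 + e)}"
    define R where "R = {q\<in>Q. q \<notin> marks D1 D2 c1 c2 c3 L2 \<and> q \<notin> S}"
    have S_iff: "q \<in> S \<longleftrightarrow> q \<in> Q \<and> q \<notin> marks D1 D2 c1 c2 c3 L2 \<and> snd q = c3 \<and> (\<exists>m::nat. real m * D2 \<le> L2 \<and> fst q = real m * D2 + e)" for q
      by (auto simp: S_def)
    have R_iff: "q \<in> R \<longleftrightarrow> q \<in> Q \<and> q \<notin> marks D1 D2 c1 c2 c3 L2 \<and> q \<notin> S" for q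
      by (auto simp: R_def)
    have R_ge: "L2 - 1 \<le> fst q" if q: "q \<in> R" for q
    proof -
      have qQ: "q \<in> Q" and nm: "q \<notin> marks D1 D2 c1 c2 c3 L2" and nS: "q \<notin> S" using q by (auto simp: R_iff)
      have "snd q \<noteq> c1" using Qq[OF qQ] nm unfolding marks_def by (cases q) auto
      moreover have "\<not> (snd q = c2 \<and> fst q + t0 \<in> grid D1 (L1 + L2))"
      proof
        assume h: "snd q = c2 \<and> fst q + t0 \<in> grid D1 (L1 + L2)"
        then obtain i :: nat where i: "fst q + t0 = real i * D1" by (auto elim: gridE)
        then have q1: "fst q = (real i - real k') * D1" by (simp add: t0_def algebra_simps)
        then have "k' \<le> i" using Qq(1)[OF qQ] D by (simp add: zero_le_mult_iff)
        then have "fst q = real (i - k') * D1" using q1 by (simp add: of_nat_diff)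
        then have "fst q \<in> grid D1 L2" using Qq(2)[OF qQ] D gridI[of D1 "i - k'" L2] by simp
        then show False using h nm unfolding marks_def by (cases q) auto
      qed
      ultimately have h: "snd q = c3" "fst q + t0 \<in> grid D2 (L1 + L2)" using Qq(4)[OF qQ] by auto
      then obtain i :: nat where i: "fst q + t0 = real i * D2" by (auto elim: gridE)
      then have q3: "fst q = (real i - real j) * D2 + e" by (simp add: e_def algebra_simps)
      have "- D2 < (real i - real j) * D2" using Qq(1)[OF qQ] q3 e \<delta> by linarith
      then have "0 < (real i - real j + 1) * D2" by (simp add: algebra_simps)
      then have "real j < real i + 1" using D by (simp add: zero_less_mult_iff)
      then have "j \<le> i" by linarith
      then have q4: "fst q = real (i - j) * D2 + e" using q3 by (simp add: of_nat_diff)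
      have "\<not> real (i - j) * D2 \<le> L2"
      proof
        assume "real (i - j) * D2 \<le> L2"
        then have "q \<in> S" unfolding S_iff using qQ nm h(1) q4 by blast
        then show False using nS by blast
      qed
      then show ?thesis using q4 e \<delta> by linarith
    qed
    have RQ: "R \<subseteq> Q" by (auto simp: R_iff)
    have mR: "marked R" "marked (Q - R)" using mQ RQ by (auto intro: marked_subset)
    have "Q = (Q - R) \<union> R" using RQ by auto
    then have splitQ: "Phi Q \<le> Phi (Q - R) + Phi R" using Phi_Un[OF mR(2,1)] by simp
    have r: "Phi R \<le> c * K1"
    proof (rule Phi_unit[OF mR(1), where a = "max 0 (L2 - 1)"])
      fix q assume q: "q \<in> R"
      then have "q \<in> Q" using RQ by blast
      then show "max 0 (L2 - 1) \<le> fst q \<and> fst q \<le> max 0 (L2 - 1) + 1 \<and> snd q \<le> c"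
        using R_ge[OF q] Qq[of q] by auto
    qed (use c0 in auto)
    have s: "Phi (Q - R) \<le> expectation (sup3 D1 D2 c1 c2 c3 L2) + (\<Sum>q\<in>S. snd q) * modulus \<delta>"
    proof (rule Phi_perturb[OF mR(2), where g = "\<lambda>q. fst q - e"])
      show "integrable M (sup3 D1 D2 c1 c2 c3 L2)" by (rule sup3_integrable[OF D L(2)])
      show "0 \<le> sup3 D1 D2 c1 c2 c3 L2 \<omega>" for \<omega> using c by (intro sup3_nonneg)
      show "S \<subseteq> Q - R" by (auto simp: S_iff R_iff)
      show "snd q * V (fst q) \<omega> \<le> sup3 D1 D2 c1 c2 c3 L2 \<omega>" if "\<omega> \<in> space M" "q \<in> Q - R - S" for \<omega> q
        using that(2) by (intro sup3_ge[OF D L(2) c that(1)]) (auto simp: R_iff)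
      fix q assume q: "q \<in> S"
      then obtain m :: nat where m: "real m * D2 \<le> L2" "fst q = real m * D2 + e" "snd q = c3" unfolding S_iff by blast
      have g: "fst q - e \<in> grid D2 L2" using m D gridI[of D2 m L2] by simp
      then show "0 \<le> fst q - e \<and> \<bar>(fst q - e) - fst q\<bar> \<le> \<delta>" using e by (auto elim: gridE)
      show "snd q * V (fst q - e) \<omega> \<le> sup3 D1 D2 c1 c2 c3 L2 \<omega>" if "\<omega> \<in> space M" for \<omega>
        using sup3_ge[OF D L(2) c that, of "(fst q - e, c3)"] g m(3) unfolding marks_def by auto
    qed
    have "(\<Sum>q\<in>S. snd q) * modulus \<delta> \<le> \<epsilon> * L2 + \<epsilon> * D2"
    proof -
      let ?N = "nat \<lfloor>L2 / D2\<rfloor>"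
      have N: "real ?N \<le> L2 / D2" using L D by simp
      have "S \<subseteq> (\<lambda>m. (real m * D2 + e, c3)) ` {..?N}"
      proof
        fix q assume "q \<in> S"
        then obtain m :: nat where m: "real m * D2 \<le> L2" "fst q = real m * D2 + e" "snd q = c3" unfolding S_iff by blast
        then have "real m \<le> L2 / D2" using D by (simp add: field_simps)
        then have "m \<le> ?N" by linarith
        then show "q \<in> (\<lambda>m. (real m * D2 + e, c3)) ` {..?N}" using m by (cases q) auto
      qed
      then have "card S \<le> card ((\<lambda>m. (real m * D2 + e, c3)) ` {..?N})" by (intro card_mono) auto
      also have "\<dots> \<le> card {..?N}" by (rule card_image_le) simp
      finally have "real (card S) \<le> real ?N + 1" by simp
      then have card: "real (card S) \<le> L2 / D2 + 1" using N by linarith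
      have "(\<Sum>q\<in>S. snd q) = (\<Sum>q\<in>S. c3)" by (intro sum.cong) (auto simp: S_iff)
      then have "(\<Sum>q\<in>S. snd q) = real (card S) * c3" by simp
      then have "(\<Sum>q\<in>S. snd q) * modulus \<delta> = real (card S) * (c3 * modulus \<delta>)" by simp
      also have "\<dots> \<le> (L2 / D2 + 1) * (\<epsilon> * D2)"
        by (rule mult_mono[OF card \<delta>(4)]) (use c modulus_nonneg[of \<delta>] L D in auto)
      also have "\<dots> = \<epsilon> * L2 + \<epsilon> * D2" using D by (simp add: field_simps)
      finally show ?thesis .
    qed
    then show "Phi P \<le> expectation (sup3 D1 D2 c1 c2 c3 L1) + expectation (sup3 D1 D2 c1 c2 c3 L2) + C + \<epsilon> * L2"
      using split a b PcQ splitQ r s unfolding C_def by linarith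
  qed
  then show ?thesis using C0 by blast
qed

lemma sup3_limit:
  assumes D: "0 < D1" "0 < D2" and c: "0 \<le> c1" "0 \<le> c2" "0 \<le> c3"
  shows "\<exists>l. ((\<lambda>L. expectation (sup3 D1 D2 c1 c2 c3 L) / L) \<longlongrightarrow> l) at_top"
proof (rule almost_subadditive_convergent)
  show "0 \<le> expectation (sup3 D1 D2 c1 c2 c3 L)" for L
    using c by (intro integral_nonneg_AE AE_I2 sup3_nonneg)
qed (use sup3_growth[OF D _ c] sup3_almost_subadditive[OF D c] in auto)

section \<open>Positivity of the constants\<close>

text \<open>What the maximum loses against the sum is at most the minimum of \<open>mx P\<close> and
  \<open>V t\<close>, and the minimum of two squares is at most the product of their roots.\<close>

lemma mx_insert_lower:
  assumes P: "marked P" "0 \<le> t" and one: "\<And>p. p \<in> P \<Longrightarrow> snd p = 1"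
  shows "mx P \<omega> + V t \<omega> - (\<Sum>p\<in>P. exp (X (fst p) \<omega> / 2) * exp (X t \<omega> / 2)) \<le> mx (insert (t, 1) P) \<omega>"
proof -
  have mi: "marked (insert (t, 1) P)" using P by (auto simp: marked_def)
  let ?s = "\<Sum>p\<in>P. exp (X (fst p) \<omega> / 2) * exp (X t \<omega> / 2)"
  have ge: "mx P \<omega> \<le> mx (insert (t, 1) P) \<omega>" "V t \<omega> \<le> mx (insert (t, 1) P) \<omega>"
    using mx_mono[OF mi, of P \<omega>] mx_ge[OF mi, of "(t, 1)" \<omega>] by auto
  have s0: "0 \<le> ?s" by (intro sum_nonneg) simp
  show ?thesis
  proof (cases "V t \<omega> \<le> ?s")
    case True
    then show ?thesis using ge by linarith
  next
    case False
    have "snd p * V (fst p) \<omega> \<le> ?s" if p: "p \<in> P" for p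
    proof -
      define a b where "a = exp (X (fst p) \<omega> / 2)" and "b = exp (X t \<omega> / 2)"
      have ab: "0 < a" "0 < b" "a * a = V (fst p) \<omega>" "b * b = V t \<omega>"
        by (simp_all add: a_def b_def exp_add[symmetric])
      have s: "a * b \<le> ?s" unfolding a_def b_def
        using p markedD(1)[OF P(1)] by (intro member_le_sum) auto
      then have "a * b < b * b" using False ab by linarith
      then have "a < b" using mult_less_cancel_right_pos[OF ab(2), of a b] by blast
      then have "a * a \<le> a * b" using ab by (intro mult_left_mono) auto
      then show ?thesis using one[OF p] s ab by simp
    qed
    then have "mx P \<omega> \<le> ?s" unfolding mx_le_iff[OF P(1)] using s0 by blast
    then show ?thesis using ge by linarith
  qed
qed

text \<open>The distances from the newest point to the earlier ones are distinct positive multiples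
  of \<open>m * D\<close>, so their affinities belong to the tail of a convergent series.\<close>

lemma sparse_sum:
  assumes D: "0 < D"
  shows "\<exists>m>0. \<forall>n::nat. (\<Sum>k<n. exp (- ((real ((n - k) * m) * D) powr \<alpha>) / 4)) \<le> 1 / 2"
proof -
  define f where "f i = exp (- ((real i * D) powr \<alpha>) / 4)" for i :: nat
  have "summable f"
  proof (rule summable_comparison_test_bigo)
    show "summable (\<lambda>n. norm (1 / (real n)\<^sup>2))"
      using inverse_power_summable[of 2] by (simp add: inverse_eq_divide)
    show "f \<in> O(\<lambda>n. 1 / (real n)\<^sup>2)"
      unfolding f_def using D \<alpha> by real_asymp
  qed
  then obtain N where N: "\<And>m n. m \<ge> N \<Longrightarrow> norm (sum f {m..<n}) < 1 / 2"
    unfolding summable_Cauchy by (metis half_gt_zero_iff zero_less_one)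
  define m where "m = Suc N"
  have "(\<Sum>k<n. f ((n - k) * m)) \<le> 1 / 2" for n
  proof -
    have inj: "inj_on (\<lambda>k. (n - k) * m) {..<n}"
    proof (rule inj_onI)
      fix x y assume xy: "x \<in> {..<n}" "y \<in> {..<n}" "(n - x) * m = (n - y) * m"
      have "m \<noteq> 0" by (simp add: m_def)
      then have "n - x = n - y" using xy(3) by simp
      then show "x = y" using xy by auto
    qed
    have "(\<Sum>k<n. f ((n - k) * m)) = sum f ((\<lambda>k. (n - k) * m) ` {..<n})"
      by (simp add: sum.reindex[OF inj])
    also have "\<dots> \<le> sum f {m..<Suc (n * m)}"
    proof (rule sum_mono2)
      show "(\<lambda>k. (n - k) * m) ` {..<n} \<subseteq> {m..<Suc (n * m)}"
        by (auto simp: less_Suc_eq_le intro!: mult_right_mono)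
    qed (auto simp: f_def)
    also have "\<dots> \<le> norm (sum f {m..<Suc (n * m)})" by simp
    also have "\<dots> < 1 / 2" by (rule N) (simp add: m_def)
    finally show ?thesis by simp
  qed
  then show ?thesis unfolding f_def by (intro exI[of _ m]) (auto simp: m_def)
qed

text \<open>On a sparse subgrid each new point raises the expected maximum by at least
  \<open>1 - 1 / 2\<close>: its own mean minus its affinities with the earlier points.\<close>

lemma sup_grid_linear_lower:
  assumes D: "0 < D"
  shows "\<exists>\<kappa>>0. \<forall>L\<ge>0. \<kappa> * L \<le> expectation (\<lambda>\<omega>. exp (max_grid B \<alpha> D L \<omega>))"
proof -
  obtain m where m: "m > 0" "\<And>n::nat. (\<Sum>k<n. exp (- ((real ((n - k) * m) * D) powr \<alpha>) / 4)) \<le> 1 / 2"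
    using sparse_sum[OF D] by blast
  define \<tau> where "\<tau> k = real (k * m) * D" for k :: nat
  have \<tau>: "0 \<le> \<tau> k" for k using D by (simp add: \<tau>_def)
  define P where "P n = (\<lambda>k. (\<tau> k, 1::real)) ` {..<n}" for n :: nat
  have mP: "marked (P n)" for n using \<tau> by (auto simp: P_def marked_def)
  have inj: "inj_on (\<lambda>k. (\<tau> k, 1::real)) A" for A
    using m(1) D by (auto simp: inj_on_def \<tau>_def)
  have "real n / 2 \<le> Phi (P n)" for n
  proof (induction n)
    case 0
    show ?case using mx_nonneg[OF mP] by (simp add: Phi_def)
  next
    case (Suc n)
    have ins: "P (Suc n) = insert (\<tau> n, 1) (P n)" by (simp add: P_def lessThan_Suc)
    let ?s = "\<lambda>\<omega>. \<Sum>k<n. exp (X (\<tau> k) \<omega> / 2) * exp (X (\<tau> n) \<omega> / 2)"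
    have sI: "integrable M ?s" using \<tau> by (intro Bochner_Integration.integrable_sum sqrt_V_expectation)
    have sE: "expectation ?s \<le> 1 / 2"
    proof -
      have "expectation ?s = (\<Sum>k<n. exp (- (\<bar>\<tau> n - \<tau> k\<bar> powr \<alpha>) / 4))"
        using \<tau> by (subst Bochner_Integration.integral_sum) (auto simp: sqrt_V_expectation)
      also have "\<dots> = (\<Sum>k<n. exp (- ((real ((n - k) * m) * D) powr \<alpha>) / 4))"
      proof (intro sum.cong refl)
        fix k assume "k \<in> {..<n}"
        then have "\<bar>\<tau> n - \<tau> k\<bar> = real ((n - k) * m) * D"
          using D by (simp add: \<tau>_def of_nat_diff left_diff_distrib mult_right_mono)
        then show "exp (- (\<bar>\<tau> n - \<tau> k\<bar> powr \<alpha>) / 4) = exp (- ((real ((n - k) * m) * D) powr \<alpha>) / 4)" by simp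
      qed
      finally show ?thesis using m(2)[of n] by simp
    qed
    have "expectation (\<lambda>\<omega>. mx (P n) \<omega> + V (\<tau> n) \<omega> - ?s \<omega>) \<le> expectation (mx (P (Suc n)))"
    proof (rule integral_mono)
      show "integrable M (\<lambda>\<omega>. mx (P n) \<omega> + V (\<tau> n) \<omega> - ?s \<omega>)"
        using sI mx_integrable[OF mP] V_integrable[OF \<tau>] by auto
      show "integrable M (mx (P (Suc n)))" by (rule mx_integrable[OF mP])
      show "mx (P n) \<omega> + V (\<tau> n) \<omega> - ?s \<omega> \<le> mx (P (Suc n)) \<omega>" for \<omega>
      proof -
        have "(\<Sum>p\<in>P n. exp (X (fst p) \<omega> / 2) * exp (X (\<tau> n) \<omega> / 2)) = ?s \<omega>"
          unfolding P_def by (subst sum.reindex[OF inj]) simp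
        moreover have "snd p = 1" if "p \<in> P n" for p using that by (auto simp: P_def)
        ultimately show ?thesis
          using mx_insert_lower[OF mP[of n] \<tau>[of n], of \<omega>] unfolding ins by simp
      qed
    qed
    also have "expectation (\<lambda>\<omega>. mx (P n) \<omega> + V (\<tau> n) \<omega> - ?s \<omega>) = Phi (P n) + 1 - expectation ?s"
      using sI mx_integrable[OF mP] V_integrable[OF \<tau>] V_expectation[OF \<tau>] by (simp add: Phi_def)
    finally show ?case using Suc sE by (simp add: Phi_def)
  qed
  note lower = this
  define \<kappa> where "\<kappa> = 1 / (2 * (real m * D))"
  have mD: "0 < real m * D" using m(1) D by simp
  have "\<kappa> * L \<le> expectation (\<lambda>\<omega>. exp (max_grid B \<alpha> D L \<omega>))" if L: "0 \<le> L" for L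
  proof -
    \<comment> \<open>The successor counts the origin: \<open>n\<close> sparse points lie in
      \<open>[0, L]\<close>, and \<open>n\<close> is at least
      \<open>L / (real m * D)\<close>.\<close>
    define n where "n = Suc (nat \<lfloor>L / (real m * D)\<rfloor>)"
    have q: "0 \<le> L / (real m * D)" using L mD by simp
    have "real (nat \<lfloor>L / (real m * D)\<rfloor>) \<le> L / (real m * D)" using q by simp
    then have le: "real k * (real m * D) \<le> L" if "k < n" for k
    proof -
      have "real k \<le> L / (real m * D)" using that q unfolding n_def by linarith
      then show ?thesis using mD by (simp add: field_simps)
    qed
    have "L / (real m * D) \<le> real n" unfolding n_def by linarith
    then have "\<kappa> * L \<le> real n / 2" unfolding \<kappa>_def by (simp add: field_simps)
    also have "\<dots> \<le> Phi (P n)" by (rule lower)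
    also have "\<dots> \<le> Phi (grid D L \<times> {1})"
    proof (rule Phi_mono)
      show "marked (grid D L \<times> {1})" using D by (intro marked_grid) auto
      have "\<tau> k \<in> grid D L" if "k < n" for k
        unfolding \<tau>_def using le[OF that] D by (intro gridI) (auto simp: mult.assoc)
      then show "P n \<subseteq> grid D L \<times> {1}" by (auto simp: P_def)
    qed
    also have "\<dots> = expectation (\<lambda>\<omega>. exp (max_grid B \<alpha> D L \<omega>))"
    proof -
      have "mx (grid D L \<times> {1}) = (\<lambda>\<omega>. exp (max_grid B \<alpha> D L \<omega>))" using mx_grid[OF D L, of 1] by auto
      then show ?thesis by (simp add: Phi_def)
    qed
    finally show ?thesis .
  qed
  moreover have "0 < \<kappa>" using mD by (simp add: \<kappa>_def)
  ultimately show ?thesis by blast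
qed

end

section \<open>The constants as limits of expected maxima\<close>

lemma nn_integral_exp_lessThan: "(\<integral>\<^sup>+ s. ennreal (exp s) * indicator {..<u} s \<partial>lborel) = ennreal (exp u)"
proof -
  have "(\<integral>\<^sup>+ s. ennreal (exp s) * indicator {..<u} s \<partial>lborel)
      = ennreal \<bar>-1\<bar> * (\<integral>\<^sup>+ s. ennreal (exp (0 + -1 * s)) * indicator {..<u} (0 + -1 * s) \<partial>lborel)"
    by (rule nn_integral_real_affine) auto
  also have "\<dots> = (\<integral>\<^sup>+ s. ennreal (exp (- s)) * indicator {- u..} s \<partial>lborel)"
    using AE_lborel_singleton[of "- u"]
    by (simp, intro nn_integral_cong_AE) (auto elim!: eventually_mono simp: indicator_def)
  also have "\<dots> = ennreal (0 - (- exp (- (- u))))"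
  proof (rule nn_integral_FTC_atLeast)
    show "((\<lambda>x. - exp (- x)) has_real_derivative exp (- x)) (at x)" for x :: real
      by (auto intro!: derivative_eq_intros)
    show "((\<lambda>x. - exp (- x)) \<longlongrightarrow> (0::real)) at_top" by real_asymp
  qed auto
  finally show ?thesis by simp
qed

text \<open>Layer cake formula, which turns the integrals in the definitions into expectations of
  \<open>exp\<close> of a minimum. An infinite value becomes 0 on both sides.\<close>

lemma (in prob_space) integral_exp_tail:
  fixes U :: "'a \<Rightarrow> real"
  assumes [measurable]: "U \<in> borel_measurable M"
  shows "(\<integral>s. exp s * \<P>(\<omega> in M. s < U \<omega>) \<partial>lborel) = expectation (\<lambda>\<omega>. exp (U \<omega>))"
proof -
  interpret P: pair_sigma_finite lborel M ..
  \<comment> \<open>A tail probability is monotone in \<open>s\<close>, hence measurable.\<close>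
  have "mono (\<lambda>s. - \<P>(\<omega> in M. s < U \<omega>))"
    by (intro monoI, simp, intro finite_measure_mono) auto
  then have "(\<lambda>s. - \<P>(\<omega> in M. s < U \<omega>)) \<in> borel_measurable borel" by (rule borel_measurable_mono)
  then have "(\<lambda>s. - (- \<P>(\<omega> in M. s < U \<omega>))) \<in> borel_measurable borel" by (rule borel_measurable_uminus)
  then have [measurable]: "(\<lambda>s. \<P>(\<omega> in M. s < U \<omega>)) \<in> borel_measurable borel" by simp
  have "(\<integral>\<^sup>+ s. ennreal (exp s * \<P>(\<omega> in M. s < U \<omega>)) \<partial>lborel)
      = (\<integral>\<^sup>+ s. (\<integral>\<^sup>+ \<omega>. ennreal (exp s) * indicator {..<U \<omega>} s \<partial>M) \<partial>lborel)"
  proof (intro nn_integral_cong)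
    fix s
    have "(\<integral>\<^sup>+ \<omega>. ennreal (exp s) * indicator {..<U \<omega>} s \<partial>M)
        = (\<integral>\<^sup>+ \<omega>. ennreal (exp s) * indicator {\<omega> \<in> space M. s < U \<omega>} \<omega> \<partial>M)"
      by (intro nn_integral_cong) (auto simp: indicator_def)
    also have "\<dots> = ennreal (exp s) * emeasure M {\<omega> \<in> space M. s < U \<omega>}"
      by (subst nn_integral_cmult) auto
    finally show "ennreal (exp s * \<P>(\<omega> in M. s < U \<omega>)) = (\<integral>\<^sup>+ \<omega>. ennreal (exp s) * indicator {..<U \<omega>} s \<partial>M)"
      by (simp add: emeasure_eq_measure ennreal_mult)
  qed
  also have "\<dots> = (\<integral>\<^sup>+ \<omega>. (\<integral>\<^sup>+ s. ennreal (exp s) * indicator {..<U \<omega>} s \<partial>lborel) \<partial>M)"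
  proof (rule P.Fubini'[symmetric])
    have "(\<lambda>p. ennreal (exp (fst p)) * indicator {p. fst p < U (snd p)} p) \<in> borel_measurable (lborel \<Otimes>\<^sub>M M)"
      by measurable
    then show "(\<lambda>(s, \<omega>). ennreal (exp s) * indicator {..<U \<omega>} s) \<in> borel_measurable (lborel \<Otimes>\<^sub>M M)"
      by (simp add: case_prod_beta indicator_def)
  qed
  also have "\<dots> = (\<integral>\<^sup>+ \<omega>. ennreal (exp (U \<omega>)) \<partial>M)" by (simp only: nn_integral_exp_lessThan)
  finally have eq: "(\<integral>\<^sup>+ s. ennreal (exp s * \<P>(\<omega> in M. s < U \<omega>)) \<partial>lborel) = (\<integral>\<^sup>+ \<omega>. ennreal (exp (U \<omega>)) \<partial>M)" .
  have "(\<integral>s. exp s * \<P>(\<omega> in M. s < U \<omega>) \<partial>lborel) = enn2real (\<integral>\<^sup>+ s. ennreal (exp s * \<P>(\<omega> in M. s < U \<omega>)) \<partial>lborel)"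
    by (rule integral_eq_nn_integral) auto
  also have "\<dots> = enn2real (\<integral>\<^sup>+ \<omega>. ennreal (exp (U \<omega>)) \<partial>M)" by (simp only: eq)
  also have "\<dots> = expectation (\<lambda>\<omega>. exp (U \<omega>))"
    by (rule integral_eq_nn_integral[symmetric]) auto
  finally show ?thesis .
qed

context fbm
begin

text \<open>The constant with a maximum where the definitions have a joint event, that is, a
  minimum. Maxima are the almost subadditive quantities, so their limits come first and the others
  are combinations of them.\<close>

definition Gam :: "real \<Rightarrow> real \<Rightarrow> real \<Rightarrow> real \<Rightarrow> real \<Rightarrow> real" where
  "Gam D1 D2 c1 c2 c3 = Lim at_top (\<lambda>L. expectation (sup3 D1 D2 c1 c2 c3 L) / L)"

lemma Gam_tendsto:
  assumes "0 < D1" "0 < D2" "0 \<le> c1" "0 \<le> c2" "0 \<le> c3"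
  shows "((\<lambda>L. expectation (sup3 D1 D2 c1 c2 c3 L) / L) \<longlongrightarrow> Gam D1 D2 c1 c2 c3) at_top"
proof -
  obtain l where l: "((\<lambda>L. expectation (sup3 D1 D2 c1 c2 c3 L) / L) \<longlongrightarrow> l) at_top"
    using sup3_limit[OF assms] by blast
  moreover have "Gam D1 D2 c1 c2 c3 = l"
    unfolding Gam_def by (rule tendsto_Lim[OF _ l]) simp
  ultimately show ?thesis by simp
qed

lemma sup3_single:
  "0 \<le> c \<Longrightarrow> sup3 D1 D2 c 0 0 L = (\<lambda>\<omega>. c * exp (max_cont B \<alpha> L \<omega>))"
  "0 \<le> c \<Longrightarrow> sup3 D1 D2 0 c 0 L = (\<lambda>\<omega>. c * exp (max_grid B \<alpha> D1 L \<omega>))"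
  "0 \<le> c \<Longrightarrow> sup3 D1 D2 0 0 c L = (\<lambda>\<omega>. c * exp (max_grid B \<alpha> D2 L \<omega>))"
  by (auto simp: sup3_def fun_eq_iff max.absorb1 max.absorb2)

lemma sup3_pair:
  "0 \<le> b \<Longrightarrow> sup3 D1 D2 a b 0 L \<omega> = max (a * exp (max_cont B \<alpha> L \<omega>)) (b * exp (max_grid B \<alpha> D1 L \<omega>))"
  "0 \<le> c \<Longrightarrow> sup3 D1 D2 a 0 c L \<omega> = max (a * exp (max_cont B \<alpha> L \<omega>)) (c * exp (max_grid B \<alpha> D2 L \<omega>))"
  "0 \<le> b \<Longrightarrow> sup3 D1 D2 0 b c L \<omega> = max (b * exp (max_grid B \<alpha> D1 L \<omega>)) (c * exp (max_grid B \<alpha> D2 L \<omega>))"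
  by (simp_all add: sup3_def max.absorb1 max.absorb2 le_max_iff_disj)

lemma H_eq_Gam:
  "H_cont M B \<alpha> = Gam D1 D2 1 0 0" "H_grid M B \<alpha> D1 = Gam D1 D2 0 1 0" "H_grid M B \<alpha> D2 = Gam D1 D2 0 0 1"
  by (simp_all add: H_cont_def H_grid_def Gam_def sup3_single divide_inverse mult.commute)

lemma Gam_single:
  assumes D: "0 < D1" "0 < D2" and c: "0 \<le> c"
  shows "Gam D1 D2 c 0 0 = c * H_cont M B \<alpha>"
    and "Gam D1 D2 0 c 0 = c * H_grid M B \<alpha> D1"
    and "Gam D1 D2 0 0 c = c * H_grid M B \<alpha> D2"
proof -
  have *: "l = c * l'" if "((\<lambda>L. c * f L / L) \<longlongrightarrow> l) at_top" "((\<lambda>L. f L / L) \<longlongrightarrow> l') at_top"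
    for f :: "real \<Rightarrow> real" and l l'
    using tendsto_unique[OF _ that(1) tendsto_mult[OF tendsto_const[of c] that(2), simplified]] by simp
  show "Gam D1 D2 c 0 0 = c * H_cont M B \<alpha>"
    unfolding H_eq_Gam(1)[of D1 D2]
    using Gam_tendsto[OF D, of c 0 0] Gam_tendsto[OF D, of 1 0 0] c by (intro *) (simp_all add: sup3_single)
  show "Gam D1 D2 0 c 0 = c * H_grid M B \<alpha> D1"
    unfolding H_eq_Gam(2)[of D1 D2]
    using Gam_tendsto[OF D, of 0 c 0] Gam_tendsto[OF D, of 0 1 0] c by (intro *) (simp_all add: sup3_single)
  show "Gam D1 D2 0 0 c = c * H_grid M B \<alpha> D2"
    unfolding H_eq_Gam(3)[of D2 D1]
    using Gam_tendsto[OF D, of 0 0 c] Gam_tendsto[OF D, of 0 0 1] c by (intro *) (simp_all add: sup3_single)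
qed

lemma H_grid_pos: assumes D: "0 < D" shows "0 < H_grid M B \<alpha> D"
proof -
  obtain \<kappa> where \<kappa>: "0 < \<kappa>" "\<And>L. 0 \<le> L \<Longrightarrow> \<kappa> * L \<le> expectation (\<lambda>\<omega>. exp (max_grid B \<alpha> D L \<omega>))"
    using sup_grid_linear_lower[OF D] by blast
  have "\<kappa> \<le> Gam D D 0 0 1"
  proof (rule tendsto_lowerbound[OF Gam_tendsto[OF D D]])
    show "\<forall>\<^sub>F L in at_top. \<kappa> \<le> expectation (sup3 D D 0 0 1 L) / L"
      using eventually_gt_at_top[of 0]
    proof eventually_elim
      case (elim L)
      then show ?case using \<kappa>(2)[of L] by (simp add: sup3_single field_simps)
    qed
  qed auto
  then show ?thesis using \<kappa>(1) by (simp add: H_eq_Gam(3)[of D D])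
qed

lemma Gam_mono:
  assumes D: "0 < D1" "0 < D2" and c: "0 \<le> c1" "0 \<le> c2" "0 \<le> c3" and d: "0 \<le> d1" "0 \<le> d2" "0 \<le> d3"
    and le: "\<And>L \<omega>. 0 \<le> L \<Longrightarrow> \<omega> \<in> space M \<Longrightarrow> sup3 D1 D2 c1 c2 c3 L \<omega> \<le> sup3 D1 D2 d1 d2 d3 L \<omega>"
  shows "Gam D1 D2 c1 c2 c3 \<le> Gam D1 D2 d1 d2 d3"
proof (rule tendsto_le[OF _ Gam_tendsto[OF D d] Gam_tendsto[OF D c]])
  show "\<forall>\<^sub>F L in at_top. expectation (sup3 D1 D2 c1 c2 c3 L) / L \<le> expectation (sup3 D1 D2 d1 d2 d3 L) / L"
    using eventually_gt_at_top[of 0]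
  proof eventually_elim
    case (elim L)
    then show ?case
      using D le[of L] by (intro divide_right_mono integral_mono sup3_integrable) auto
  qed
qed simp

lemma H_cont_pos: "0 < H_cont M B \<alpha>"
proof -
  have "Gam 1 1 0 0 1 \<le> Gam 1 1 1 0 0"
  proof (rule Gam_mono)
    fix L \<omega> assume L: "0 \<le> (L::real)" and \<omega>: "\<omega> \<in> space M"
    obtain t where t: "max_cont B \<alpha> L \<omega> = X t \<omega>" "\<And>s. 0 \<le> s \<Longrightarrow> s \<le> L \<Longrightarrow> X s \<omega> \<le> X t \<omega>"
      using max_cont_attained[OF L \<omega>] by metis
    obtain u where u: "u \<in> grid 1 L" "max_grid B \<alpha> 1 L \<omega> = X u \<omega>"
      using max_grid_attained[OF zero_less_one L, of \<omega>] by metis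
    have "X u \<omega> \<le> X t \<omega>" using u(1) by (intro t(2)) (auto elim: gridE)
    then show "sup3 1 1 0 0 1 L \<omega> \<le> sup3 1 1 1 0 0 L \<omega>" by (simp add: sup3_single t u)
  qed auto
  then show ?thesis using H_grid_pos[of 1] by (simp add: H_eq_Gam(1)[of 1 1] H_eq_Gam(3)[of 1 1])
qed

lemma Gam_lower:
  assumes D: "0 < D1" "0 < D2" and c: "0 \<le> c1" "0 \<le> c2" "0 \<le> c3"
  shows "c1 * H_cont M B \<alpha> \<le> Gam D1 D2 c1 c2 c3"
    and "c2 * H_grid M B \<alpha> D1 \<le> Gam D1 D2 c1 c2 c3"
    and "c3 * H_grid M B \<alpha> D2 \<le> Gam D1 D2 c1 c2 c3"
  unfolding Gam_single[OF D c(1), symmetric] Gam_single[OF D c(2), symmetric] Gam_single[OF D c(3), symmetric]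
  using D c by (auto intro!: Gam_mono simp: sup3_def max.coboundedI1 max.coboundedI2)

lemma Gam_upper:
  assumes D: "0 < D1" "0 < D2" and c: "0 \<le> c1" "0 \<le> c2" "0 \<le> c3"
  shows "Gam D1 D2 c1 c2 c3 \<le> c1 * H_cont M B \<alpha> + c2 * H_grid M B \<alpha> D1 + c3 * H_grid M B \<alpha> D2"
proof -
  have "Gam D1 D2 c1 c2 c3 \<le> Gam D1 D2 c1 0 0 + Gam D1 D2 0 c2 0 + Gam D1 D2 0 0 c3"
  proof (rule tendsto_le[OF _ _ Gam_tendsto[OF D c]])
    show "((\<lambda>L. expectation (sup3 D1 D2 c1 0 0 L) / L + expectation (sup3 D1 D2 0 c2 0 L) / L + expectation (sup3 D1 D2 0 0 c3 L) / L)
        \<longlongrightarrow> Gam D1 D2 c1 0 0 + Gam D1 D2 0 c2 0 + Gam D1 D2 0 0 c3) at_top"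
      using D c by (intro tendsto_add Gam_tendsto) auto
    show "\<forall>\<^sub>F L in at_top. expectation (sup3 D1 D2 c1 c2 c3 L) / L
        \<le> expectation (sup3 D1 D2 c1 0 0 L) / L + expectation (sup3 D1 D2 0 c2 0 L) / L + expectation (sup3 D1 D2 0 0 c3 L) / L"
      using eventually_gt_at_top[of 0]
    proof eventually_elim
      case (elim L)
      have I: "integrable M (sup3 D1 D2 a b d L)" for a b d using D elim by (intro sup3_integrable) auto
      have "expectation (sup3 D1 D2 c1 c2 c3 L)
          \<le> expectation (\<lambda>\<omega>. sup3 D1 D2 c1 0 0 L \<omega> + sup3 D1 D2 0 c2 0 L \<omega> + sup3 D1 D2 0 0 c3 L \<omega>)"
      proof (rule integral_mono)
        show "integrable M (\<lambda>\<omega>. sup3 D1 D2 c1 0 0 L \<omega> + sup3 D1 D2 0 c2 0 L \<omega> + sup3 D1 D2 0 0 c3 L \<omega>)"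
          by (intro Bochner_Integration.integrable_add I)
        show "sup3 D1 D2 c1 c2 c3 L \<omega> \<le> sup3 D1 D2 c1 0 0 L \<omega> + sup3 D1 D2 0 c2 0 L \<omega> + sup3 D1 D2 0 0 c3 L \<omega>" for \<omega>
          using c by (simp add: sup3_single) (simp add: sup3_def)
      qed (rule I)
      also have "\<dots> = expectation (sup3 D1 D2 c1 0 0 L) + expectation (sup3 D1 D2 0 c2 0 L) + expectation (sup3 D1 D2 0 0 c3 L)"
        by (simp only: Bochner_Integration.integral_add I Bochner_Integration.integrable_add)
      finally show ?case using elim by (simp add: add_divide_distrib[symmetric] divide_right_mono)
    qed
  qed simp
  then show ?thesis using Gam_single[OF D] c by simp
qed

lemma max_cont_measurable: assumes "0 \<le> L" shows "max_cont B \<alpha> L \<in> borel_measurable M"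
  using borel_measurable_ln[OF exp_max_cont_measurable[OF assms]] by simp

lemma max_grid_measurable: assumes "0 < D" "0 \<le> L" shows "max_grid B \<alpha> D L \<in> borel_measurable M"
  using borel_measurable_ln[OF exp_max_grid_measurable[OF assms]] by simp

lemma exp_min_diff: "exp (min (a - x) (b - y)) = exp (- x) * exp a + exp (- y) * exp b - max (exp (- x) * exp a) (exp (- y) * exp b)"
  for a b x y :: real
proof -
  have *: "exp (- x) * exp a = exp (a - x)" "exp (- y) * exp b = exp (b - y)" by (simp_all add: exp_add[symmetric])
  show ?thesis unfolding * by (auto simp: min_def max_def)
qed

text \<open>A minimum is the sum minus the maximum, and a superscript \<open>x\<close> acts as the
  weight \<open>exp (- x)\<close>. Both spacings are expressed through the same
  \<open>Gam D1 D2\<close>, so that pair terms can cancel in \<open>f5\<close>.\<close>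

lemma H_cont_grid_eq:
  assumes D: "0 < D1" "0 < D2"
  shows "H_cont_grid M B \<alpha> D1 x y = exp (- x) * H_cont M B \<alpha> + exp (- y) * H_grid M B \<alpha> D1 - Gam D1 D2 (exp (- x)) (exp (- y)) 0" (is ?g1)
    and "H_cont_grid M B \<alpha> D2 x y = exp (- x) * H_cont M B \<alpha> + exp (- y) * H_grid M B \<alpha> D2 - Gam D1 D2 (exp (- x)) 0 (exp (- y))" (is ?g2)
proof -
  have tail: "(\<integral>s. exp s * \<P>(\<omega> in M. max_cont B \<alpha> L \<omega> > s + x \<and> max_grid B \<alpha> D L \<omega> > s + y) \<partial>lborel)
      = expectation (\<lambda>\<omega>. exp (min (max_cont B \<alpha> L \<omega> - x) (max_grid B \<alpha> D L \<omega> - y)))" if "0 < D" "0 \<le> L" for D L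
  proof -
    have "(\<lambda>\<omega>. min (max_cont B \<alpha> L \<omega> - x) (max_grid B \<alpha> D L \<omega> - y)) \<in> borel_measurable M"
      by (intro borel_measurable_min borel_measurable_diff max_cont_measurable max_grid_measurable that) auto
    from integral_exp_tail[OF this] show ?thesis by (simp add: less_diff_eq)
  qed
  show ?g1
    unfolding H_cont_grid_def Gam_single(1)[OF D exp_ge_zero, symmetric] Gam_single(2)[OF D exp_ge_zero, symmetric]
  proof (rule tendsto_Lim)
    have "((\<lambda>L. expectation (sup3 D1 D2 (exp (- x)) 0 0 L) / L + expectation (sup3 D1 D2 0 (exp (- y)) 0 L) / L - expectation (sup3 D1 D2 (exp (- x)) (exp (- y)) 0 L) / L)
       \<longlongrightarrow> Gam D1 D2 (exp (- x)) 0 0 + Gam D1 D2 0 (exp (- y)) 0 - Gam D1 D2 (exp (- x)) (exp (- y)) 0) at_top"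
      using D by (intro tendsto_add tendsto_diff Gam_tendsto) auto
    moreover have "\<forall>\<^sub>F L in at_top. expectation (sup3 D1 D2 (exp (- x)) 0 0 L) / L + expectation (sup3 D1 D2 0 (exp (- y)) 0 L) / L - expectation (sup3 D1 D2 (exp (- x)) (exp (- y)) 0 L) / L
       = inverse L * (\<integral>s. exp s * \<P>(\<omega> in M. max_cont B \<alpha> L \<omega> > s + x \<and> max_grid B \<alpha> D1 L \<omega> > s + y) \<partial>lborel)"
      using eventually_gt_at_top[of 0]
    proof eventually_elim
      case (elim L)
      have I: "integrable M (sup3 D1 D2 a b d L)" for a b d using D elim by (intro sup3_integrable) auto
      have "exp (min (max_cont B \<alpha> L \<omega> - x) (max_grid B \<alpha> D1 L \<omega> - y))
          = sup3 D1 D2 (exp (- x)) 0 0 L \<omega> + sup3 D1 D2 0 (exp (- y)) 0 L \<omega> - sup3 D1 D2 (exp (- x)) (exp (- y)) 0 L \<omega>" for \<omega>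
        unfolding exp_min_diff by (simp add: sup3_single sup3_pair)
      then have E_eq: "expectation (\<lambda>\<omega>. exp (min (max_cont B \<alpha> L \<omega> - x) (max_grid B \<alpha> D1 L \<omega> - y)))
          = expectation (sup3 D1 D2 (exp (- x)) 0 0 L) + expectation (sup3 D1 D2 0 (exp (- y)) 0 L) - expectation (sup3 D1 D2 (exp (- x)) (exp (- y)) 0 L)"
        using I by simp
      show ?case unfolding tail[OF D(1) less_imp_le[OF elim]] E_eq by (simp add: divide_inverse algebra_simps)
    qed
    ultimately show "((\<lambda>L. inverse L * (\<integral>s. exp s * \<P>(\<omega> in M. max_cont B \<alpha> L \<omega> > s + x \<and> max_grid B \<alpha> D1 L \<omega> > s + y) \<partial>lborel))
       \<longlongrightarrow> Gam D1 D2 (exp (- x)) 0 0 + Gam D1 D2 0 (exp (- y)) 0 - Gam D1 D2 (exp (- x)) (exp (- y)) 0) at_top"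
      by (rule Lim_transform_eventually)
  qed simp
  show ?g2
    unfolding H_cont_grid_def Gam_single(1)[OF D exp_ge_zero, symmetric] Gam_single(3)[OF D exp_ge_zero, symmetric]
  proof (rule tendsto_Lim)
    have "((\<lambda>L. expectation (sup3 D1 D2 (exp (- x)) 0 0 L) / L + expectation (sup3 D1 D2 0 0 (exp (- y)) L) / L - expectation (sup3 D1 D2 (exp (- x)) 0 (exp (- y)) L) / L)
       \<longlongrightarrow> Gam D1 D2 (exp (- x)) 0 0 + Gam D1 D2 0 0 (exp (- y)) - Gam D1 D2 (exp (- x)) 0 (exp (- y))) at_top"
      using D by (intro tendsto_add tendsto_diff Gam_tendsto) auto
    moreover have "\<forall>\<^sub>F L in at_top. expectation (sup3 D1 D2 (exp (- x)) 0 0 L) / L + expectation (sup3 D1 D2 0 0 (exp (- y)) L) / L - expectation (sup3 D1 D2 (exp (- x)) 0 (exp (- y)) L) / L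
       = inverse L * (\<integral>s. exp s * \<P>(\<omega> in M. max_cont B \<alpha> L \<omega> > s + x \<and> max_grid B \<alpha> D2 L \<omega> > s + y) \<partial>lborel)"
      using eventually_gt_at_top[of 0]
    proof eventually_elim
      case (elim L)
      have I: "integrable M (sup3 D1 D2 a b d L)" for a b d using D elim by (intro sup3_integrable) auto
      have "exp (min (max_cont B \<alpha> L \<omega> - x) (max_grid B \<alpha> D2 L \<omega> - y))
          = sup3 D1 D2 (exp (- x)) 0 0 L \<omega> + sup3 D1 D2 0 0 (exp (- y)) L \<omega> - sup3 D1 D2 (exp (- x)) 0 (exp (- y)) L \<omega>" for \<omega>
        unfolding exp_min_diff by (simp add: sup3_single sup3_pair)
      then have E_eq: "expectation (\<lambda>\<omega>. exp (min (max_cont B \<alpha> L \<omega> - x) (max_grid B \<alpha> D2 L \<omega> - y)))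
          = expectation (sup3 D1 D2 (exp (- x)) 0 0 L) + expectation (sup3 D1 D2 0 0 (exp (- y)) L) - expectation (sup3 D1 D2 (exp (- x)) 0 (exp (- y)) L)"
        using I by simp
      show ?case unfolding tail[OF D(2) less_imp_le[OF elim]] E_eq by (simp add: divide_inverse algebra_simps)
    qed
    ultimately show "((\<lambda>L. inverse L * (\<integral>s. exp s * \<P>(\<omega> in M. max_cont B \<alpha> L \<omega> > s + x \<and> max_grid B \<alpha> D2 L \<omega> > s + y) \<partial>lborel))
       \<longlongrightarrow> Gam D1 D2 (exp (- x)) 0 0 + Gam D1 D2 0 0 (exp (- y)) - Gam D1 D2 (exp (- x)) 0 (exp (- y))) at_top"
      by (rule Lim_transform_eventually)
  qed simp
qed

lemma H_grid_grid_eq: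
  assumes D: "0 < D1" "0 < D2"
  shows "H_grid_grid M B \<alpha> D1 D2 y z = exp (- y) * H_grid M B \<alpha> D1 + exp (- z) * H_grid M B \<alpha> D2 - Gam D1 D2 0 (exp (- y)) (exp (- z))"
  unfolding H_grid_grid_def Gam_single(2)[OF D exp_ge_zero, symmetric] Gam_single(3)[OF D exp_ge_zero, symmetric]
proof (rule tendsto_Lim)
  have "((\<lambda>L. expectation (sup3 D1 D2 0 (exp (- y)) 0 L) / L + expectation (sup3 D1 D2 0 0 (exp (- z)) L) / L - expectation (sup3 D1 D2 0 (exp (- y)) (exp (- z)) L) / L)
     \<longlongrightarrow> Gam D1 D2 0 (exp (- y)) 0 + Gam D1 D2 0 0 (exp (- z)) - Gam D1 D2 0 (exp (- y)) (exp (- z))) at_top"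
    using D by (intro tendsto_add tendsto_diff Gam_tendsto) auto
  moreover have "\<forall>\<^sub>F L in at_top. expectation (sup3 D1 D2 0 (exp (- y)) 0 L) / L + expectation (sup3 D1 D2 0 0 (exp (- z)) L) / L - expectation (sup3 D1 D2 0 (exp (- y)) (exp (- z)) L) / L
     = inverse L * (\<integral>s. exp s * \<P>(\<omega> in M. max_grid B \<alpha> D1 L \<omega> > s + y \<and> max_grid B \<alpha> D2 L \<omega> > s + z) \<partial>lborel)"
    using eventually_gt_at_top[of 0]
  proof eventually_elim
    case (elim L)
    have I: "integrable M (sup3 D1 D2 a b d L)" for a b d using D elim by (intro sup3_integrable) auto
    have "(\<lambda>\<omega>. min (max_grid B \<alpha> D1 L \<omega> - y) (max_grid B \<alpha> D2 L \<omega> - z)) \<in> borel_measurable M"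
      using D elim by (intro borel_measurable_min borel_measurable_diff max_grid_measurable) auto
    from integral_exp_tail[OF this]
    have tail: "(\<integral>s. exp s * \<P>(\<omega> in M. max_grid B \<alpha> D1 L \<omega> > s + y \<and> max_grid B \<alpha> D2 L \<omega> > s + z) \<partial>lborel)
      = expectation (\<lambda>\<omega>. exp (min (max_grid B \<alpha> D1 L \<omega> - y) (max_grid B \<alpha> D2 L \<omega> - z)))"
      by (simp add: less_diff_eq)
    have "exp (min (max_grid B \<alpha> D1 L \<omega> - y) (max_grid B \<alpha> D2 L \<omega> - z))
        = sup3 D1 D2 0 (exp (- y)) 0 L \<omega> + sup3 D1 D2 0 0 (exp (- z)) L \<omega> - sup3 D1 D2 0 (exp (- y)) (exp (- z)) L \<omega>" for \<omega>
      unfolding exp_min_diff by (simp add: sup3_single sup3_pair)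
    then have E_eq: "expectation (\<lambda>\<omega>. exp (min (max_grid B \<alpha> D1 L \<omega> - y) (max_grid B \<alpha> D2 L \<omega> - z)))
        = expectation (sup3 D1 D2 0 (exp (- y)) 0 L) + expectation (sup3 D1 D2 0 0 (exp (- z)) L) - expectation (sup3 D1 D2 0 (exp (- y)) (exp (- z)) L)"
      using I by simp
    show ?case unfolding tail E_eq by (simp add: divide_inverse algebra_simps)
  qed
  ultimately show "((\<lambda>L. inverse L * (\<integral>s. exp s * \<P>(\<omega> in M. max_grid B \<alpha> D1 L \<omega> > s + y \<and> max_grid B \<alpha> D2 L \<omega> > s + z) \<partial>lborel))
     \<longlongrightarrow> Gam D1 D2 0 (exp (- y)) 0 + Gam D1 D2 0 0 (exp (- z)) - Gam D1 D2 0 (exp (- y)) (exp (- z))) at_top"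
    by (rule Lim_transform_eventually)
qed simp

lemma min_incl_excl: "min a (min b c) = a + b + c - max a b - max a c - max b c + max a (max b c)" for a b c :: real
  by (auto simp: min_def max_def)

lemma H_cont_grid_grid_eq:
  assumes D: "0 < D1" "0 < D2"
  shows "H_cont_grid_grid M B \<alpha> D1 D2 x y z
    = exp (- x) * H_cont M B \<alpha> + exp (- y) * H_grid M B \<alpha> D1 + exp (- z) * H_grid M B \<alpha> D2
      - Gam D1 D2 (exp (- x)) (exp (- y)) 0 - Gam D1 D2 (exp (- x)) 0 (exp (- z)) - Gam D1 D2 0 (exp (- y)) (exp (- z))
      + Gam D1 D2 (exp (- x)) (exp (- y)) (exp (- z))"
  unfolding H_cont_grid_grid_def Gam_single(1)[OF D exp_ge_zero, symmetric] Gam_single(2)[OF D exp_ge_zero, symmetric]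
    Gam_single(3)[OF D exp_ge_zero, symmetric]
proof (rule tendsto_Lim)
  let ?e = "\<lambda>a b c L. expectation (sup3 D1 D2 a b c L) / L"
  let ?x = "exp (- x)" and ?y = "exp (- y)" and ?z = "exp (- z)"
  have "((\<lambda>L. ?e ?x 0 0 L + ?e 0 ?y 0 L + ?e 0 0 ?z L - ?e ?x ?y 0 L - ?e ?x 0 ?z L - ?e 0 ?y ?z L + ?e ?x ?y ?z L)
     \<longlongrightarrow> Gam D1 D2 ?x 0 0 + Gam D1 D2 0 ?y 0 + Gam D1 D2 0 0 ?z - Gam D1 D2 ?x ?y 0 - Gam D1 D2 ?x 0 ?z - Gam D1 D2 0 ?y ?z + Gam D1 D2 ?x ?y ?z) at_top"
    using D by (intro tendsto_add tendsto_diff Gam_tendsto) auto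
  moreover have "\<forall>\<^sub>F L in at_top. ?e ?x 0 0 L + ?e 0 ?y 0 L + ?e 0 0 ?z L - ?e ?x ?y 0 L - ?e ?x 0 ?z L - ?e 0 ?y ?z L + ?e ?x ?y ?z L
     = inverse L * (\<integral>s. exp s * \<P>(\<omega> in M. max_cont B \<alpha> L \<omega> > s + x \<and> max_grid B \<alpha> D1 L \<omega> > s + y \<and> max_grid B \<alpha> D2 L \<omega> > s + z) \<partial>lborel)"
    using eventually_gt_at_top[of 0]
  proof eventually_elim
    case (elim L)
    have I: "integrable M (sup3 D1 D2 a b d L)" for a b d using D elim by (intro sup3_integrable) auto
    let ?U = "\<lambda>\<omega>. min (max_cont B \<alpha> L \<omega> - x) (min (max_grid B \<alpha> D1 L \<omega> - y) (max_grid B \<alpha> D2 L \<omega> - z))"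
    have "?U \<in> borel_measurable M"
      using D elim by (intro borel_measurable_min borel_measurable_diff max_cont_measurable max_grid_measurable) auto
    from integral_exp_tail[OF this]
    have tail: "(\<integral>s. exp s * \<P>(\<omega> in M. max_cont B \<alpha> L \<omega> > s + x \<and> max_grid B \<alpha> D1 L \<omega> > s + y \<and> max_grid B \<alpha> D2 L \<omega> > s + z) \<partial>lborel)
      = expectation (\<lambda>\<omega>. exp (?U \<omega>))"
      by (simp add: less_diff_eq)
    have "exp (?U \<omega>) = sup3 D1 D2 ?x 0 0 L \<omega> + sup3 D1 D2 0 ?y 0 L \<omega> + sup3 D1 D2 0 0 ?z L \<omega>
        - sup3 D1 D2 ?x ?y 0 L \<omega> - sup3 D1 D2 ?x 0 ?z L \<omega> - sup3 D1 D2 0 ?y ?z L \<omega> + sup3 D1 D2 ?x ?y ?z L \<omega>" for \<omega>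
    proof -
      have mono: "exp (min a b) = min (exp a) (exp b)" for a b :: real by (simp add: min_def)
      have eq: "exp (max_cont B \<alpha> L \<omega> - x) = ?x * exp (max_cont B \<alpha> L \<omega>)"
          "exp (max_grid B \<alpha> D1 L \<omega> - y) = ?y * exp (max_grid B \<alpha> D1 L \<omega>)"
          "exp (max_grid B \<alpha> D2 L \<omega> - z) = ?z * exp (max_grid B \<alpha> D2 L \<omega>)"
        by (simp_all add: exp_add[symmetric])
      show ?thesis
        unfolding mono eq unfolding min_incl_excl by (simp add: sup3_single sup3_pair) (simp add: sup3_def)
    qed
    then have E_eq: "expectation (\<lambda>\<omega>. exp (?U \<omega>))
      = expectation (sup3 D1 D2 ?x 0 0 L) + expectation (sup3 D1 D2 0 ?y 0 L) + expectation (sup3 D1 D2 0 0 ?z L)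
        - expectation (sup3 D1 D2 ?x ?y 0 L) - expectation (sup3 D1 D2 ?x 0 ?z L) - expectation (sup3 D1 D2 0 ?y ?z L)
        + expectation (sup3 D1 D2 ?x ?y ?z L)"
      using I by simp
    show ?case unfolding tail E_eq by (simp add: divide_inverse algebra_simps)
  qed
  ultimately show "((\<lambda>L. inverse L * (\<integral>s. exp s * \<P>(\<omega> in M. max_cont B \<alpha> L \<omega> > s + x \<and> max_grid B \<alpha> D1 L \<omega> > s + y \<and> max_grid B \<alpha> D2 L \<omega> > s + z) \<partial>lborel))
     \<longlongrightarrow> Gam D1 D2 ?x 0 0 + Gam D1 D2 0 ?y 0 + Gam D1 D2 0 0 ?z - Gam D1 D2 ?x ?y 0 - Gam D1 D2 ?x 0 ?z - Gam D1 D2 0 ?y ?z + Gam D1 D2 ?x ?y ?z) at_top"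
    by (rule Lim_transform_eventually)
qed simp

end

section \<open>The exponent functions of the theorem\<close>

lemma exp_max_3:
  fixes v :: "real^3"
  shows "exp_max a v = max (a 1 * exp (- v $ 1)) (max (a 2 * exp (- v $ 2)) (a 3 * exp (- v $ 3)))"
  by (rule antisym) (auto simp: exp_max_le_iff forall_3 intro: exp_max_ge)

lemma exponent_function_exp_max:
  fixes a :: "'n::finite \<Rightarrow> real"
  assumes "\<And>i. 0 \<le> a i" shows "exponent_function (exp_max a)"
proof -
  interpret N: prob_space std_normal_distribution by (rule prob_space_normal_density) simp
  have "exponent_function (\<lambda>v. \<integral>\<omega>. exp_max (\<lambda>i. a i) v \<partial>std_normal_distribution)"
    by (rule exponent_function_expectation[where U = "\<lambda>i _. a i"]) (use assms N.prob_space_axioms in auto)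
  moreover have "(\<lambda>v. \<integral>\<omega>. exp_max (\<lambda>i. a i) v \<partial>std_normal_distribution) = exp_max a"
    using N.prob_space by (intro ext) simp
  ultimately show ?thesis by simp
qed

lemma exponent_function_single:
  assumes "0 \<le> a" shows "exponent_function (\<lambda>v :: real^'n. a * exp (- v $ i))"
proof -
  have "exp_max (\<lambda>j. if j = i then a else 0) v = a * exp (- v $ i)" for v :: "real^'n"
  proof (rule antisym)
    show "exp_max (\<lambda>j. if j = i then a else 0) v \<le> a * exp (- v $ i)"
      using assms by (auto simp: exp_max_le_iff)
    show "a * exp (- v $ i) \<le> exp_max (\<lambda>j. if j = i then a else 0) v"
      using exp_max_ge[of "\<lambda>j. if j = i then a else 0" i v] by simp
  qed
  then have "(\<lambda>v :: real^'n. a * exp (- v $ i)) = exp_max (\<lambda>j. if j = i then a else 0)"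
    by (simp add: fun_eq_iff)
  then show ?thesis
    using exponent_function_exp_max[of "\<lambda>j. if j = i then a else 0"] assms by simp
qed

context fbm
begin

text \<open>The random weight of coordinate \<open>i\<close> is \<open>sup3\<close> with the
  coefficients of \<open>i\<close>, divided by \<open>L\<close>. Separate coefficient functions for
  the three suprema let one supremum serve several coordinates, as in \<open>f6\<close>.\<close>

lemma exponent_function_Gam:
  fixes a1 a2 a3 :: "'n::finite \<Rightarrow> real"
  assumes D: "0 < D1" "0 < D2" and a: "\<And>i. 0 \<le> a1 i" "\<And>i. 0 \<le> a2 i" "\<And>i. 0 \<le> a3 i"
  shows "exponent_function (\<lambda>v. Gam D1 D2 (exp_max a1 v) (exp_max a2 v) (exp_max a3 v))"
proof (rule exponent_function_limit)
  fix n :: nat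
  define L where "L = real (Suc n)"
  have L: "0 < L" by (simp add: L_def)
  have ef: "exponent_function (\<lambda>v. \<integral>\<omega>. exp_max (\<lambda>i. 1 / L * sup3 D1 D2 (a1 i) (a2 i) (a3 i) L \<omega>) v \<partial>M)"
  proof (rule exponent_function_expectation[OF prob_space_axioms])
    show "integrable M (\<lambda>\<omega>. 1 / L * sup3 D1 D2 (a1 i) (a2 i) (a3 i) L \<omega>)" for i
      using D L by (intro integrable_mult_right sup3_integrable) auto
    show "0 \<le> 1 / L * sup3 D1 D2 (a1 i) (a2 i) (a3 i) L \<omega>" for i \<omega>
      using L a by (intro mult_nonneg_nonneg sup3_nonneg) auto
  qed
  \<comment> \<open>Two maxima are interchanged, the one over the coordinates and the one over the
    three suprema.\<close>
  have eq: "exp_max (\<lambda>i. sup3 D1 D2 (a1 i) (a2 i) (a3 i) L \<omega>) v = sup3 D1 D2 (exp_max a1 v) (exp_max a2 v) (exp_max a3 v) L \<omega>" for \<omega> v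
  proof -
    have scaled: "exp_max b v * e \<le> s \<longleftrightarrow> (\<forall>i. b i * e * exp (- v $ i) \<le> s)" if "0 < e" for b :: "'n \<Rightarrow> real" and e s
    proof -
      have "exp_max b v * e = exp_max (\<lambda>i. e * b i) v" using that by (simp add: exp_max_scale mult.commute)
      then show ?thesis by (simp only: exp_max_le_iff) (simp add: mult_ac)
    qed
    have "exp_max (\<lambda>i. sup3 D1 D2 (a1 i) (a2 i) (a3 i) L \<omega>) v \<le> s
        \<longleftrightarrow> sup3 D1 D2 (exp_max a1 v) (exp_max a2 v) (exp_max a3 v) L \<omega> \<le> s" for s
    proof -
      have 3: "max p (max q r) * exp t \<le> s \<longleftrightarrow> p * exp t \<le> s \<and> q * exp t \<le> s \<and> r * exp t \<le> s" for p q r t :: real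
        by (simp add: max_mult_distrib_right)
      show ?thesis
        unfolding sup3_def exp_max_le_iff 3 max.bounded_iff scaled[OF exp_gt_zero] by blast
    qed
    then show ?thesis by (meson antisym order_refl)
  qed
  have "(\<integral>\<omega>. exp_max (\<lambda>i. 1 / L * sup3 D1 D2 (a1 i) (a2 i) (a3 i) L \<omega>) v \<partial>M)
      = expectation (sup3 D1 D2 (exp_max a1 v) (exp_max a2 v) (exp_max a3 v) L) / L" for v
    using L by (simp only: exp_max_scale eq zero_le_divide_1_iff less_imp_le integral_mult_right_zero) simp
  then show "exponent_function (\<lambda>v. expectation (sup3 D1 D2 (exp_max a1 v) (exp_max a2 v) (exp_max a3 v) (real (Suc n))) / real (Suc n))"
    using ef by (simp only: L_def)
next
  fix v :: "real^'n"
  have nn: "0 \<le> exp_max a1 v" "0 \<le> exp_max a2 v" "0 \<le> exp_max a3 v" using a by (auto intro: exp_max_nonneg)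
  have "filterlim (\<lambda>n. real (Suc n)) at_top sequentially"
    using filterlim_real_sequentially by (rule filterlim_compose) (rule filterlim_Suc)
  then show "(\<lambda>n. expectation (sup3 D1 D2 (exp_max a1 v) (exp_max a2 v) (exp_max a3 v) (real (Suc n))) / real (Suc n))
      \<longlonglongrightarrow> Gam D1 D2 (exp_max a1 v) (exp_max a2 v) (exp_max a3 v)"
    by (rule filterlim_compose[OF Gam_tendsto[OF D nn]])
qed

text \<open>Normalised so that a weight \<open>c\<close> with the two others 0 gives
  \<open>c\<close>; this is the effect of adding the logarithms of the constants to the
  superscripts.\<close>

definition nGam :: "real \<Rightarrow> real \<Rightarrow> real \<Rightarrow> real \<Rightarrow> real \<Rightarrow> real" where
  "nGam D1 D2 c1 c2 c3 = Gam D1 D2 (c1 / H_cont M B \<alpha>) (c2 / H_grid M B \<alpha> D1) (c3 / H_grid M B \<alpha> D2)"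

lemma nGam_bounds:
  assumes D: "0 < D1" "0 < D2" and c: "0 \<le> c1" "0 \<le> c2" "0 \<le> c3"
  shows "c1 \<le> nGam D1 D2 c1 c2 c3" "c2 \<le> nGam D1 D2 c1 c2 c3" "c3 \<le> nGam D1 D2 c1 c2 c3"
    "nGam D1 D2 c1 c2 c3 \<le> c1 + c2 + c3"
  using Gam_lower[OF D, of "c1 / H_cont M B \<alpha>" "c2 / H_grid M B \<alpha> D1" "c3 / H_grid M B \<alpha> D2"]
    Gam_upper[OF D, of "c1 / H_cont M B \<alpha>" "c2 / H_grid M B \<alpha> D1" "c3 / H_grid M B \<alpha> D2"]
    H_cont_pos H_grid_pos[OF D(1)] H_grid_pos[OF D(2)] c
  by (simp_all add: nGam_def less_imp_le)

lemma exponent_function_nGam: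
  fixes a1 a2 a3 :: "'n::finite \<Rightarrow> real"
  assumes D: "0 < D1" "0 < D2" and a: "\<And>i. 0 \<le> a1 i" "\<And>i. 0 \<le> a2 i" "\<And>i. 0 \<le> a3 i"
  shows "exponent_function (\<lambda>v. nGam D1 D2 (exp_max a1 v) (exp_max a2 v) (exp_max a3 v))"
proof -
  have *: "exp_max b v / h = exp_max (\<lambda>i. 1 / h * b i) v" if "0 < h" for b :: "'n \<Rightarrow> real" and v h
    using that by (simp add: exp_max_scale[of "1 / h" b v, simplified])
  note H = H_cont_pos H_grid_pos[OF D(1)] H_grid_pos[OF D(2)]
  show ?thesis
    unfolding nGam_def *[OF H(1)] *[OF H(2)] *[OF H(3)]
    using a H by (intro exponent_function_Gam[OF D]) (auto simp: less_imp_le)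
qed

lemma exp_neg_ln_add: "0 < (h::real) \<Longrightarrow> exp (- (ln h + x)) = exp (- x) / h"
  by (simp add: exp_diff exp_minus field_simps)

text \<open>The subtracted constant is a sum minus a joint maximum; the sum cancels
  \<open>exp (- x)\<close> and \<open>exp (- z)\<close>.\<close>

lemma f3_eq:
  assumes D: "0 < D1" "0 < D2"
  shows "f3 M B \<alpha> D2 x y z = exp (- y) + nGam D1 D2 (exp (- x)) 0 (exp (- z))"
  using H_cont_pos H_grid_pos[OF D(2)]
  by (simp add: f3_def H_cont_grid_eq(2)[OF D] nGam_def exp_neg_ln_add del: minus_add_distrib)

text \<open>Inclusion--exclusion run backwards: all single and pair terms of the four constants
  cancel against \<open>exp (- x) + exp (- y) + exp (- z)\<close>, leaving the triple
  maximum.\<close>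

lemma f5_eq:
  assumes D: "0 < D1" "0 < D2"
  shows "f5 M B \<alpha> D1 D2 x y z = nGam D1 D2 (exp (- x)) (exp (- y)) (exp (- z))"
  using H_cont_pos H_grid_pos[OF D(1)] H_grid_pos[OF D(2)]
  by (simp add: f5_def H_cont_grid_eq(1)[OF D] H_cont_grid_eq(2)[OF D] H_grid_grid_eq[OF D] H_cont_grid_grid_eq[OF D]
      nGam_def exp_neg_ln_add del: minus_add_distrib)

text \<open>A minimum of arguments is a maximum of weights, so the supremum over the interval
  carries the larger of two weights.\<close>

lemma f6_eq:
  assumes D: "0 < D1" "0 < D2"
  shows "f6 M B \<alpha> D1 x y z = nGam D1 D2 (max (exp (- x)) (exp (- z))) (exp (- y)) 0"
proof -
  have "max (exp (- x)) (exp (- z)) = exp (- min x z)" by (simp add: min_def max_def)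
  then show ?thesis
    using H_cont_pos H_grid_pos[OF D(1)]
    by (simp add: f6_def H_cont_grid_eq(1)[OF D] nGam_def exp_neg_ln_add del: minus_add_distrib)
qed

end

section \<open>Verification for the seven functions\<close>

definition admissible :: "(real \<Rightarrow> real \<Rightarrow> real \<Rightarrow> real) \<Rightarrow> bool" where
  "admissible f \<longleftrightarrow> exponent_function (\<lambda>v :: real^3. f (v $ 1) (v $ 2) (v $ 3)) \<and>
     (\<forall>x y z. exp (- x) \<le> f x y z \<and> exp (- y) \<le> f x y z \<and> exp (- z) \<le> f x y z \<and>
        f x y z \<le> exp (- x) + exp (- y) + exp (- z))"

lemma exp_neg_min: "exp (- min x y) = max (exp (- x)) (exp (- y))" for x y :: real
  by (simp add: min_def max_def)

lemma admissible_f1: "admissible f1"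
proof -
  have "exponent_function (\<lambda>v :: real^3. 1 * exp (- v $ 1) + 1 * exp (- v $ 2) + 1 * exp (- v $ 3))"
    by (intro exponent_function_add exponent_function_single) auto
  then show ?thesis by (auto simp: admissible_def f1_def add_nonneg_nonneg)
qed

text \<open>The condition decides which of \<open>exp (- y - \<theta>1)\<close> and
  \<open>exp (- z - \<theta>2)\<close> is the smaller. That one is subtracted, and a minimum is the
  sum minus the maximum.\<close>

lemma f2_eq:
  "f2 \<theta>1 \<theta>2 x y z = exp (- x) + (1 - exp (- \<theta>1)) * exp (- y) + (1 - exp (- \<theta>2)) * exp (- z)
     + max (exp (- \<theta>1) * exp (- y)) (exp (- \<theta>2) * exp (- z))"
proof -
  have "exp (- \<theta>2) * exp (- z) \<le> exp (- \<theta>1) * exp (- y) \<longleftrightarrow> \<not> y > z + (\<theta>2 - \<theta>1)"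
    by (simp add: exp_add[symmetric] not_less algebra_simps)
  then show ?thesis
    by (auto simp: f2_def max_def exp_add[symmetric] algebra_simps)
qed

text \<open>Nonnegative \<theta>1 and \<theta>2 make the coefficients
  \<open>1 - exp (- \<theta>1)\<close> and \<open>1 - exp (- \<theta>2)\<close> nonnegative, so
  \<open>f2\<close> is a sum of exponent functions.\<close>

lemma admissible_f2: assumes "0 \<le> \<theta>1" "0 \<le> \<theta>2" shows "admissible (f2 \<theta>1 \<theta>2)"
proof -
  define a where "a i = (if i = 2 then exp (- \<theta>1) else if i = 3 then exp (- \<theta>2) else 0)" for i :: 3
  have a: "exp_max a v = max (exp (- \<theta>1) * exp (- v $ 2)) (exp (- \<theta>2) * exp (- v $ 3))" for v
    unfolding exp_max_3 a_def by (simp add: max.absorb2 le_max_iff_disj)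
  have "exponent_function (\<lambda>v :: real^3. 1 * exp (- v $ 1) + (1 - exp (- \<theta>1)) * exp (- v $ 2) + (1 - exp (- \<theta>2)) * exp (- v $ 3) + exp_max a v)"
    using assms by (intro exponent_function_add exponent_function_single exponent_function_exp_max) (auto simp: a_def)
  then have 1: "exponent_function (\<lambda>v :: real^3. f2 \<theta>1 \<theta>2 (v $ 1) (v $ 2) (v $ 3))" by (simp add: a f2_eq)
  have "exp (- x) \<le> f2 \<theta>1 \<theta>2 x y z \<and> exp (- y) \<le> f2 \<theta>1 \<theta>2 x y z \<and> exp (- z) \<le> f2 \<theta>1 \<theta>2 x y z \<and>
        f2 \<theta>1 \<theta>2 x y z \<le> exp (- x) + exp (- y) + exp (- z)" for x y z
  proof -
    define p q where "p = exp (- \<theta>1) * exp (- y)" and "q = exp (- \<theta>2) * exp (- z)"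
    have "0 \<le> p" "0 \<le> q" "p \<le> exp (- y)" "q \<le> exp (- z)"
      using assms by (auto simp: p_def q_def mult_le_cancel_right1)
    moreover have "f2 \<theta>1 \<theta>2 x y z = exp (- x) + (exp (- y) - p) + (exp (- z) - q) + max p q"
      unfolding f2_eq p_def q_def by (simp add: left_diff_distrib)
    moreover have "0 < exp (- x)" "0 < exp (- y)" "0 < exp (- z)" by simp_all
    ultimately show ?thesis by (auto simp: max_def)
  qed
  then show ?thesis using 1 by (auto simp: admissible_def)
qed

lemma admissible_f4: "admissible f4"
proof -
  define a where "a i = (if i = 2 then 0 else 1 :: real)" for i :: 3
  have a: "exp_max a v = max (exp (- v $ 1)) (exp (- v $ 3))" for v
    unfolding exp_max_3 a_def by (simp add: max.absorb2)
  have "exponent_function (\<lambda>v :: real^3. 1 * exp (- v $ 2) + exp_max a v)"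
    by (intro exponent_function_add exponent_function_single exponent_function_exp_max) (auto simp: a_def)
  then show ?thesis
    by (auto simp: admissible_def f4_def exp_neg_min a max_def add_nonneg_nonneg intro: add_increasing add_increasing2)
qed

lemma admissible_f7: "admissible f7"
proof -
  have a: "exp_max (\<lambda>i. 1) v = f7 (v $ 1) (v $ 2) (v $ 3)" for v :: "real^3"
    unfolding exp_max_3 f7_def exp_neg_min by simp
  have "exponent_function (exp_max (\<lambda>i :: 3. 1))" by (rule exponent_function_exp_max) simp
  then have "exponent_function (\<lambda>v :: real^3. f7 (v $ 1) (v $ 2) (v $ 3))"
    unfolding a[symmetric] .
  then show ?thesis
    by (auto simp: admissible_def f7_def exp_neg_min max_def add_nonneg_nonneg intro: add_increasing add_increasing2)
qed

context fbm
begin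

lemma exp_max_unit:
  fixes v :: "real^3"
  shows "exp_max (\<lambda>j. if j = i then 1 else 0) v = exp (- v $ i)"
  using exhaust_3[of i] unfolding exp_max_3 by (auto simp: max.absorb1 max.absorb2)

lemma exp_max_zero:
  fixes v :: "real^3"
  shows "exp_max (\<lambda>_. 0) v = 0"
  unfolding exp_max_3 by simp

lemma admissible_f3:
  assumes D: "0 < (D1 :: real)" "0 < D2" shows "admissible (f3 M B \<alpha> D2)"
proof -
  have "exponent_function (\<lambda>v :: real^3. 1 * exp (- v $ 2) +
      nGam D1 D2 (exp_max (\<lambda>j. if j = 1 then 1 else 0) v) (exp_max (\<lambda>_. 0) v) (exp_max (\<lambda>j. if j = 3 then 1 else 0) v))"
    by (intro exponent_function_add exponent_function_single exponent_function_nGam[OF D]) auto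
  then have 1: "exponent_function (\<lambda>v :: real^3. f3 M B \<alpha> D2 (v $ 1) (v $ 2) (v $ 3))"
    by (simp add: exp_max_unit exp_max_zero f3_eq[OF D])
  have "exp (- x) \<le> f3 M B \<alpha> D2 x y z \<and> exp (- y) \<le> f3 M B \<alpha> D2 x y z \<and> exp (- z) \<le> f3 M B \<alpha> D2 x y z \<and>
        f3 M B \<alpha> D2 x y z \<le> exp (- x) + exp (- y) + exp (- z)" for x y z
    using nGam_bounds[OF D exp_ge_zero[of "- x"] order_refl exp_ge_zero[of "- z"]] exp_gt_zero[of "- y"] exp_gt_zero[of "- x"]
    unfolding f3_eq[OF D] by linarith
  then show ?thesis using 1 by (auto simp: admissible_def)
qed

lemma admissible_f5:
  assumes D: "0 < D1" "0 < D2" shows "admissible (f5 M B \<alpha> D1 D2)"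
proof -
  have "exponent_function (\<lambda>v :: real^3. nGam D1 D2 (exp_max (\<lambda>j. if j = 1 then 1 else 0) v)
      (exp_max (\<lambda>j. if j = 2 then 1 else 0) v) (exp_max (\<lambda>j. if j = 3 then 1 else 0) v))"
    by (intro exponent_function_nGam[OF D]) auto
  then have 1: "exponent_function (\<lambda>v :: real^3. f5 M B \<alpha> D1 D2 (v $ 1) (v $ 2) (v $ 3))"
    by (simp add: exp_max_unit f5_eq[OF D])
  then show ?thesis
    unfolding admissible_def f5_eq[OF D] using nGam_bounds[OF D exp_ge_zero exp_ge_zero exp_ge_zero] by blast
qed

lemma admissible_f6:
  assumes D: "0 < D1" "0 < (D2 :: real)" shows "admissible (f6 M B \<alpha> D1)"
proof -
  define a where "a i = (if i = 2 then 0 else 1 :: real)" for i :: 3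
  have a: "exp_max a v = max (exp (- v $ 1)) (exp (- v $ 3))" for v
    unfolding exp_max_3 a_def by (simp add: max.absorb2)
  have "exponent_function (\<lambda>v :: real^3. nGam D1 D2 (exp_max a v) (exp_max (\<lambda>j. if j = 2 then 1 else 0) v) (exp_max (\<lambda>_. 0) v))"
    by (intro exponent_function_nGam[OF D]) (auto simp: a_def)
  then have 1: "exponent_function (\<lambda>v :: real^3. f6 M B \<alpha> D1 (v $ 1) (v $ 2) (v $ 3))"
    by (simp add: exp_max_unit exp_max_zero a f6_eq[OF D])
  have "exp (- x) \<le> f6 M B \<alpha> D1 x y z \<and> exp (- y) \<le> f6 M B \<alpha> D1 x y z \<and> exp (- z) \<le> f6 M B \<alpha> D1 x y z \<and>
        f6 M B \<alpha> D1 x y z \<le> exp (- x) + exp (- y) + exp (- z)" for x y z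
  proof -
    have m: "0 \<le> max (exp (- x)) (exp (- z))" by (simp add: le_max_iff_disj)
    show ?thesis
      using nGam_bounds[OF D m exp_ge_zero[of "- y"] order_refl] exp_gt_zero[of "- z"] exp_gt_zero[of "- x"]
      unfolding f6_eq[OF D] by linarith
  qed
  then show ?thesis using 1 by (auto simp: admissible_def)
qed

end

theorem mainTheorem3:
  fixes M :: "'a measure" and B :: "real \<Rightarrow> 'a \<Rightarrow> real"
    and N :: "'b measure" and Z :: "'b \<Rightarrow> real^'p"
    and r :: "real^'p^'p"
    and \<alpha> D1 D2 \<theta>1 \<theta>2 :: real
    and f :: "real \<Rightarrow> real \<Rightarrow> real \<Rightarrow> real"
  assumes "0 < \<alpha>" and "\<alpha> \<le> 2"
    and "fractional_brownian_motion M (\<alpha> / 2) B"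
    and "\<And>k l. 0 \<le> r $ k $ l"
    and "positive_definite (cov_matrix r)"
    and "centered_gaussian_vector N Z (cov_matrix r)"
    and "0 < D1" and "0 < D2" and "D1 \<noteq> D2"
    and "0 \<le> \<theta>1" and "0 \<le> \<theta>2"
    and "f \<in> {f1, f2 \<theta>1 \<theta>2, f3 M B \<alpha> D2, f4, f5 M B \<alpha> D1 D2, f6 M B \<alpha> D1, f7}"
  shows "\<exists>\<mu> :: ((real^'p) \<times> (real^'p) \<times> (real^'p)) measure.
           distribution_function_of \<mu> (\<lambda>(x, y1, y2). G_fun N Z r f x y1 y2) \<and>
           non_degenerate \<mu> \<and>
           ((\<forall>k. r $ k $ k = 0) \<longrightarrow>
              unit_Gumbel_marginals \<mu> \<and>
              (\<forall>x y1 y2. \<forall>n::nat. n \<ge> 1 \<longrightarrow>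
                 (G_fun N Z r f (x + vec (ln (real n))) (y1 + vec (ln (real n)))
                    (y2 + vec (ln (real n)))) ^ n
                 = G_fun N Z r f x y1 y2))"
proof -
  interpret fbm M B \<alpha>
    using assms by unfold_locales
  have "admissible f"
    using assms(12) admissible_f1 admissible_f2[OF assms(10,11)] admissible_f3[OF assms(7,8)] admissible_f4
      admissible_f5[OF assms(7,8)] admissible_f6[OF assms(7,8)] admissible_f7
    by blast
  then have f: "exponent_function (\<lambda>v :: real^3. f (v $ 1) (v $ 2) (v $ 3))"
    and bounds: "\<And>x y z. exp (- x) \<le> f x y z" "\<And>x y z. exp (- y) \<le> f x y z" "\<And>x y z. exp (- z) \<le> f x y z"
      "\<And>x y z. f x y z \<le> exp (- x) + exp (- y) + exp (- z)"
    by (auto simp: admissible_def)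
  have N: "prob_space N" and Z_gaussian: "jointly_gaussian N UNIV (\<lambda>k \<omega>. Z \<omega> $ k)"
    using assms(6) by (auto simp: centered_gaussian_vector_def)
  \<comment> \<open>Measurability is part of \<open>gaussian_rv\<close>, applied to a linear
    combination with a single term.\<close>
  have Z: "(\<lambda>\<omega>. Z \<omega> $ k) \<in> borel_measurable N" for k
    using Z_gaussian[unfolded jointly_gaussian_def, rule_format, of "{k}" "\<lambda>_. 1"]
    by (simp add: gaussian_rv_def)
  show ?thesis by (rule max_stable_mixture[OF N Z f bounds])
qed

end
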